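(* For every irrational slope $\theta$, the geodesic flow in the direction of slope $\theta$ on the surface $S_1$ is recurrent.
   Context: $S_1$ is the translation surface defined as follows. Let $Q^+$ be the convex hull of the points $(n,n^2)$, $n\in\mathbb{Z}$, and let $Q^-$ be its image under the rotation by $\pi$ (the convex hull of the points $(n,-n^2)$). $S_1$ is obtained by gluing each edge of $Q^+$ by a translation to its image edge (under the rotation by $\pi$) in $Q^-$. It has two singular points (images of vertices) of infinite cone angle, infinite genus and infinite area. The geodesic flow in a direction moves points at unit speed along straight lines in that direction (defined until a singularity is reached). It is recurrent if for every finite (bounded) transversal $I$ to the foliation of $S_1$ by leaves in the given direction, almost every point of $I$ (with respect to the transverse measure, i.e. Euclidean width) returns to $I$ under the flow, i.e. the first return map to $I$ is defined almost everywhere. *)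

theory Defs
  imports "HOL-Analysis.Analysis"
begin

section \<open>Translation surfaces given by charts\<close>

text \<open>
  A translation atlas on (the regular part of) a surface with points in \<open>'a\<close> is a set of local
  parametrisations: pairs \<open>(U, \<psi>)\<close> of an open set \<open>U\<close> in the plane and an injection \<open>\<psi>\<close> of \<open>U\<close> into
  the surface, the changes of charts being translations. Singular points are not covered.
\<close>

type_synonym 'a atlas = "((real \<times> real) set \<times> (real \<times> real \<Rightarrow> 'a)) set"

text \<open>
  A geodesic defined on a time interval \<open>J\<close> is a curve which in suitable charts is \<open>s \<mapsto> p + s v\<close>.
  As it stays in the image of the charts, it never meets a singularity.
\<close>

definition geodesic :: "'a atlas \<Rightarrow> real \<times> real \<Rightarrow> real set \<Rightarrow> (real \<Rightarrow> 'a) \<Rightarrow> bool" where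
  "geodesic A v J \<gamma> \<longleftrightarrow>
     (\<forall>t\<in>J. \<exists>(U, \<psi>)\<in>A. \<exists>p. \<exists>e>0. \<forall>s\<in>J \<inter> ball t e.
        p + (s - t) *\<^sub>R v \<in> U \<and> \<gamma> s = \<psi> (p + (s - t) *\<^sub>R v))"

text \<open>
  The flow for time \<open>t \<ge> 0\<close> in the direction \<open>v\<close>, as a relation: it is a partial function, undefined
  at \<open>x\<close> when a singularity is reached.
\<close>

definition flows_to :: "'a atlas \<Rightarrow> real \<times> real \<Rightarrow> real \<Rightarrow> 'a \<Rightarrow> 'a \<Rightarrow> bool" where
  "flows_to A v t x y \<longleftrightarrow> (\<exists>\<gamma>. geodesic A v {0..t} \<gamma> \<and> \<gamma> 0 = x \<and> \<gamma> t = y)"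

text \<open>
  For a unit vector \<open>v\<close>, the signed Euclidean distance from the line through \<open>0\<close> directed by \<open>v\<close>;
  its level sets are the leaves of the foliation of the plane in the direction \<open>v\<close>.
\<close>

definition transverse_coord :: "real \<times> real \<Rightarrow> real \<times> real \<Rightarrow> real" where
  "transverse_coord v p = fst v * snd p - snd v * fst p"

text \<open>
  A transversal is an arc on which the transverse coordinate is locally a homeomorphism onto its
  image. It is parametrised here by its transverse measure (much as one parametrises a curve by
  arc length), so that the transverse measure is Lebesgue measure on the parameter interval \<open>J\<close>.
  The arc may be open or closed at each end (so it may end at a singularity) and need not be
  injective (so closed transversals are included).
\<close>

definition transversal :: "'a atlas \<Rightarrow> real \<times> real \<Rightarrow> real set \<Rightarrow> (real \<Rightarrow> 'a) \<Rightarrow> bool" where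
  "transversal A v J \<sigma> \<longleftrightarrow> is_interval J \<and>
     (\<forall>t\<in>J. \<exists>(U, \<psi>)\<in>A. \<exists>c. \<exists>e>0. continuous_on (J \<inter> ball t e) c \<and>
        (\<forall>s\<in>J \<inter> ball t e. c s \<in> U \<and> \<sigma> s = \<psi> (c s) \<and>
           transverse_coord v (c s) - transverse_coord v (c t) = s - t))"

text \<open>
  With the above parametrisation, \<open>bounded J\<close> says that the transversal has finite width; compact
  transversals and transversals of finite length satisfy this.
\<close>

definition recurrent :: "'a atlas \<Rightarrow> real \<times> real \<Rightarrow> bool" where
  "recurrent A v \<longleftrightarrow>
     (\<forall>J \<sigma>. transversal A v J \<sigma> \<and> bounded J \<longrightarrow>
        (AE s in lebesgue_on J. \<exists>t>0. \<exists>y\<in>\<sigma> ` J. flows_to A v t (\<sigma> s) y))"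


section \<open>The surface \<open>S\<^sub>1\<close>\<close>

definition vertex :: "int \<Rightarrow> real \<times> real" where
  "vertex n = (of_int n, (of_int n)\<^sup>2)"

definition Q_plus :: "(real \<times> real) set" where
  "Q_plus = convex hull (range vertex)"

definition Q_minus :: "(real \<times> real) set" where
  "Q_minus = uminus ` Q_plus"

definition edge :: "int \<Rightarrow> (real \<times> real) set" where
  "edge n = closed_segment (vertex n) (vertex (n + 1))"

definition shift :: "int \<Rightarrow> real \<times> real" where
  "shift n = - vertex n - vertex (n + 1)"

lemma shift_edge: "(\<lambda>p. p + shift n) ` edge n = uminus ` edge n"
proof -
  have "(\<lambda>p. p + shift n) ` edge n = (+) (shift n) ` edge n"
    by (simp add: add.commute)
  also have "\<dots> = closed_segment (- vertex (n + 1)) (- vertex n)"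
    unfolding edge_def closed_segment_translation[symmetric] by (simp add: shift_def)
  also have "\<dots> = uminus ` edge n"
    unfolding edge_def
    by (subst closed_segment_linear_image[symmetric])
       (auto intro: linear_uminus simp: closed_segment_commute)
  finally show ?thesis .
qed

text \<open>
  The surface is the quotient of the disjoint union of \<open>Q\<^sup>+\<close> and \<open>Q\<^sup>-\<close> by the equivalence
  relation generated by the gluings of the edges; its points are equivalence classes.
\<close>

definition gluing :: "((real \<times> real) + (real \<times> real)) rel" where
  "gluing = {(Inl p, Inr (p + shift n)) |n p. p \<in> edge n}"

definition glued :: "((real \<times> real) + (real \<times> real)) rel" where
  "glued = (gluing \<union> gluing\<inverse>)\<^sup>*"

type_synonym S1_point = "((real \<times> real) + (real \<times> real)) set"

definition S1 :: "S1_point set" where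
  "S1 = (Q_plus <+> Q_minus) // glued"

definition S1_singularities :: "S1_point set" where
  "S1_singularities = (range vertex <+> uminus ` range vertex) // glued"

text \<open>
  The chart at the edge \<open>n\<close> develops in the plane the interiors of the two polygons and the open
  edge \<open>n\<close> along which they are glued.
\<close>

definition chart_domain :: "int \<Rightarrow> (real \<times> real) set" where
  "chart_domain n = interior Q_plus \<union> open_segment (vertex n) (vertex (n + 1)) \<union>
     (\<lambda>q. q - shift n) ` interior Q_minus"

definition chart :: "int \<Rightarrow> real \<times> real \<Rightarrow> S1_point" where
  "chart n p = glued `` {if p \<in> Q_plus then Inl p else Inr (p + shift n)}"

definition S1_atlas :: "S1_point atlas" where
  "S1_atlas = range (\<lambda>n. (chart_domain n, chart n))"

section \<open>The charts form a translation atlas of the complement of the singularities\<close>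

text \<open>The equation of the line through the vertices \<open>n\<close> and \<open>n + 1\<close>.\<close>

definition chord :: "int \<Rightarrow> real \<Rightarrow> real" where "chord n x = (2 * of_int n + 1) * x - of_int n * (of_int n + 1)"

lemma chord_le: assumes "of_int n \<le> x" "x \<le> of_int n + 1" shows "chord m x \<le> chord n x"
proof -
  have "chord n x - chord m x = (of_int n - of_int m) * (2*x - of_int n - of_int m - 1)" by (simp add: chord_def algebra_simps)
  also have "\<dots> \<ge> 0"
  proof (cases n m rule: linorder_cases)
    case less
    then have "(of_int n::real) + 1 \<le> of_int m" by linarith
    then show ?thesis using assms by (intro mult_nonpos_nonpos) linarith+
  next
    case greater
    then have "(of_int m::real) + 1 \<le> of_int n" by linarith
    then show ?thesis using assms by (intro mult_nonneg_nonneg) linarith+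
  qed auto
  finally show ?thesis by simp
qed

lemma chord_vertex: "chord n (of_int k) \<le> (of_int k)\<^sup>2"
  using chord_le[of k "of_int k" n] by (simp add: chord_def power2_eq_square algebra_simps)

lemma edge_iff: "(x,y) \<in> edge n \<longleftrightarrow> of_int n \<le> x \<and> x \<le> of_int n + 1 \<and> y = chord n x"
proof
  assume "(x,y) \<in> edge n"
  then obtain u where "0\<le>u" "u\<le>1" "x = (1-u) * of_int n + u * (of_int n+1)" "y = (1-u) * (of_int n)^2 + u * (of_int n+1)^2"
    by (auto simp: edge_def closed_segment_def vertex_def)
  then show "of_int n \<le> x \<and> x \<le> of_int n + 1 \<and> y = chord n x"
    by (auto simp: chord_def algebra_simps power2_eq_square)
next
  assume a: "of_int n \<le> x \<and> x \<le> of_int n + 1 \<and> y = chord n x"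
  then show "(x,y) \<in> edge n" unfolding edge_def closed_segment_def vertex_def
    by (auto intro!: exI[of _ "x - of_int n"] simp: chord_def algebra_simps power2_eq_square)
qed

lemma edge_subset_Q_plus: "edge n \<subseteq> Q_plus"
  unfolding edge_def Q_plus_def
  by (meson closed_segment_subset_convex_hull hull_inc rangeI)

lemma Q_plus_iff: "(x,y) \<in> Q_plus \<longleftrightarrow> (\<forall>n. chord n x \<le> y)"
proof
  have "Q_plus \<subseteq> {p. \<forall>n. chord n (fst p) \<le> snd p}"
    unfolding Q_plus_def
  proof (rule hull_minimal)
    show "range vertex \<subseteq> {p. \<forall>n. chord n (fst p) \<le> snd p}" by (auto simp: vertex_def chord_vertex)
    have "{p. \<forall>n. chord n (fst p) \<le> snd p} = (\<Inter>n. {p. (2 * of_int n + 1, -1) \<bullet> p \<le> of_int n * (of_int n + 1)})"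
      by (auto simp: chord_def inner_prod_def algebra_simps)
    then show "convex {p. \<forall>n. chord n (fst p) \<le> snd p}"
      by (simp add: convex_INT convex_halfspace_le)
  qed
  then show "(x,y) \<in> Q_plus \<Longrightarrow> (\<forall>n. chord n x \<le> y)" by auto
next
  assume a: "\<forall>n. chord n x \<le> y"
  define n where "n = \<lfloor>x\<rfloor>"
  have 1: "(x, chord n x) \<in> Q_plus" using edge_subset_Q_plus[of n] edge_iff[of x "chord n x" n] unfolding n_def by auto
  obtain N::nat where N: "of_nat N > max \<bar>x\<bar> (max \<bar>y\<bar> 1)" using reals_Archimedean2 by blast
  have "(x, (of_nat N)^2) \<in> closed_segment (vertex (-int N)) (vertex (int N))"
    unfolding closed_segment_def vertex_def using N
    by (auto intro!: exI[of _ "(x + N) / (2*N)"] simp: field_simps power2_eq_square)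
  then have 2: "(x, (of_nat N)^2) \<in> Q_plus" unfolding Q_plus_def
    by (meson closed_segment_subset_convex_hull hull_inc rangeI subsetD)
  have "(of_nat N::real) * 1 \<le> (of_nat N)^2" unfolding power2_eq_square using N by (intro mult_left_mono) auto
  then have "y \<le> (of_nat N)^2" using N by linarith
  then have "y \<in> closed_segment (chord n x) ((of_nat N)^2)" using a[rule_format, of n] by (auto simp: closed_segment_eq_real_ivl)
  then have "(x,y) \<in> closed_segment (x, chord n x) (x, (of_nat N)^2)"
    by (auto simp: closed_segment_def algebra_simps)
  moreover have "convex Q_plus" unfolding Q_plus_def by (rule convex_convex_hull)
  ultimately show "(x,y) \<in> Q_plus" using 1 2 closed_segment_subset by blast
qed

lemma interior_Q_plus_iff: "(x,y) \<in> interior Q_plus \<longleftrightarrow> (\<forall>n. chord n x < y)"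
proof
  assume "(x,y) \<in> interior Q_plus"
  then obtain e where e: "e>0" "ball (x,y) e \<subseteq> Q_plus" using mem_interior by blast
  have "(x,y - e/2) \<in> ball (x,y) e" using e by (simp add: dist_prod_def dist_real_def)
  then have "(x,y-e/2) \<in> Q_plus" using e by blast
  then show "\<forall>n. chord n x < y" unfolding Q_plus_iff using e(1) by (smt (verit) half_gt_zero)
next
  assume a: "\<forall>n. chord n x < y"
  define n where "n = \<lfloor>x\<rfloor>"
  show "(x,y) \<in> interior Q_plus"
  proof (cases "x = of_int n")
    case True
    let ?O = "{p. of_int n - 1 < fst p \<and> fst p < of_int n + 1 \<and> chord n (fst p) < snd p \<and> chord (n-1) (fst p) < snd p}"
    have "open ?O" unfolding chord_def by (intro open_Collect_conj open_Collect_less continuous_intros)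
    moreover have "(x,y) \<in> ?O" using a True by auto
    moreover have "?O \<subseteq> Q_plus"
    proof 
      fix p assume p: "p \<in> ?O"
      obtain a b where ab: "p = (a,b)" by force
      show "p \<in> Q_plus" unfolding ab Q_plus_iff
      proof
        fix m show "chord m a \<le> b" using p chord_le[of n a m] chord_le[of "n-1" a m] unfolding ab by (cases "a \<ge> of_int n") auto
      qed
    qed
    ultimately show ?thesis by (meson interiorI)
  next
    case False
    let ?O = "{p. of_int n < fst p \<and> fst p < of_int n + 1 \<and> chord n (fst p) < snd p}"
    have "open ?O" unfolding chord_def by (intro open_Collect_conj open_Collect_less continuous_intros)
    moreover have "(x,y) \<in> ?O" using a False unfolding n_def by auto linarith
    moreover have "?O \<subseteq> Q_plus"
    proof 
      fix p assume p: "p \<in> ?O"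
      obtain a b where ab: "p = (a,b)" by force
      show "p \<in> Q_plus" unfolding ab Q_plus_iff
      proof
        fix m show "chord m a \<le> b" using p chord_le[of n a m] unfolding ab by auto
      qed
    qed
    ultimately show ?thesis by (meson interiorI)
  qed
qed

lemma Q_plus_eq: "Q_plus = interior Q_plus \<union> (\<Union>n. edge n)"
proof (intro equalityI subsetI)
  fix p assume p: "p \<in> Q_plus"
  obtain x y where xy: "p = (x,y)" by force
  have le: "chord n x \<le> y" for n using p unfolding xy Q_plus_iff by auto
  show "p \<in> interior Q_plus \<union> (\<Union>n. edge n)"
  proof (cases "\<forall>n. chord n x < y")
    case True then show ?thesis unfolding xy using interior_Q_plus_iff by auto
  next
    case False
    then obtain n where "chord n x = y" using le by (meson not_less antisym)
    moreover have "chord (n+1) x \<le> y" "chord (n-1) x \<le> y" using le by auto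
    ultimately have "(x,y) \<in> edge n" unfolding edge_iff by (auto simp: chord_def algebra_simps)
    then show ?thesis unfolding xy by auto
  qed
qed (use interior_subset edge_subset_Q_plus in auto)

lemma edge_notin_interior: "p \<in> edge n \<Longrightarrow> p \<notin> interior Q_plus"
  by (cases p) (auto simp: interior_Q_plus_iff edge_iff)

lemma open_edge_eq: "open_segment (vertex n) (vertex (n+1)) = edge n - range vertex"
proof -
  have "k = n \<or> k = n+1" if "vertex k \<in> edge n" for k
    using that unfolding vertex_def edge_iff by linarith
  moreover have "vertex n \<in> edge n" "vertex (n+1) \<in> edge n" by (auto simp: edge_def)
  ultimately show ?thesis unfolding open_segment_def edge_def[symmetric] by blast
qed

lemma interior_Q_minus_below: assumes "q \<in> interior Q_minus" shows "q - shift n \<notin> Q_plus"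
proof -
  have im: "interior Q_minus = uminus ` interior Q_plus"
    unfolding Q_minus_def by (rule interior_negations)
  then obtain x y where "q = (-x,-y)" "(x,y) \<in> interior Q_plus" using assms by auto
  then have "chord n x < y" using interior_Q_plus_iff by auto
  then show ?thesis unfolding \<open>q = _\<close>
    by (simp add: shift_def vertex_def Q_plus_iff not_le) (rule exI[of _ n], simp add: chord_def algebra_simps power2_eq_square)
qed

lemma equiv_glued: "equiv UNIV glued"
  unfolding glued_def equiv_def
  by (auto simp: refl_on_def sym_Un_converse sym_rtrancl trans_rtrancl)

lemma glued_vertices: assumes "(a,b) \<in> glued" "a \<in> range vertex <+> uminus ` range vertex"
  shows "b \<in> range vertex <+> uminus ` range vertex"
  using assms unfolding glued_def
proof (induction rule: rtrancl_induct)
  case base then show ?case by simp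
next
  case (step y z)
  have A: "p \<in> range vertex \<longleftrightarrow> p + shift n \<in> uminus ` range vertex" if "p \<in> edge n" for p n
  proof
    assume "p \<in> range vertex"
    then obtain k where k: "p = vertex k" by blast
    then have "vertex k \<in> edge n" using that by simp
    then have "k = n \<or> k = n + 1" unfolding vertex_def edge_iff by linarith
    then have "p = vertex n \<or> p = vertex (n + 1)" using k by blast
    then show "p + shift n \<in> uminus ` range vertex" by (auto simp: shift_def)
  next
    assume "p + shift n \<in> uminus ` range vertex"
    then obtain k where k: "p = vertex n + vertex (n+1) - vertex k" by (auto simp: shift_def algebra_simps)
    then have "k = n \<or> k = n + 1" using that unfolding vertex_def by (auto simp: edge_iff)
    then show "p \<in> range vertex" using k by auto
  qed
  from step have "y \<in> range vertex <+> uminus ` range vertex" by simp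
  moreover have "(\<exists>n p. p \<in> edge n \<and> y = Inl p \<and> z = Inr (p + shift n)) \<or> (\<exists>n p. p \<in> edge n \<and> z = Inl p \<and> y = Inr (p + shift n))"
    using step(2) unfolding gluing_def by blast
  ultimately show ?case
  proof (elim disjE exE conjE)
    fix n p assume *: "p \<in> edge n" "y = Inl p" "z = Inr (p + shift n)" "y \<in> range vertex <+> uminus ` range vertex"
    then have "p \<in> range vertex" by (elim PlusE) simp_all
    then show ?case using A[OF *(1)] *(3) by blast
  next
    fix n p assume *: "p \<in> edge n" "z = Inl p" "y = Inr (p + shift n)" "y \<in> range vertex <+> uminus ` range vertex"
    then have "p + shift n \<in> uminus ` range vertex" by (elim PlusE) simp_all
    then show ?case using A[OF *(1)] *(2) by blast
  qed
qed

lemma S1_charts: "(\<Union>(U, \<psi>)\<in>S1_atlas. \<psi> ` U) = S1 - S1_singularities"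
proof -
  have eqc: "glued `` {a} = glued `` {b} \<longleftrightarrow> (a,b) \<in> glued" for a b
    using eq_equiv_class_iff[OF equiv_glued] by blast
  have sing: "glued `` {a} \<in> S1_singularities \<longleftrightarrow> a \<in> range vertex <+> uminus ` range vertex" for a
  proof
    assume "glued `` {a} \<in> S1_singularities"
    then obtain b where b: "b \<in> range vertex <+> uminus ` range vertex" "glued `` {a} = glued `` {b}"
      unfolding S1_singularities_def by (rule quotientE)
    then have "(b, a) \<in> glued" by (intro eqc[THEN iffD1]) simp
    then show "a \<in> range vertex <+> uminus ` range vertex" using b(1) by (rule glued_vertices)
  next
    assume "a \<in> range vertex <+> uminus ` range vertex"
    then show "glued `` {a} \<in> S1_singularities" unfolding S1_singularities_def by (rule quotientI)
  qed
  have S1I: "glued `` {a} \<in> S1" if "a \<in> Q_plus <+> Q_minus" for a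
    using that unfolding S1_def by (rule quotientI)
  have im: "interior Q_minus = uminus ` interior Q_plus"
    unfolding Q_minus_def by (rule interior_negations)
  have ve: "vertex k \<in> edge k" for k by (auto simp: edge_def)
  have vi: "vertex k \<notin> interior Q_plus" for k using edge_notin_interior ve by blast
  show ?thesis
  proof (intro equalityI subsetI)
    fix X assume "X \<in> (\<Union>(U, \<psi>)\<in>S1_atlas. \<psi> ` U)"
    then obtain n p where X: "X = chart n p" and p: "p \<in> chart_domain n" unfolding S1_atlas_def by auto
    show "X \<in> S1 - S1_singularities"
    proof (cases "p \<in> interior Q_plus \<union> open_segment (vertex n) (vertex (n + 1))")
      case True
      then have p_in: "p \<in> Q_plus" and p_nv: "p \<notin> range vertex"
        using interior_subset[of Q_plus] edge_subset_Q_plus[of n] open_edge_eq[of n] vi by blast+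
      have "X = glued `` {Inl p}" unfolding X chart_def using p_in by simp
      moreover have "Inl p \<notin> range vertex <+> uminus ` range vertex" using p_nv by blast
      moreover have "Inl p \<in> Q_plus <+> Q_minus" using p_in by (rule InlI)
      ultimately show ?thesis using S1I sing by simp
    next
      case False
      then obtain q where q: "p = q - shift n" "q \<in> interior Q_minus" using p unfolding chart_domain_def by blast
      have "X = glued `` {Inr q}"
        unfolding X chart_def q(1) using interior_Q_minus_below[OF q(2), of n] by simp
      moreover have "q \<notin> uminus ` range vertex"
      proof
        assume "q \<in> uminus ` range vertex"
        then obtain k where "q = - vertex k" by blast
        moreover obtain r where "q = - r" "r \<in> interior Q_plus" using q(2) unfolding im by blast
        ultimately show False using vi[of k] by simp
      qed
      then have "Inr q \<notin> range vertex <+> uminus ` range vertex" by blast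
      moreover have "Inr q \<in> Q_plus <+> Q_minus" using q(2) interior_subset[of Q_minus] by blast
      ultimately show ?thesis using S1I sing by simp
    qed
  next
    fix X assume X: "X \<in> S1 - S1_singularities"
    have L: "X \<in> (\<Union>(U, \<psi>)\<in>S1_atlas. \<psi> ` U)" if "X = glued `` {Inl p}" "p \<in> Q_plus" for p
    proof -
      have "Inl p \<notin> range vertex <+> uminus ` range vertex" using X that(1) sing by simp
      then have "p \<notin> range vertex" using InlI by metis
      moreover have "p \<in> interior Q_plus \<union> (\<Union>n. edge n)" using that(2) Q_plus_eq by simp
      then obtain n where "p \<in> interior Q_plus \<or> p \<in> edge n" by auto
      ultimately have "p \<in> chart_domain n" unfolding chart_domain_def open_edge_eq by simp
      moreover have "X = chart n p" using that unfolding chart_def by auto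
      ultimately show ?thesis unfolding S1_atlas_def by auto
    qed
    from X obtain a where a: "X = glued `` {a}" "a \<in> Q_plus <+> Q_minus" unfolding S1_def
      by (blast elim: quotientE)
    show "X \<in> (\<Union>(U, \<psi>)\<in>S1_atlas. \<psi> ` U)"
    proof (cases a)
      case (Inl p) then show ?thesis using L a by auto
    next
      case (Inr q)
      then have q: "q \<in> Q_minus" using a by auto
      show ?thesis
      proof (cases "q \<in> interior Q_minus")
        case True
        then have "q - shift 0 \<in> chart_domain 0" "X = chart 0 (q - shift 0)"
          using interior_Q_minus_below[OF True, of 0] True a(1) Inr unfolding chart_domain_def chart_def by simp_all
        then show ?thesis unfolding S1_atlas_def by auto
      next
        case False
        obtain r where r: "q = - r" "r \<in> Q_plus" using q unfolding Q_minus_def by blast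
        then have "r \<notin> interior Q_plus" using False unfolding im by blast
        then obtain n where "r \<in> edge n" using r(2) Q_plus_eq by auto
        then have "q \<in> uminus ` edge n" using r(1) by blast
        then obtain p where p: "p \<in> edge n" "q = p + shift n" unfolding shift_edge[symmetric] by auto
        then have "(Inl p, Inr q) \<in> glued" unfolding glued_def gluing_def by blast
        then have "glued `` {Inl p} = glued `` {Inr q}" by (rule eqc[THEN iffD2])
        then have "X = glued `` {Inl p}" using a(1) Inr by simp
        then show ?thesis using L p edge_subset_Q_plus by blast
      qed
    qed
  qed
qed


lemma interior_Q_minus_noteq: "q \<in> interior Q_minus \<Longrightarrow> q \<noteq> p + shift n" if "p \<in> edge n"
proof
  assume q: "q \<in> interior Q_minus" "q = p + shift n"
  have "interior Q_minus = uminus ` interior Q_plus"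
    unfolding Q_minus_def by (rule interior_negations)
  then obtain r where "q = - r" "r \<in> interior Q_plus" using q by auto
  moreover have "q \<in> uminus ` edge n" using q that shift_edge by blast
  ultimately show False using edge_notin_interior by (metis imageE neg_equal_iff_equal)
qed

lemma glued_Inr: assumes "(Inr q, b) \<in> glued" "q \<in> interior Q_minus" shows "b = Inr q"
  using assms(1) unfolding glued_def
proof (induction rule: rtrancl_induct)
  case (step y z)
  then show ?case using assms(2) interior_Q_minus_noteq unfolding gluing_def by blast
qed simp

lemma glued_Inl: assumes "(Inl p, b) \<in> glued" "p \<in> Q_plus" "p \<notin> range vertex"
  shows "b = Inl p \<or> (\<exists>n. p \<in> edge n \<and> b = Inr (p + shift n))"
  using assms(1) unfolding glued_def
proof (induction rule: rtrancl_induct)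
  case (step y z)
  have "m = n" if "p \<in> edge n" "p' \<in> edge m" "p + shift n = p' + shift m" for n m p'
  proof -
    obtain x y where p: "p = (x,y)" by force
    obtain x' y' where p': "p' = (x',y')" by force
    have e: "x - (2 * of_int n + 1) = x' - (2 * of_int m + 1)"
      using that(3) unfolding p p' by (simp add: shift_def vertex_def)
    have "p \<in> open_segment (vertex n) (vertex (n+1))" using open_edge_eq that assms by blast
    then have "p \<noteq> vertex n" "p \<noteq> vertex (n+1)" using assms by auto
    then have "of_int n < x" "x < of_int n + 1"
      using that(1) unfolding p edge_iff vertex_def by (auto simp: chord_def less_le algebra_simps power2_eq_square)
    moreover have "of_int m \<le> x'" "x' \<le> of_int m + 1" using that(2) unfolding p' edge_iff by auto
    ultimately show "m = n" using e by linarith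
  qed
  then show ?case using step(2,3) unfolding gluing_def by fastforce
qed simp

lemma chart_change:
  assumes "p \<in> chart_domain n" "q \<in> chart_domain m" "chart n p = chart m q"
  shows "q = p \<or> q = p + (shift n - shift m)"
proof -
  have eqc: "glued `` {a} = glued `` {b} \<longleftrightarrow> (a,b) \<in> glued" for a b
    using eq_equiv_class_iff[OF equiv_glued] by blast
  have ve: "vertex k \<in> edge k" for k by (auto simp: edge_def)
  have vi: "vertex k \<notin> interior Q_plus" for k using edge_notin_interior ve by blast
  have D: "(p \<in> Q_plus \<and> p \<notin> range vertex \<and> chart n p = glued `` {Inl p}) \<or>
    (p + shift n \<in> interior Q_minus \<and> chart n p = glued `` {Inr (p + shift n)})" if h: "p \<in> chart_domain n" for p n
  proof (cases "p \<in> interior Q_plus \<union> open_segment (vertex n) (vertex (n + 1))")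
    case True
    then have p_in: "p \<in> Q_plus" and p_nv: "p \<notin> range vertex"
        using interior_subset[of Q_plus] edge_subset_Q_plus[of n] open_edge_eq[of n] vi by blast+
    show ?thesis using p_in p_nv by (simp add: chart_def)
  next
    case False
    then obtain q where q: "p = q - shift n" "q \<in> interior Q_minus" using h unfolding chart_domain_def by blast
    then show ?thesis using interior_Q_minus_below[OF q(2), of n] by (simp add: chart_def)
  qed
  have X: False if "(Inl p, Inr q) \<in> glued" "p \<in> Q_plus" "p \<notin> range vertex" "q \<in> interior Q_minus" for p q
    using glued_Inl[OF that(1-3)] interior_Q_minus_noteq that(4) by blast
  have sym: "(a,b) \<in> glued \<Longrightarrow> (b,a) \<in> glued" for a b using equiv_glued by (meson equivE symE)
  have eq: "(a, b) \<in> glued" if "chart n p = glued `` {a}" "chart m q = glued `` {b}" for a b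
    using that assms(3) by (intro eqc[THEN iffD1]) simp
  from D[OF assms(1)] D[OF assms(2)] show ?thesis
  proof (elim disjE conjE)
    assume *: "p \<in> Q_plus" "p \<notin> range vertex" "chart n p = glued `` {Inl p}"
      "chart m q = glued `` {Inl q}"
    have "(Inl p, Inl q) \<in> glued" using *(3,4) by (rule eq)
    then show ?thesis using glued_Inl[of p "Inl q"] *(1,2) by auto
  next
    assume *: "p + shift n \<in> interior Q_minus" "chart n p = glued `` {Inr (p + shift n)}"
      "chart m q = glued `` {Inr (q + shift m)}"
    have "(Inr (p + shift n), Inr (q + shift m)) \<in> glued" using *(2,3) by (rule eq)
    then have "q + shift m = p + shift n" using glued_Inr[OF _ *(1)] by blast
    then show ?thesis by (simp add: algebra_simps)
  next
    assume *: "p \<in> Q_plus" "p \<notin> range vertex" "chart n p = glued `` {Inl p}"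
      "q + shift m \<in> interior Q_minus" "chart m q = glued `` {Inr (q + shift m)}"
    have "(Inl p, Inr (q + shift m)) \<in> glued" using *(3,5) by (rule eq)
    then show ?thesis using X *(1,2,4) by blast
  next
    assume *: "p + shift n \<in> interior Q_minus" "chart n p = glued `` {Inr (p + shift n)}"
      "q \<in> Q_plus" "q \<notin> range vertex" "chart m q = glued `` {Inl q}"
    have "(Inl q, Inr (p + shift n)) \<in> glued" using eq[OF *(2,5)] by (rule sym)
    then show ?thesis using X *(1,3,4) by blast
  qed
qed

lemma inj_chart: "inj_on (chart n) (chart_domain n)"
  using chart_change[of _ n _ n] by (fastforce simp: inj_on_def)

lemma open_chart: "open (chart_domain n)"
proof -
  let ?S = "{p. of_int n < fst p \<and> fst p < of_int n + 1 \<and> chord (n-1) (fst p) < snd p \<and> chord (n+1) (fst p) < snd p \<and>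
     (let r = - (p + shift n) in chord (n-1) (fst r) < snd r \<and> chord (n+1) (fst r) < snd r)}"
  have im: "interior Q_minus = uminus ` interior Q_plus"
    unfolding Q_minus_def by (rule interior_negations)
  have "open ?S" unfolding chord_def Let_def
    by (intro open_Collect_conj open_Collect_less continuous_intros)
  have "?S \<subseteq> chart_domain n"
  proof
    fix p assume a: "p \<in> ?S"
    obtain x y where p: "p = (x,y)" by force
    define x' y' where "x' = of_int n + of_int (n+1) - x" and "y' = (of_int n)^2 + (of_int (n+1))^2 - y"
    have r: "- (p + shift n) = (x',y')" by (simp add: p x'_def y'_def shift_def vertex_def)
    have x: "of_int n < x" "x < of_int n + 1" using a p by auto
    then have x': "of_int n \<le> x'" "x' \<le> of_int n + 1" by (auto simp: x'_def)
    have y: "chord n x - y = y' - chord n x'" by (simp add: x'_def y'_def chord_def algebra_simps power2_eq_square)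
    consider "y > chord n x" | "y = chord n x" | "y < chord n x" by linarith
    then show "p \<in> chart_domain n"
    proof cases
      case 1
      then have "p \<in> interior Q_plus" unfolding p interior_Q_plus_iff using chord_le[of n x] x less_imp_le le_less_trans by blast
      then show ?thesis unfolding chart_domain_def by auto
    next
      case 2
      then have "p \<in> edge n" using x p edge_iff by auto
      moreover have "p \<noteq> vertex k" for k using x unfolding p vertex_def by (auto; linarith)
      ultimately show ?thesis unfolding chart_domain_def open_edge_eq by blast
    next
      case 3
      then have "chord n x' < y'" using y by linarith
      then have "- (p + shift n) \<in> interior Q_plus"
        unfolding r interior_Q_plus_iff using chord_le[OF x'] le_less_trans by blast
      then have "- (- (p + shift n)) \<in> interior Q_minus" unfolding im by (rule imageI)
      then have "(p + shift n) - shift n \<in> (\<lambda>q. q - shift n) ` interior Q_minus" by (intro imageI) (simp only: minus_minus)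
      then show ?thesis unfolding chart_domain_def by simp
    qed
  qed
  moreover have "open_segment (vertex n) (vertex (n + 1)) \<subseteq> ?S"
  proof
    fix p assume a: "p \<in> open_segment (vertex n) (vertex (n + 1))"
    obtain x y where p: "p = (x,y)" by force
    have e: "p \<in> edge n" "p \<notin> range vertex" using a open_edge_eq by auto
    then have "p \<noteq> vertex n" "p \<noteq> vertex (n+1)" by auto
    then have "of_int n < x" "x < of_int n + 1" "y = chord n x"
      using e(1) unfolding p edge_iff vertex_def by (auto simp: chord_def less_le algebra_simps power2_eq_square)
    then show "p \<in> ?S" unfolding p by (auto simp: chord_def Let_def shift_def vertex_def algebra_simps power2_eq_square)
  qed
  ultimately have "chart_domain n = interior Q_plus \<union> ?S \<union> (\<lambda>q. q - shift n) ` interior Q_minus"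
    unfolding chart_domain_def by blast
  moreover have "open ((\<lambda>q. q - shift n) ` interior Q_minus)"
    by (rule open_translation_subtract[OF open_interior])
  ultimately show ?thesis using \<open>open ?S\<close> by (simp only: open_Un open_interior)
qed

end

theory Submission
  imports Defs
begin

text \<open>
A leaf of slope \<open>\<theta>\<close> runs alternately through chords of \<open>Q\<^sup>+\<close> and of \<open>Q\<^sup>-\<close>. After rotating \<open>Q\<^sup>-\<close>
onto \<open>Q\<^sup>+\<close> every chord becomes a chord of \<open>Q\<^sup>+\<close>, described by the intercept \<open>b\<close> of the line
\<open>y = \<theta> x + b\<close> that carries it. Crossing the edge \<open>n\<close> reflects \<open>b\<close> in the interval bounded by the
intercepts of the vertices \<open>n\<close> and \<open>n + 1\<close> and reverses the direction of motion. So the flow is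
governed by the map \<open>return_map \<theta>\<close> of the real line, which flips first the intervals of the edges
on the right and then those of the edges on the left. It preserves Lebesgue measure, and the flow
is recurrent as soon as this map is conservative (\<open>return_map_conservative\<close>).

To prove that it is conservative, let \<open>mass \<theta> j\<close> be the measure of the chords from which a leaf
leaves for ever the set \<open>core \<theta> j\<close> of the chords whose left end, for \<open>\<theta> > 0\<close>, is below the vertex
\<open>- j\<close>. A leaf that leaves a set for ever almost surely has a last visit to any larger set of
finite measure, since the infinitely many disjoint images of a wandering set have finite total
measure in that larger set (\<open>emeasure_escaping_mono\<close>). Hence the measure of the chords left for
ever grows with the set, and \<open>mass \<theta> j\<close> must be shown to vanish. Three facts suffice.

\<^item> The affine automorphism that sends the vertex \<open>n\<close> to the vertex \<open>n - m\<close> changes the slope \<open>\<theta>\<close> to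
  \<open>\<theta> - 2 m\<close> and moves the core by \<open>m\<close> edges: \<open>mass \<theta> j \<le> mass \<bar>\<theta> - 2 m\<bar> (j + m)\<close>
  (\<open>mass_twist_vertical\<close>).

\<^item> The horizontal lines through the vertices cut the surface into cylinders; the one between the
  heights \<open>i\<^sup>2\<close> and \<open>(i + 1)\<^sup>2\<close> has height \<open>2 i + 1\<close> and circumference \<open>2 (2 i + 1)\<close>. A leaf that
  climbs through it is therefore displaced horizontally by \<open>(2 i + 1) / \<theta>\<close> modulo \<open>2 (2 i + 1)\<close>.
  So the passages through all cylinders depend only on \<open>1 / \<theta>\<close> modulo \<open>2\<close>, and \<open>1 / \<theta>\<close> can be
  replaced by \<open>1 / \<theta> - 2 k\<close> at no cost (\<open>mass_twist_horizontal\<close>).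

\<^item> For \<open>0 < \<theta> < 1\<close> a leaf can leave \<open>core \<theta> j\<close> for ever only through the horizontal segment of
  length \<open>2 j\<close> at height \<open>j\<^sup>2\<close>, which has width \<open>2 j \<theta>\<close> (\<open>mass_shallow\<close>).

Written for a direction \<open>(x, y)\<close> instead of a slope, the two reductions are steps of the Euclidean
algorithm with even quotients, and the last bound is \<open>2 j y\<close>, where \<open>j\<close> grows with the quotients
spent while the remainders \<open>x\<close> and \<open>y\<close> decrease. The locale \<open>descent\<close> shows by a potential
argument that for an irrational slope the bound becomes arbitrarily small along the algorithm.
Thus the mass is zero (\<open>mass_eq_0\<close>).
\<close>

section \<open>Escaping points of an automorphism of the line\<close>

text \<open>
The inverse \<open>S\<close> is carried along so that images under \<open>T\<close> can be treated as preimages.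
\<close>

definition lborel_automorphism :: "(real \<Rightarrow> real) \<Rightarrow> (real \<Rightarrow> real) \<Rightarrow> bool" where
  "lborel_automorphism T S \<longleftrightarrow> T \<in> borel_measurable borel \<and> S \<in> borel_measurable borel \<and>
     (\<forall>x. S (T x) = x) \<and> (\<forall>x. T (S x) = x) \<and> (\<forall>A\<in>sets borel. emeasure lborel (S -` A) = emeasure lborel A)"

lemma measurable_vimage_borel: "f \<in> borel_measurable borel \<Longrightarrow> A \<in> sets borel \<Longrightarrow> f -` A \<in> sets borel"
  using measurable_sets[of f borel borel A] by simp

lemma lborel_automorphism_compose:
  assumes "lborel_automorphism T S" "lborel_automorphism T' S'"
  shows "lborel_automorphism (T \<circ> T') (S' \<circ> S)"
proof -
  have "emeasure lborel ((S' \<circ> S) -` A) = emeasure lborel A" if "A \<in> sets borel" for A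
  proof -
    have "(S' \<circ> S) -` A = S -` (S' -` A)" by auto
    then show ?thesis using assms that by (simp add: lborel_automorphism_def measurable_vimage_borel)
  qed
  then show ?thesis using assms by (auto simp: lborel_automorphism_def)
qed

lemma lborel_automorphism_funpow:
  assumes "lborel_automorphism T S"
  shows "lborel_automorphism (T ^^ k) (S ^^ k)"
proof (induction k)
  case 0
  show ?case by (simp add: lborel_automorphism_def)
next
  case (Suc k)
  have "S ^^ Suc k = S ^^ k \<circ> S" by (rule funpow_Suc_right)
  then show ?case using lborel_automorphism_compose[OF assms Suc] by (simp only: funpow.simps)
qed

lemma lborel_automorphism_image:
  assumes "lborel_automorphism T S" "A \<in> sets borel"
  shows "T ` A \<in> sets borel" "emeasure lborel (T ` A) = emeasure lborel A"
proof -
  have "T ` A = S -` A" 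
  proof (intro equalityI subsetI)
    fix y assume "y \<in> S -` A"
    moreover have "y = T (S y)" using assms(1) by (simp add: lborel_automorphism_def)
    ultimately show "y \<in> T ` A" by blast
  qed (use assms(1) in \<open>auto simp: lborel_automorphism_def\<close>)
  then show "T ` A \<in> sets borel" "emeasure lborel (T ` A) = emeasure lborel A"
    using assms by (auto simp: lborel_automorphism_def measurable_vimage_borel)
qed

text \<open>
The part of \<open>A\<close> that leaves \<open>A\<close> for ever; conservativity means that it is negligible for every
\<open>A\<close>.
\<close>

definition escaping :: "(real \<Rightarrow> real) \<Rightarrow> real set \<Rightarrow> real set" where
  "escaping T A = {x\<in>A. \<forall>k\<ge>1. (T ^^ k) x \<notin> A}"

lemma escaping_subset: "escaping T A \<subseteq> A"
  by (auto simp: escaping_def)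

lemma borel_funpow:
  fixes T :: "real \<Rightarrow> real"
  shows "T \<in> borel_measurable borel \<Longrightarrow> (T ^^ k) \<in> borel_measurable borel"
proof (induction k)
  case (Suc k)
  then show ?case using measurable_comp[of "T ^^ k" borel borel T borel] by simp
qed (simp add: id_def)

lemma sets_escaping:
  assumes "T \<in> borel_measurable borel" "A \<in> sets borel"
  shows "escaping T A \<in> sets borel"
proof -
  have "escaping T A = A \<inter> (\<Inter>k\<in>{1..}. - ((T ^^ k) -` A))" by (auto simp: escaping_def)
  also have "\<dots> \<in> sets borel"
    by (intro sets.Int assms sets.countable_INT') (auto intro!: borel_comp measurable_vimage_borel borel_funpow assms)
  finally show ?thesis .
qed

text \<open>
A coincidence of two images would exhibit a later visit to \<open>A\<close>, namely after the difference of the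
two times.
\<close>

lemma escaping_disjoint:
  assumes "lborel_automorphism T S" "k \<noteq> l"
  shows "(T ^^ k) ` escaping T A \<inter> (T ^^ l) ` escaping T A = {}"
proof -
  have *: "(T ^^ k) ` escaping T A \<inter> (T ^^ l) ` escaping T A = {}" if "k < l" for k l
  proof (rule ccontr)
    assume "(T ^^ k) ` escaping T A \<inter> (T ^^ l) ` escaping T A \<noteq> {}"
    then obtain x y where xy: "x \<in> escaping T A" "y \<in> escaping T A" "(T ^^ k) x = (T ^^ l) y" by auto
    have "(T ^^ k) x = (T ^^ k) ((T ^^ (l - k)) y)"
      using xy(3) that funpow_add[of k "l - k" T] by simp
    moreover have inv: "(S ^^ k) ((T ^^ k) z) = z" for z
      using lborel_automorphism_funpow[OF assms(1), of k] by (simp add: lborel_automorphism_def)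
    ultimately have "x = (T ^^ (l - k)) y" by metis
    then show False using xy(1,2) that by (simp add: escaping_def)
  qed
  show ?thesis using *[of k l] *[of l k] assms(2) by (cases "k < l") auto
qed

text \<open>
The images of the pieces \<open>X k\<close> under the respective iterates are disjoint parts of \<open>Y\<close>, so \<open>Y\<close>
bounds their total measure. Below it is used with the visits to a set at time \<open>k\<close>, and with the
last visits at time \<open>k\<close>.
\<close>

lemma sum_emeasure_pieces_le:
  assumes T: "lborel_automorphism T S" and A: "A \<in> sets borel"
    and X: "\<And>k. X k \<in> sets borel" "\<And>k. X k \<subseteq> escaping T A" "\<And>k. (T ^^ k) ` X k \<subseteq> Y"
    and Y: "Y \<in> sets borel"
  shows "(\<Sum>k. emeasure lborel (X k)) \<le> emeasure lborel Y"
proof -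
  have "disjoint_family (\<lambda>k. (T ^^ k) ` X k)"
    unfolding disjoint_family_on_def
  proof (intro ballI impI)
    fix k l :: nat assume "k \<noteq> l"
    from escaping_disjoint[OF T this, of A] show "(T ^^ k) ` X k \<inter> (T ^^ l) ` X l = {}"
      using X(2)[of k] X(2)[of l] by blast
  qed
  moreover have "range (\<lambda>k. (T ^^ k) ` X k) \<subseteq> sets lborel"
    using lborel_automorphism_image(1)[OF lborel_automorphism_funpow[OF T] X(1)] by auto
  ultimately have "(\<Sum>k. emeasure lborel ((T ^^ k) ` X k)) = emeasure lborel (\<Union>k. (T ^^ k) ` X k)"
    by (intro suminf_emeasure)
  moreover have "emeasure lborel ((T ^^ k) ` X k) = emeasure lborel (X k)" for k
    by (rule lborel_automorphism_image(2)[OF lborel_automorphism_funpow[OF T] X(1)])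
  moreover have "emeasure lborel (\<Union>k. (T ^^ k) ` X k) \<le> emeasure lborel Y"
    using X(3) Y by (intro emeasure_mono) auto
  ultimately show ?thesis by simp
qed

text \<open>
Each escaping point of \<open>A\<close> is carried to its last visit to \<open>B\<close>. Such a visit exists for almost all
of them by the Borel-Cantelli lemma, because the visits to \<open>B\<close> at the various times occupy
disjoint subsets of \<open>B\<close>. Different escaping points never reach the same last visit.
\<close>

proposition emeasure_escaping_mono:
  assumes T: "lborel_automorphism T S" and A: "A \<in> sets borel" and B: "B \<in> sets borel"
    and sub: "A \<subseteq> B" and fin: "emeasure lborel B < \<infinity>"
  shows "emeasure lborel (escaping T A) \<le> emeasure lborel (escaping T B)"
proof -
  have Tm: "T \<in> borel_measurable borel" using T by (simp add: lborel_automorphism_def)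
  note pow = borel_funpow[OF Tm]
  define W where "W = escaping T A"
  have W: "W \<in> sets borel" unfolding W_def by (rule sets_escaping[OF Tm A])
  \<comment> \<open>visits and last visits to \<open>B\<close> at time \<open>k\<close>\<close>
  define V where "V k = W \<inter> (T ^^ k) -` B" for k
  define L where "L k = W \<inter> (T ^^ k) -` escaping T B" for k
  have Vs: "V k \<in> sets borel" for k unfolding V_def
    by (intro sets.Int W measurable_vimage_borel pow B)
  have Ls: "L k \<in> sets borel" for k unfolding L_def
    by (intro sets.Int W measurable_vimage_borel pow sets_escaping Tm B)
  have V: "(\<Sum>k. emeasure lborel (V k)) \<le> emeasure lborel B"
    by (rule sum_emeasure_pieces_le[OF T A Vs _ _ B]) (auto simp: V_def W_def)
  have L: "(\<Sum>k. emeasure lborel (L k)) \<le> emeasure lborel (escaping T B)"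
    by (rule sum_emeasure_pieces_le[OF T A Ls _ _ sets_escaping[OF Tm B]]) (auto simp: L_def W_def)
  have Vfin: "emeasure lborel (V k) < \<infinity>" for k
  proof -
    have "emeasure lborel (V k) \<le> (\<Sum>k. emeasure lborel (V k))"
      using sum_le_suminf[of "\<lambda>k. emeasure lborel (V k)" "{k}"] by simp
    then show ?thesis using V fin by (meson le_less_trans)
  qed
  have "summable (\<lambda>k. measure lborel (V k))"
  proof (rule summable_suminf_not_top)
    have "ennreal (measure lborel (V k)) = emeasure lborel (V k)" for k
      using Vfin[of k] by (simp add: emeasure_eq_ennreal_measure less_top)
    then show "(\<Sum>k. ennreal (measure lborel (V k))) \<noteq> top" using V fin by (auto simp: top_unique)
  qed simp
  then have lim: "limsup V \<in> null_sets lborel"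
    using Vs Vfin by (intro borel_cantelli_limsup1) auto
  have "W \<subseteq> (\<Union>k. L k) \<union> limsup V"
  proof
    fix x assume x: "x \<in> W"
    show "x \<in> (\<Union>k. L k) \<union> limsup V"
    proof (cases "finite {k. (T ^^ k) x \<in> B}")
      case True
      define m where "m = Max {k. (T ^^ k) x \<in> B}"
      have "0 \<in> {k. (T ^^ k) x \<in> B}" using x sub by (auto simp: W_def escaping_def)
      then have m: "(T ^^ m) x \<in> B" using Max_in[OF True] unfolding m_def by blast
      have "(T ^^ (k + m)) x \<notin> B" if "k \<ge> 1" for k
        using Max_ge[OF True, of "k + m"] that unfolding m_def[symmetric] by auto
      then have "(T ^^ m) x \<in> escaping T B" using m by (auto simp: escaping_def funpow_add)
      then show ?thesis using x by (auto simp: L_def)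
    next
      case False
      then have "\<forall>n. \<exists>k\<ge>n. x \<in> V k" using x unfolding V_def infinite_nat_iff_unbounded_le by auto
      then show ?thesis by (auto simp: limsup_INF_SUP)
    qed
  qed
  then have "emeasure lborel W \<le> emeasure lborel ((\<Union>k. L k) \<union> limsup V)"
    using Ls lim by (intro emeasure_mono sets.Un) auto
  also have "\<dots> = emeasure lborel (\<Union>k. L k)"
    using Ls lim by (intro emeasure_Un_null_set) auto
  also have "\<dots> \<le> (\<Sum>k. emeasure lborel (L k))"
    using Ls by (intro emeasure_subadditive_countably) auto
  finally show ?thesis using L unfolding W_def by simp
qed

lemma emeasure_vimage_affine:
  fixes c t :: real
  assumes "c \<noteq> 0" "A \<in> sets borel"
  shows "emeasure lborel A = ennreal \<bar>c\<bar> * emeasure lborel ((\<lambda>x. t + c * x) -` A)"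
proof -
  have [measurable]: "A \<in> sets borel" by fact
  have "emeasure lborel A = (\<integral>\<^sup>+x. indicator A x \<partial>lborel)" by simp
  also have "\<dots> = ennreal \<bar>c\<bar> * (\<integral>\<^sup>+x. indicator A (t + c * x) \<partial>lborel)"
    using assms by (intro nn_integral_real_affine) auto
  also have "(\<lambda>x. indicator A (t + c * x) :: ennreal) = indicator ((\<lambda>x. t + c * x) -` A)"
    by (auto simp: indicator_def)
  also have "(\<integral>\<^sup>+x. indicator ((\<lambda>x. t + c * x) -` A) x \<partial>lborel) = emeasure lborel ((\<lambda>x. t + c * x) -` A)"
    by (intro nn_integral_indicator) (auto intro!: measurable_vimage_borel)
  finally show ?thesis .
qed

lemma null_vimage_affine:
  fixes a c :: real
  assumes "c \<noteq> 0" "N \<in> null_sets lborel"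
  shows "(\<lambda>s. a + c * s) -` N \<in> null_sets lborel"
proof -
  have N: "N \<in> sets borel" using assms(2) by auto
  have "ennreal \<bar>c\<bar> * emeasure lborel ((\<lambda>s. a + c * s) -` N) = 0"
    using emeasure_vimage_affine[OF assms(1) N, of a] assms(2) by auto
  then have "emeasure lborel ((\<lambda>s. a + c * s) -` N) = 0" using assms(1) by (simp add: ennreal_eq_0_iff)
  moreover have "(\<lambda>s. a + c * s) -` N \<in> sets borel" by (intro measurable_vimage_borel N) simp
  ultimately show ?thesis by auto
qed

lemma borel_preimage_on:
  assumes "continuous_on K c" "K \<in> sets borel" "S \<in> sets borel"
  shows "{s \<in> K. c s \<in> S} \<in> sets borel"
proof -
  have "c \<in> borel_measurable (restrict_space borel K)" using assms(1) by (rule borel_measurable_continuous_on_restrict)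
  then have "c -` S \<inter> space (restrict_space borel K) \<in> sets (restrict_space borel K)"
    using assms(3) by (rule measurable_sets)
  moreover have "c -` S \<inter> space (restrict_space borel K) = {s \<in> K. c s \<in> S}" by (auto simp: space_restrict_space)
  ultimately show ?thesis using assms(2) by (simp add: sets_restrict_space_iff)
qed

section \<open>The return map on intercepts\<close>

text \<open>
The intercept of the line of slope \<open>\<theta>\<close> through the vertex \<open>n\<close>.
\<close>

definition icpt :: "real \<Rightarrow> int \<Rightarrow> real" where
  "icpt \<theta> n = (of_int n)\<^sup>2 - \<theta> * of_int n"

text \<open>
The interval from \<open>icpt \<theta> n\<close> to \<open>icpt \<theta> (n + 1)\<close> is positively oriented exactly when the slope
\<open>2 n + 1\<close> of the edge \<open>n\<close> exceeds \<open>\<theta>\<close>, i.e. when leaves that move to the right leave \<open>Q\<^sup>+\<close> through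
it. The map \<open>flip \<theta>\<close> is the crossing of such an edge. As the reflection in the vertical axis
exchanges \<open>\<theta>\<close> and \<open>- \<theta>\<close> and the vertices \<open>n\<close> and \<open>- n\<close>, the crossing of an edge by leaves that
move to the left is \<open>flip (- \<theta>)\<close>. Intercepts in no such interval are fixed: they are endpoints, or
belong to lines that miss \<open>Q\<^sup>+\<close>.
\<close>

definition flip :: "real \<Rightarrow> real \<Rightarrow> real" where
  "flip \<theta> b = (if \<exists>n. icpt \<theta> n < b \<and> b < icpt \<theta> (n + 1)
     then (let n = (THE n. icpt \<theta> n < b \<and> b < icpt \<theta> (n + 1)) in icpt \<theta> n + icpt \<theta> (n + 1) - b) else b)"

lemma icpt_uminus: "icpt (- \<theta>) n = icpt \<theta> (- n)"
  by (simp add: icpt_def)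

lemma icpt_diff: "icpt \<theta> m - icpt \<theta> n = (of_int m - of_int n) * (of_int m + of_int n - \<theta>)"
  by (simp add: icpt_def algebra_simps power2_eq_square)

lemma icpt_less_iff: "icpt \<theta> n < icpt \<theta> (n + 1) \<longleftrightarrow> \<theta> < 2 * of_int n + 1"
  using icpt_diff[of \<theta> "n + 1" n] by auto

lemma icpt_mono:
  assumes "\<theta> \<le> 2 * of_int n + 1" "n \<le> m"
  shows "icpt \<theta> n \<le> icpt \<theta> m"
proof (cases "n = m")
  case False
  then have "of_int n + 1 \<le> (of_int m :: real)" using assms(2) by linarith
  then have "0 \<le> (of_int m - of_int n) * (of_int m + of_int n - \<theta>)" 
    using assms(1) by (intro mult_nonneg_nonneg) linarith+
  then show ?thesis using icpt_diff[of \<theta> m n] by simp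
qed simp

lemma icpt_antimono:
  assumes "2 * of_int n - 1 \<le> \<theta>" "m \<le> n"
  shows "icpt \<theta> n \<le> icpt \<theta> m"
  using icpt_mono[of "- \<theta>" "- n" "- m"] assms by (simp add: icpt_uminus)

text \<open>
The intercepts \<open>icpt \<theta> n\<close> are the values of a convex quadratic polynomial, so the positively
oriented intervals are those to the right of its minimum and do not overlap.
\<close>

lemma flip_interval_unique:
  assumes "icpt \<theta> n < b" "b < icpt \<theta> (n + 1)" "icpt \<theta> m < b" "b < icpt \<theta> (m + 1)"
  shows "m = n"
proof -
  have *: False if "icpt \<theta> n < b" "b < icpt \<theta> (n + 1)" "icpt \<theta> m < b" "b < icpt \<theta> (m + 1)" "n < m" for n m
  proof -
    have "\<theta> < 2 * of_int n + 1" using that icpt_less_iff[of \<theta> n] by linarith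
    then have "icpt \<theta> (n + 1) \<le> icpt \<theta> m" using that(5) by (intro icpt_mono) auto
    then show False using that by linarith
  qed
  show ?thesis using *[of n m] *[of m n] assms by (cases n m rule: linorder_cases) auto
qed

lemma flip_eq:
  assumes "icpt \<theta> n < b" "b < icpt \<theta> (n + 1)"
  shows "flip \<theta> b = icpt \<theta> n + icpt \<theta> (n + 1) - b"
proof -
  have "(THE n. icpt \<theta> n < b \<and> b < icpt \<theta> (n + 1)) = n"
    using assms flip_interval_unique by (intro the_equality) blast+
  then show ?thesis using assms by (auto simp: flip_def)
qed

lemma flip_id: "(\<And>n. \<not> (icpt \<theta> n < b \<and> b < icpt \<theta> (n + 1))) \<Longrightarrow> flip \<theta> b = b"
  by (auto simp: flip_def)

lemma flip_cases:
  fixes \<theta> b :: real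
  obtains (flip) n where "icpt \<theta> n < b" "b < icpt \<theta> (n + 1)" "flip \<theta> b = icpt \<theta> n + icpt \<theta> (n + 1) - b"
     "icpt \<theta> n < flip \<theta> b" "flip \<theta> b < icpt \<theta> (n + 1)"
  | (id) "flip \<theta> b = b" "\<And>n. \<not> (icpt \<theta> n < b \<and> b < icpt \<theta> (n + 1))"
proof (cases "\<exists>n. icpt \<theta> n < b \<and> b < icpt \<theta> (n + 1)")
  case True
  then obtain n where n: "icpt \<theta> n < b" "b < icpt \<theta> (n + 1)" by blast
  then show ?thesis using that(1)[OF n flip_eq[OF n]] flip_eq[OF n] by simp
next
  case False
  then show ?thesis using that(2) flip_id by blast
qed

lemma flip_flip: "flip \<theta> (flip \<theta> b) = b"
proof (cases rule: flip_cases[where \<theta> = \<theta> and b = b])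
  case (flip n)
  then show ?thesis using flip_eq[OF flip(4,5)] by simp
qed auto

lemma flip_automorphism: "lborel_automorphism (flip \<theta>) (flip \<theta>)"
proof -
  define I where "I n = {icpt \<theta> n <..< icpt \<theta> (n + 1)}" for n
  define r where "r n b = icpt \<theta> n + icpt \<theta> (n + 1) + (- 1) * b" for n b
  have Ib: "I n \<in> sets borel" for n by (simp add: I_def)
  have rI: "b \<in> I n \<longleftrightarrow> r n b \<in> I n" for n b by (auto simp: I_def r_def)
  have rm: "r n \<in> borel_measurable borel" for n unfolding r_def by measurable
  have disj: "disjoint_family I"
    unfolding disjoint_family_on_def using flip_interval_unique by (fastforce simp: I_def)
  define C where "C = - (\<Union>n. I n)"
  have Cb: "C \<in> sets borel" unfolding C_def using Ib by auto
  have vim: "flip \<theta> -` A = (A \<inter> C) \<union> (\<Union>n. r n -` (A \<inter> I n))" for A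
  proof -
    have "b \<in> flip \<theta> -` A \<longleftrightarrow> b \<in> (A \<inter> C) \<union> (\<Union>n. r n -` (A \<inter> I n))" for b
    proof (cases rule: flip_cases[where \<theta> = \<theta> and b = b])
      case (flip n)
      have b: "b \<in> I n" using flip by (simp add: I_def)
      have "m = n" if "r m b \<in> I m" for m
        using that b flip_interval_unique unfolding rI[symmetric] by (auto simp: I_def)
      moreover have "r n b \<in> I n" using b rI by blast
      moreover have "b \<in> flip \<theta> -` A \<longleftrightarrow> r n b \<in> A" using flip(3) by (simp add: r_def)
      ultimately show ?thesis using b unfolding C_def by blast
    next
      case id
      then have "b \<notin> I n" for n by (auto simp: I_def)
      then have "b \<in> C" "\<And>n. r n b \<notin> I n" using rI unfolding C_def by blast+
      then show ?thesis using id(1) by auto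
    qed
    then show ?thesis by (rule set_eqI)
  qed
  have m: "r n -` (A \<inter> I n) \<in> sets borel" if "A \<in> sets borel" for A n
    by (rule measurable_vimage_borel[OF rm sets.Int[OF that Ib]])
  have I0: "n = m" if "b \<in> I n" "b \<in> I m" for n m b
    using disj that unfolding disjoint_family_on_def by auto
  have dr: "disjoint_family (\<lambda>n. r n -` (A \<inter> I n))" for A
    unfolding disjoint_family_on_def
  proof (intro ballI impI equals0I)
    fix n m b assume "n \<noteq> m" "b \<in> r n -` (A \<inter> I n) \<inter> r m -` (A \<inter> I m)"
    then show False using I0[of b n m] rI[of b n] rI[of b m] by simp
  qed
  have dA: "disjoint_family (\<lambda>n. A \<inter> I n)" for A
    unfolding disjoint_family_on_def
  proof (intro ballI impI equals0I)
    fix n m b assume "n \<noteq> m" "b \<in> (A \<inter> I n) \<inter> (A \<inter> I m)"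
    then show False using I0[of b n m] by simp
  qed
  have "emeasure lborel (flip \<theta> -` A) = emeasure lborel A" if A: "A \<in> sets borel" for A
  proof -
    have "emeasure lborel (flip \<theta> -` A) = emeasure lborel (A \<inter> C) + emeasure lborel (\<Union>n. r n -` (A \<inter> I n))"
      unfolding vim
    proof (rule plus_emeasure[symmetric])
      show "(\<Union>n. r n -` (A \<inter> I n)) \<in> sets lborel" using m[OF A] by (intro sets.countable_UN') auto
      show "A \<inter> C \<inter> (\<Union>n. r n -` (A \<inter> I n)) = {}"
      proof (intro equals0I)
        fix b assume "b \<in> A \<inter> C \<inter> (\<Union>n. r n -` (A \<inter> I n))"
        then obtain n where "r n b \<in> I n" "b \<in> C" by auto
        then show False using rI[of b n] by (simp add: C_def)
      qed
    qed (use A Cb in auto)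
    also have "emeasure lborel (\<Union>n. r n -` (A \<inter> I n)) = (\<integral>\<^sup>+n. emeasure lborel (r n -` (A \<inter> I n)) \<partial>count_space UNIV)"
      using m[OF A] dr by (intro emeasure_UN_countable) auto
    also have "(\<lambda>n. emeasure lborel (r n -` (A \<inter> I n))) = (\<lambda>n. emeasure lborel (A \<inter> I n))"
    proof
      fix n
      have "A \<inter> I n \<in> sets borel" using A Ib by (intro sets.Int)
      from emeasure_vimage_affine[OF _ this, of "-1" "icpt \<theta> n + icpt \<theta> (n + 1)"]
      show "emeasure lborel (r n -` (A \<inter> I n)) = emeasure lborel (A \<inter> I n)"
        unfolding r_def by (metis abs_minus_cancel abs_one ennreal_1 mult_1 neg_equal_0_iff_equal zero_neq_one)
    qed
    also have "(\<integral>\<^sup>+n. emeasure lborel (A \<inter> I n) \<partial>count_space UNIV) = emeasure lborel (\<Union>n. A \<inter> I n)"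
      using A Ib dA by (intro emeasure_UN_countable[symmetric]) auto
    also have "emeasure lborel (A \<inter> C) + emeasure lborel (\<Union>n. A \<inter> I n) = emeasure lborel ((A \<inter> C) \<union> (\<Union>n. A \<inter> I n))"
    proof (rule plus_emeasure)
      show "(\<Union>n. A \<inter> I n) \<in> sets lborel" using A Ib by (intro sets.countable_UN') auto
    qed (use A Cb in \<open>auto simp: C_def\<close>)
    also have "(A \<inter> C) \<union> (\<Union>n. A \<inter> I n) = A" by (auto simp: C_def)
    finally show ?thesis .
  qed
  moreover have "flip \<theta> \<in> borel_measurable borel"
  proof (rule borel_measurableI)
    fix A :: "real set" assume "open A"
    then have A: "A \<in> sets borel" by simp
    show "flip \<theta> -` A \<inter> space borel \<in> sets borel"
      unfolding vim using A Cb m[OF A] by (intro sets.Int sets.Un sets.countable_UN') auto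
  qed
  ultimately show ?thesis by (simp add: lborel_automorphism_def flip_flip)
qed

text \<open>
The effect on the intercept of crossing two consecutive edges, after which the leaf moves to the
right in the same polygon again. The inverse is the return map of the leaves that move to the
left.
\<close>

definition return_map :: "real \<Rightarrow> real \<Rightarrow> real" where
  "return_map \<theta> = flip (- \<theta>) \<circ> flip \<theta>"

lemma return_map_automorphism: "lborel_automorphism (return_map \<theta>) (return_map (- \<theta>))"
  unfolding return_map_def using lborel_automorphism_compose[OF flip_automorphism flip_automorphism] by simp

text \<open>
The bound is the intercept of the tangent of slope \<open>\<theta>\<close> to the parabola through the vertices.
\<close>

lemma icpt_ge: "- (\<theta>\<^sup>2) / 4 \<le> icpt \<theta> n"
proof -
  have "icpt \<theta> n + \<theta>\<^sup>2 / 4 = (of_int n - \<theta> / 2)\<^sup>2"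
    by (simp add: icpt_def power2_eq_square algebra_simps)
  then show ?thesis using zero_le_power2[of "of_int n - \<theta> / 2"] by linarith
qed

text \<open>
The lower bound only excludes fixed points of the return map and makes the measure finite. Being
the intercept of the tangent to the parabola through the vertices, it is carried along by the
shears of \<open>mass_shift\<close>, which preserve this parabola.
\<close>

definition core :: "real \<Rightarrow> nat \<Rightarrow> real set" where
  "core \<theta> j = {- (\<theta>\<^sup>2) / 4 <..< icpt \<theta> (- int j)}"

definition mass :: "real \<Rightarrow> nat \<Rightarrow> real" where
  "mass \<theta> j = measure lborel (escaping (return_map \<theta>) (core \<theta> j))"

lemma core_borel: "core \<theta> j \<in> sets borel"
  by (simp add: core_def)

lemma emeasure_core: "emeasure lborel (core \<theta> j) < \<infinity>"
proof -
  have "core \<theta> j \<subseteq> {- (\<theta>\<^sup>2) / 4 .. icpt \<theta> (- int j)}" by (auto simp: core_def)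
  then have "emeasure lborel (core \<theta> j) \<le> emeasure lborel {- (\<theta>\<^sup>2) / 4 .. icpt \<theta> (- int j)}"
    by (intro emeasure_mono) auto
  also have "\<dots> < \<infinity>" using icpt_ge by (simp)
  finally show ?thesis .
qed

lemma return_map_borel: "return_map \<theta> \<in> borel_measurable borel"
  using return_map_automorphism by (simp add: lborel_automorphism_def)

lemma emeasure_escaping_core:
  "emeasure lborel (escaping (return_map \<theta>) (core \<theta> j)) = ennreal (mass \<theta> j)"
proof -
  have "emeasure lborel (escaping (return_map \<theta>) (core \<theta> j)) \<le> emeasure lborel (core \<theta> j)"
    using core_borel escaping_subset by (intro emeasure_mono) auto
  then have "emeasure lborel (escaping (return_map \<theta>) (core \<theta> j)) < \<infinity>"
    using emeasure_core by (rule le_less_trans)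
  then show ?thesis unfolding mass_def by (simp add: emeasure_eq_ennreal_measure less_top)
qed

lemma mass_nonneg: "0 \<le> mass \<theta> j"
  by (simp add: mass_def)

lemma escaping_conjugate:
  assumes "\<And>x. \<phi> (T x) = T' (\<phi> x)"
  shows "\<phi> -` escaping T' A = escaping T (\<phi> -` A)"
proof -
  have "\<phi> ((T ^^ k) x) = (T' ^^ k) (\<phi> x)" for k x
    by (induction k) (auto simp: assms)
  then show ?thesis by (auto simp: escaping_def)
qed

lemma icpt_shift: "icpt (\<theta> - 2 * of_int m) n = icpt \<theta> (n + m) - icpt \<theta> m"
  by (simp add: icpt_def power2_eq_square algebra_simps)

lemma flip_shift: "flip (\<theta> - 2 * of_int m) (b - icpt \<theta> m) = flip \<theta> b - icpt \<theta> m"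
proof (cases rule: flip_cases[where \<theta> = \<theta> and b = b])
  case (flip n)
  then show ?thesis
    using flip_eq[of "\<theta> - 2 * of_int m" "n - m" "b - icpt \<theta> m"] by (simp add: icpt_shift)
next
  case id
  have "\<not> (icpt (\<theta> - 2 * of_int m) n < b - icpt \<theta> m \<and> b - icpt \<theta> m < icpt (\<theta> - 2 * of_int m) (n + 1))" for n
    using id(2)[of "n + m"] by (simp add: icpt_shift add.commute add.left_commute)
  then show ?thesis using flip_id[of "\<theta> - 2 * of_int m" "b - icpt \<theta> m"] id(1) by simp
qed

lemma return_map_shift:
  "return_map (\<theta> - 2 * of_int m) (b - icpt \<theta> m) = return_map \<theta> b - icpt \<theta> m"
  using flip_shift[of "- \<theta>" "- m" "flip \<theta> b"] by (simp add: return_map_def flip_shift icpt_uminus)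

text \<open>
The shear \<open>(x, y) \<mapsto> (x - m, y - 2 m x + m\<^sup>2)\<close> permutes the vertices, and it conjugates the return
maps of the slopes \<open>\<theta>\<close> and \<open>\<theta> - 2 m\<close> by a translation of the intercepts.
\<close>

lemma mass_shift:
  "mass \<theta> j = mass (\<theta> - 2 * real m) (j + m)"
proof -
  let ?\<phi> = "\<lambda>b. - icpt \<theta> m + 1 * b"
  let ?\<theta> = "\<theta> - 2 * real m"
  have "?\<phi> -` core ?\<theta> (j + m) = core \<theta> j"
  proof -
    have "icpt ?\<theta> (- int (j + m)) = icpt \<theta> (- int j) - icpt \<theta> m"
      using icpt_shift[of \<theta> "int m" "- int (j + m)"] by simp
    moreover have "- (?\<theta>\<^sup>2) / 4 = - (\<theta>\<^sup>2) / 4 - icpt \<theta> m"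
      by (simp add: icpt_def power2_eq_square field_simps)
    ultimately show ?thesis by (auto simp: core_def)
  qed
  moreover have "?\<phi> (return_map \<theta> x) = return_map ?\<theta> (?\<phi> x)" for x
    using return_map_shift[of \<theta> "int m" x] by simp
  ultimately have "?\<phi> -` escaping (return_map ?\<theta>) (core ?\<theta> (j + m)) = escaping (return_map \<theta>) (core \<theta> j)"
    using escaping_conjugate[of ?\<phi> "return_map \<theta>" "return_map ?\<theta>"] by simp
  then have "emeasure lborel (escaping (return_map ?\<theta>) (core ?\<theta> (j + m))) = emeasure lborel (escaping (return_map \<theta>) (core \<theta> j))"
    using emeasure_vimage_affine[of 1 "escaping (return_map ?\<theta>) (core ?\<theta> (j + m))" "- icpt \<theta> m"]
      sets_escaping[OF return_map_borel core_borel] by simp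
  then show ?thesis by (simp add: emeasure_escaping_core mass_nonneg)
qed

lemma flip_gt: "- (\<theta>\<^sup>2) / 4 < b \<Longrightarrow> - (\<theta>\<^sup>2) / 4 < flip \<theta> b"
proof (cases rule: flip_cases[where \<theta> = \<theta> and b = b])
  case (flip n)
  then show ?thesis using icpt_ge[of \<theta> n] by linarith
qed simp

text \<open>
The core is bounded above by an endpoint of the intervals that \<open>flip (- \<theta>)\<close> reflects.
\<close>

lemma flip_core:
  assumes "0 \<le> \<theta>" "b \<in> core \<theta> j"
  shows "flip (- \<theta>) b \<in> core \<theta> j"
proof (cases rule: flip_cases[where \<theta> = "- \<theta>" and b = b])
  case (flip n)
  have n: "- \<theta> < 2 * of_int n + 1" using flip icpt_less_iff[of "- \<theta>" n] by linarith
  have b: "b < icpt (- \<theta>) (int j)" using assms(2) by (simp add: core_def icpt_uminus)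
  have "\<not> int j \<le> n"
  proof
    assume "int j \<le> n"
    then have "icpt (- \<theta>) (int j) \<le> icpt (- \<theta>) n" using assms(1) by (intro icpt_mono) auto
    then show False using b flip by linarith
  qed
  then have "icpt (- \<theta>) (n + 1) \<le> icpt (- \<theta>) (int j)" using n by (intro icpt_mono) auto
  then have "flip (- \<theta>) b < icpt \<theta> (- int j)" using flip by (simp add: icpt_uminus)
  moreover have "- (\<theta>\<^sup>2) / 4 < flip (- \<theta>) b"
    using flip_gt[of "- \<theta>" b] assms(2) by (simp add: core_def)
  ultimately show ?thesis by (simp add: core_def)
qed (use assms(2) in simp)

lemma flip_core_iff: "0 \<le> \<theta> \<Longrightarrow> flip (- \<theta>) b \<in> core \<theta> j \<longleftrightarrow> b \<in> core \<theta> j"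
  using flip_core flip_flip by metis

lemma core_mono: "0 \<le> \<theta> \<Longrightarrow> j \<le> l \<Longrightarrow> core \<theta> j \<subseteq> core \<theta> l"
  using icpt_mono[of "- \<theta>" "int j" "int l"] by (auto simp: core_def icpt_uminus)

lemma mass_mono:
  assumes "0 \<le> \<theta>" "j \<le> l"
  shows "mass \<theta> j \<le> mass \<theta> l"
  using emeasure_escaping_mono[OF return_map_automorphism[of \<theta>] core_borel core_borel core_mono[OF assms] emeasure_core]
  by (simp add: emeasure_escaping_core mass_nonneg)

text \<open>
The return maps of \<open>\<theta>\<close> and \<open>- \<theta>\<close> are the two compositions of the same two involutions, hence
conjugate by one of them, which preserves the core by \<open>flip_core\<close>.
\<close>

lemma emeasure_escaping_core_reflect:
  assumes "\<theta> \<le> 0"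
  shows "emeasure lborel (escaping (return_map \<theta>) (core (- \<theta>) j)) = ennreal (mass (- \<theta>) j)"
proof -
  have inv: "flip \<theta> -` core (- \<theta>) j = core (- \<theta>) j"
    using flip_core_iff[of "- \<theta>"] assms by auto
  have "flip \<theta> (return_map \<theta> x) = return_map (- \<theta>) (flip \<theta> x)" for x
    by (simp add: return_map_def)
  then have "flip \<theta> -` escaping (return_map (- \<theta>)) (core (- \<theta>) j) = escaping (return_map \<theta>) (core (- \<theta>) j)"
    using escaping_conjugate[of "flip \<theta>" "return_map \<theta>"] inv by simp
  then have "emeasure lborel (escaping (return_map \<theta>) (core (- \<theta>) j)) =
      emeasure lborel (escaping (return_map (- \<theta>)) (core (- \<theta>) j))"
    using flip_automorphism[of \<theta>] sets_escaping[OF return_map_borel core_borel]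
    by (metis lborel_automorphism_def)
  then show ?thesis by (simp add: emeasure_escaping_core)
qed

lemma mass_reflect:
  assumes "\<theta> \<le> 0"
  shows "mass \<theta> j \<le> mass (- \<theta>) j"
proof -
  have sub: "core \<theta> j \<subseteq> core (- \<theta>) j" using assms mult_nonneg_nonpos[of "2 * real j" \<theta>] by (auto simp: core_def icpt_def)
  show ?thesis
    using emeasure_escaping_mono[OF return_map_automorphism[of \<theta>] core_borel core_borel sub emeasure_core]
    by (simp add: emeasure_escaping_core emeasure_escaping_core_reflect assms mass_nonneg)
qed

lemma mass_twist_vertical: "mass \<theta> j \<le> mass \<bar>\<theta> - 2 * real m\<bar> (j + m)"
  using mass_shift[of \<theta> j m] mass_reflect[of "\<theta> - 2 * real m" "j + m"] by (cases "0 \<le> \<theta> - 2 * real m") auto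

text \<open>
The intercepts of lines that run through images of vertices all lie in this countable group.
\<close>

definition lattice :: "real \<Rightarrow> real set" where
  "lattice \<theta> = {of_int m + of_int n * \<theta> |m n. True}"

lemma countable_lattice: "countable (lattice \<theta>)"
proof -
  have "lattice \<theta> = range (\<lambda>(m, n). of_int m + of_int n * \<theta>)" by (auto simp: lattice_def)
  then show ?thesis by simp
qed

lemma latticeI: "x = of_int m + of_int n * \<theta> \<Longrightarrow> x \<in> lattice \<theta>"
  by (auto simp: lattice_def)

lemma lattice_diff:
  assumes "x \<in> lattice \<theta>" "y \<in> lattice \<theta>" shows "x - y \<in> lattice \<theta>"
proof -
  obtain m n m' n' where "x = of_int m + of_int n * \<theta>" "y = of_int m' + of_int n' * \<theta>"
    using assms by (auto simp: lattice_def)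
  then show ?thesis by (intro latticeI[of _ "m - m'" "n - n'"]) (simp add: algebra_simps)
qed

lemma lattice_uminus: "lattice (- \<theta>) = lattice \<theta>"
proof -
  have "lattice (- \<theta>) \<subseteq> lattice \<theta>" for \<theta>
  proof
    fix x assume "x \<in> lattice (- \<theta>)"
    then obtain m n where "x = of_int m + of_int n * (- \<theta>)" by (auto simp: lattice_def)
    then show "x \<in> lattice \<theta>" by (intro latticeI[of _ m "- n"]) simp
  qed
  from this[of \<theta>] this[of "- \<theta>"] show ?thesis by simp
qed

lemma icpt_lattice: "icpt \<theta> n \<in> lattice \<theta>"
  by (rule latticeI[of _ "n\<^sup>2" "- n"]) (simp add: icpt_def)

lemma flip_lattice: "b \<notin> lattice \<theta> \<Longrightarrow> flip \<theta> b \<notin> lattice \<theta>"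
proof (cases rule: flip_cases[where \<theta> = \<theta> and b = b])
  case (flip n)
  assume b: "b \<notin> lattice \<theta>"
  show ?thesis
  proof
    assume "flip \<theta> b \<in> lattice \<theta>"
    then have "icpt \<theta> n - (flip \<theta> b - icpt \<theta> (n + 1)) \<in> lattice \<theta>" by (intro lattice_diff icpt_lattice)
    then show False using b flip(3) by simp
  qed
qed simp

lemma return_map_lattice: "b \<notin> lattice \<theta> \<Longrightarrow> return_map \<theta> b \<notin> lattice \<theta>"
  using flip_lattice[of b \<theta>] flip_lattice[of "flip \<theta> b" "- \<theta>"] by (simp add: return_map_def lattice_uminus)

lemma return_map_funpow_lattice: "b \<notin> lattice \<theta> \<Longrightarrow> (return_map \<theta> ^^ k) b \<notin> lattice \<theta>"
  by (induction k) (simp_all add: return_map_lattice)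

text \<open>
For \<open>\<theta> < 1\<close> leaves that move to the right can exit through every edge \<open>n \<ge> 0\<close>. A leaf on a chord
whose line passes below the vertex \<open>j\<close> therefore exits below that vertex and stays in the core
after the crossing.
\<close>

lemma escaping_core_shallow:
  assumes "0 < \<theta>" "\<theta> < 1" "b \<in> escaping (return_map \<theta>) (core \<theta> j)" "b \<notin> lattice \<theta>"
  shows "icpt \<theta> (int j) < b" "b < icpt \<theta> (- int j)"
proof -
  have b: "b \<in> core \<theta> j" "return_map \<theta> b \<notin> core \<theta> j"
    using assms(3) by (auto simp: escaping_def dest: spec[of _ 1])
  then show "b < icpt \<theta> (- int j)" by (simp add: core_def)
  show "icpt \<theta> (int j) < b"
  proof (rule ccontr)
    assume "\<not> icpt \<theta> (int j) < b"
    moreover have "b \<noteq> icpt \<theta> (int j)" using assms(4) icpt_lattice by blast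
    ultimately have lt: "b < icpt \<theta> (int j)" by simp
    have "flip \<theta> b \<in> core \<theta> j"
    proof (cases rule: flip_cases[where \<theta> = \<theta> and b = b])
      case (flip n)
      have n: "\<theta> < 2 * of_int n + 1" using flip icpt_less_iff[of \<theta> n] by linarith
      have "\<not> int j \<le> n"
      proof
        assume "int j \<le> n"
        then have "icpt \<theta> (int j) \<le> icpt \<theta> n" using assms(2) by (intro icpt_mono) auto
        then show False using lt flip by linarith
      qed
      then have "icpt \<theta> (n + 1) \<le> icpt \<theta> (int j)" using n by (intro icpt_mono) auto
      also have "\<dots> \<le> icpt \<theta> (- int j)" using assms(1) by (simp add: icpt_def)
      finally have "flip \<theta> b < icpt \<theta> (- int j)" using flip by linarith
      then show ?thesis using flip_gt[of \<theta> b] b(1) by (simp add: core_def)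
    qed (use b(1) in simp)
    then show False using b(2) flip_core[of \<theta>] assms(1) by (simp add: return_map_def)
  qed
qed

lemma mass_shallow:
  assumes "0 < \<theta>" "\<theta> < 1"
  shows "mass \<theta> j \<le> 2 * real j * \<theta>"
proof -
  have le: "icpt \<theta> (int j) \<le> icpt \<theta> (- int j)" using assms(1) by (simp add: icpt_def)
  have "escaping (return_map \<theta>) (core \<theta> j) \<subseteq> {icpt \<theta> (int j) <..< icpt \<theta> (- int j)} \<union> lattice \<theta>"
    using escaping_core_shallow[OF assms] by auto
  then have "emeasure lborel (escaping (return_map \<theta>) (core \<theta> j)) \<le>
      emeasure lborel ({icpt \<theta> (int j) <..< icpt \<theta> (- int j)} \<union> lattice \<theta>)"
    by (intro emeasure_mono) (simp_all add: sets.Un sets.countable countable_lattice)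
  also have "\<dots> = emeasure lborel {icpt \<theta> (int j) <..< icpt \<theta> (- int j)}"
    by (intro emeasure_Un_null_set countable_imp_null_set_lborel countable_lattice) simp
  also have "\<dots> = ennreal (2 * real j * \<theta>)" using le by (simp add: icpt_def)
  finally show ?thesis using assms by (simp add: emeasure_escaping_core ennreal_le_iff)
qed

section \<open>Passages through the horizontal cylinders\<close>

text \<open>
A state \<open>(i, x, up)\<close> is a point with abscissa \<open>x\<close> of the horizontal segment at height \<open>i\<^sup>2\<close>,
crossed upwards in \<open>Q\<^sup>+\<close>, or crossed in \<open>Q\<^sup>-\<close>, which after the rotation means downwards in \<open>Q\<^sup>+\<close>.
One step leads through the cylinder between the heights \<open>i\<^sup>2\<close> and \<open>(i + 1)\<^sup>2\<close>, where \<open>\<eta> = 1 / \<theta>\<close>.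
Its bottom and its top each consist of one segment of either polygon, which gives four rules. The
displacement is prescribed modulo the circumference \<open>2 (2 i + 1)\<close>; the unknown \<open>k\<close> counts the
turns. In the last rule \<open>i\<close> may be \<open>0\<close>: the lowest cylinder has no bottom segment in \<open>Q\<^sup>+\<close>.
\<close>

inductive pass :: "real \<Rightarrow> int \<times> real \<times> bool \<Rightarrow> int \<times> real \<times> bool \<Rightarrow> bool" for \<eta> where
  up_up: "1 \<le> i \<Longrightarrow> \<bar>x\<bar> < of_int i \<Longrightarrow> \<bar>x'\<bar> < of_int i + 1 \<Longrightarrow>
    x' - x = of_int (2 * i + 1) * \<eta> + of_int (2 * (2 * i + 1) * k) \<Longrightarrow> pass \<eta> (i, x, True) (i + 1, x', True)"
| up_down: "1 \<le> i \<Longrightarrow> \<bar>x\<bar> < of_int i \<Longrightarrow> \<bar>x'\<bar> < of_int i \<Longrightarrow>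
    x + x' = of_int (2 * i + 1) * (1 - \<eta>) + of_int (2 * (2 * i + 1) * k) \<Longrightarrow> pass \<eta> (i, x, True) (i, x', False)"
| down_down: "1 \<le> i \<Longrightarrow> \<bar>x\<bar> < of_int i + 1 \<Longrightarrow> \<bar>x'\<bar> < of_int i \<Longrightarrow>
    x - x' = of_int (2 * i + 1) * \<eta> + of_int (2 * (2 * i + 1) * k) \<Longrightarrow> pass \<eta> (i + 1, x, False) (i, x', False)"
| down_up: "0 \<le> i \<Longrightarrow> \<bar>x\<bar> < of_int i + 1 \<Longrightarrow> \<bar>x'\<bar> < of_int i + 1 \<Longrightarrow>
    x + x' = of_int (2 * i + 1) * (1 + \<eta>) + of_int (2 * (2 * i + 1) * k) \<Longrightarrow> pass \<eta> (i + 1, x, False) (i + 1, x', True)"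

text \<open>
The points of the segment at height \<open>j\<^sup>2\<close> from which a leaf climbs and never comes back to this
height.
\<close>

definition ascending :: "real \<Rightarrow> int \<Rightarrow> real set" where
  "ascending \<eta> j = {x. \<bar>x\<bar> < of_int j \<and> (\<forall>s. (pass \<eta>)\<^sup>+\<^sup>+ (j, x, True) s \<longrightarrow> j < fst s)}"

lemma pass_twist: "pass \<eta> s s' \<Longrightarrow> pass (\<eta> - 2 * of_int m) s s'"
proof (induction rule: pass.induct)
  case (up_up i x x' k)
  then show ?case by (intro pass.up_up[where k = "k + m"]) (simp_all add: algebra_simps)
next
  case (up_down i x x' k)
  then show ?case by (intro pass.up_down[where k = "k - m"]) (simp_all add: algebra_simps)
next
  case (down_down i x x' k)
  then show ?case by (intro pass.down_down[where k = "k + m"]) (simp_all add: algebra_simps)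
next
  case (down_up i x x' k)
  then show ?case by (intro pass.down_up[where k = "k + m"]) (simp_all add: algebra_simps)
qed

definition mirror :: "int \<times> real \<times> bool \<Rightarrow> int \<times> real \<times> bool" where
  "mirror = (\<lambda>(i, x, up). (i, - x, up))"

lemma pass_mirror: "pass \<eta> s s' \<Longrightarrow> pass (- \<eta>) (mirror s) (mirror s')"
proof (induction rule: pass.induct)
  case (up_up i x x' k)
  then show ?case unfolding mirror_def prod.case
    by (intro pass.up_up[where k = "- k"]) (simp_all add: algebra_simps)
next
  case (up_down i x x' k)
  then show ?case unfolding mirror_def prod.case
    by (intro pass.up_down[where k = "- k - 1"]) (simp_all add: algebra_simps)
next
  case (down_down i x x' k)
  then show ?case unfolding mirror_def prod.case
    by (intro pass.down_down[where k = "- k"]) (simp_all add: algebra_simps)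
next
  case (down_up i x x' k)
  then show ?case unfolding mirror_def prod.case
    by (intro pass.down_up[where k = "- k - 1"]) (simp_all add: algebra_simps)
qed

lemma ascending_twist: "ascending (\<eta> - 2 * of_int m) j = ascending \<eta> j"
proof -
  have "pass (\<eta> - 2 * of_int m) s s' \<longleftrightarrow> pass \<eta> s s'" for s s'
    using pass_twist[of \<eta> s s' m] pass_twist[of "\<eta> - 2 * of_int m" s s' "- m"] by auto
  then have "pass (\<eta> - 2 * of_int m) = pass \<eta>" by (intro ext)
  then show ?thesis by (simp add: ascending_def)
qed

lemma ascending_mirror: "x \<in> ascending \<eta> j \<Longrightarrow> - x \<in> ascending (- \<eta>) j"
proof -
  assume x: "x \<in> ascending \<eta> j"
  have "(pass \<eta>)\<^sup>+\<^sup>+ (mirror s) (mirror s')" if "(pass (- \<eta>))\<^sup>+\<^sup>+ s s'" for s s'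
    using that
  proof (induction rule: tranclp_induct)
    case (base s')
    then show ?case using pass_mirror[of "- \<eta>" s s'] by auto
  next
    case (step s' s'')
    then show ?case using pass_mirror[of "- \<eta>" s' s''] by auto
  qed
  from this[of "(j, - x, True)"] show ?thesis
    using x by (fastforce simp: ascending_def mirror_def)
qed

text \<open>
The chord with intercept \<open>b\<close> meets the interior of the horizontal segment from the vertex \<open>- i\<close> to
the vertex \<open>i\<close>.
\<close>

definition crosses :: "real \<Rightarrow> int \<Rightarrow> real \<Rightarrow> bool" where
  "crosses \<theta> i b \<longleftrightarrow> 1 \<le> i \<and> icpt \<theta> i < b \<and> b < icpt \<theta> (- i)"

text \<open>
The abscissa at which the line with intercept \<open>b\<close> has height \<open>i\<^sup>2\<close>.
\<close>

definition height_coord :: "real \<Rightarrow> int \<Rightarrow> real \<Rightarrow> real" where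
  "height_coord \<theta> i b = ((of_int i)\<^sup>2 - b) / \<theta>"

lemma abs_height_coord:
  assumes "0 < \<theta>"
  shows "\<bar>height_coord \<theta> i b\<bar> < of_int i \<longleftrightarrow> icpt \<theta> i < b \<and> b < icpt \<theta> (- i)"
  using assms by (auto simp: height_coord_def icpt_def abs_less_iff field_simps)

lemma line_of_height_coord: "0 < \<theta> \<Longrightarrow> (of_int i)\<^sup>2 - \<theta> * height_coord \<theta> i b = b"
  by (simp add: height_coord_def)

lemma height_coord_eqI: "0 < \<theta> \<Longrightarrow> b = (of_int i)\<^sup>2 - \<theta> * x \<Longrightarrow> height_coord \<theta> i b = x"
  by (simp add: height_coord_def)

text \<open>
While a leaf runs around the cylinder \<open>i\<close> without leaving it, it crosses alternately the edges \<open>i\<close>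
and \<open>- i - 1\<close>. Two crossings add the circumference, measured transversally, to the intercept. The
two inequalities say that this happens \<open>r\<close> times before the leaf gets out of the cylinder.
\<close>

lemma return_map_bounces:
  assumes "0 < \<theta>" "0 \<le> i" "icpt \<theta> i < b" "b + real r * (2 * (2 * of_int i + 1) * \<theta>) < icpt \<theta> (- i - 1)"
  shows "(return_map \<theta> ^^ r) b = b + real r * (2 * (2 * of_int i + 1) * \<theta>)"
  using assms(4)
proof (induction r)
  case (Suc r)
  define L where "L = 2 * (2 * of_int i + 1) * \<theta>"
  have L: "0 < L" using assms(1,2) by (simp add: L_def)
  define c where "c = b + real r * L"
  have c: "c + L < icpt \<theta> (- i - 1)" using Suc.prems by (simp add: c_def L_def algebra_simps)
  have "(return_map \<theta> ^^ r) b = c"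
    using Suc.IH c L unfolding c_def L_def by (simp add: algebra_simps)
  moreover have "return_map \<theta> c = c + L"
  proof -
    have "0 \<le> real r * L" using L by simp
    then have ge: "icpt \<theta> i < c" using assms(3) unfolding c_def by linarith
    have it: "0 \<le> of_int i * \<theta>" using assms(1,2) by simp
    have lt: "c < icpt \<theta> (i + 1)" using c it assms(1)
      unfolding L_def icpt_def by (simp add: algebra_simps power2_eq_square)
    have "flip \<theta> c = icpt \<theta> i + icpt \<theta> (i + 1) - c" by (rule flip_eq[OF ge lt])
    also have "\<dots> = icpt \<theta> (- i) + icpt \<theta> (- i - 1) - (c + L)"
      by (simp add: icpt_def L_def algebra_simps power2_eq_square)
    finally have f: "flip \<theta> c = icpt \<theta> (- i) + icpt \<theta> (- i - 1) - (c + L)" .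
    have "icpt \<theta> (- i) < c + L" using ge it assms(1)
      unfolding L_def icpt_def by (simp add: algebra_simps power2_eq_square)
    then have "flip (- \<theta>) (flip \<theta> c) = icpt (- \<theta>) i + icpt (- \<theta>) (i + 1) - flip \<theta> c"
      using c f by (intro flip_eq) (simp_all add: icpt_uminus)
    then show ?thesis using f by (simp add: return_map_def icpt_uminus)
  qed
  ultimately show ?case by (simp add: c_def L_def algebra_simps)
qed simp

text \<open>
The intercept of the chord through the point described by a state.
\<close>

definition chord_of :: "real \<Rightarrow> int \<times> real \<times> bool \<Rightarrow> real" where
  "chord_of \<theta> s = (of_int (fst s))\<^sup>2 - \<theta> * fst (snd s)"

lemma return_map_funpow_inverse:
  "(return_map (- \<theta>) ^^ r) ((return_map \<theta> ^^ r) b) = b"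
  using lborel_automorphism_funpow[OF return_map_automorphism[of \<theta>], of r] by (simp add: lborel_automorphism_def)

lemma return_map_flip: "(return_map (- \<theta>) ^^ r) (flip \<theta> b) = flip \<theta> ((return_map \<theta> ^^ r) b)"
proof (induction r)
  case (Suc r)
  then show ?case by (simp add: return_map_def)
qed simp

lemma ge_if_gt_pred:
  fixes L :: real and k :: int
  assumes "- L < of_int k * L" "0 < L" shows "0 \<le> k"
proof -
  have "- 1 * L < of_int k * L" using assms by simp
  then have "(- 1 :: real) < of_int k" using assms(2) mult_less_cancel_right_pos[of L "- 1" "of_int k"] by blast
  then show ?thesis by linarith
qed

text \<open>
The size of the segments excludes negative numbers of turns, so \<open>return_map_bounces\<close> applies. Read
backwards, the same statement describes the leaves that descend through the cylinder.
\<close>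

lemma pass_up_up_chord:
  assumes t: "0 < \<theta>" and p: "1 \<le> i" "\<bar>x\<bar> < of_int i" "\<bar>x'\<bar> < of_int i + 1"
    "x' - x = of_int (2 * i + 1) * (1 / \<theta>) + of_int (2 * (2 * i + 1) * k)"
  shows "\<exists>r. (return_map \<theta> ^^ r) ((of_int i)\<^sup>2 - \<theta> * x) = (of_int (i + 1))\<^sup>2 - \<theta> * x'"
proof -
  define L where "L = 2 * (2 * of_int i + 1) * \<theta>"
  have L: "0 < L" using t p(1) by (simp add: L_def)
  define b where "b = (of_int i)\<^sup>2 - \<theta> * x"
  define b' where "b' = (of_int (i + 1))\<^sup>2 - \<theta> * x'"
  have b: "icpt \<theta> i < b" "b < icpt \<theta> (- i)" using abs_height_coord[OF t, of i b] height_coord_eqI[OF t b_def] p(2) by auto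
  have b': "icpt \<theta> (i + 1) < b'" "b' < icpt \<theta> (- (i + 1))" using abs_height_coord[OF t, of "i + 1" b'] height_coord_eqI[OF t b'_def] p(3) by auto
  have x': "x' = x + of_int (2 * i + 1) * (1 / \<theta>) + of_int (2 * (2 * i + 1) * k)" using p(4) by simp
  have eq: "b' = b + of_int (- k) * L"
    using t unfolding b'_def b_def x' L_def by (simp add: algebra_simps power2_eq_square)
  have it: "0 < of_int i * \<theta>" using t p(1) by simp
  have i0: "0 < (of_int i :: real)" using p(1) by simp
  have "- L < b' - b" using b b' unfolding L_def icpt_def
    by (simp add: algebra_simps power2_eq_square) (use it i0 t in linarith)
  then have "0 \<le> - k" using ge_if_gt_pred[of L "- k"] L eq by simp
  then have rk: "real (nat (- k)) = of_int (- k)" by simp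
  have "b' < icpt \<theta> (- i - 1)" using b'(2) by simp
  then have "b + real (nat (- k)) * L < icpt \<theta> (- i - 1)" using eq rk by simp
  then have "(return_map \<theta> ^^ nat (- k)) b = b + real (nat (- k)) * L"
    using return_map_bounces[OF t _ b(1), of "nat (- k)"] p(1) by (simp only: L_def)
  then have "(return_map \<theta> ^^ nat (- k)) b = b'" using eq rk by simp
  then show ?thesis unfolding b_def b'_def by blast
qed

text \<open>
For \<open>\<theta> < 1\<close> every step of \<open>pass\<close> is realised by the flow: in each case the number of turns has the
right sign, and \<open>return_map_bounces\<close> follows the leaf through the cylinder.
\<close>

lemma pass_chord:
  assumes t: "0 < \<theta>" "\<theta> < 1" and p: "pass (1 / \<theta>) s s'"
    and s: "chord_of \<theta> s = (if snd (snd s) then (return_map \<theta> ^^ k) b else flip \<theta> ((return_map \<theta> ^^ k) b))"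
  shows "\<exists>k' \<ge> k. chord_of \<theta> s' = (if snd (snd s') then (return_map \<theta> ^^ k') b else flip \<theta> ((return_map \<theta> ^^ k') b))
     \<and> (\<not> snd (snd s) \<and> snd (snd s') \<longrightarrow> k < k')"
  using p
proof cases
  case (up_up i x x' l)
  obtain r where "(return_map \<theta> ^^ r) (chord_of \<theta> s) = chord_of \<theta> s'"
    using pass_up_up_chord[OF t(1) up_up(3-6)] unfolding up_up(1,2) chord_of_def by auto
  then show ?thesis using s up_up by (intro exI[of _ "r + k"]) (simp add: funpow_add)
next
  case (down_down i x x' l)
  have "\<exists>r. (return_map \<theta> ^^ r) (chord_of \<theta> s') = chord_of \<theta> s"
    using pass_up_up_chord[OF t(1) down_down(3,5,4,6)] unfolding down_down(1,2) chord_of_def by auto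
  then obtain r where "(return_map \<theta> ^^ r) (chord_of \<theta> s') = chord_of \<theta> s" by blast
  then have "chord_of \<theta> s' = (return_map (- \<theta>) ^^ r) (chord_of \<theta> s)"
    using return_map_funpow_inverse[where \<theta> = \<theta> and r = r and b = "chord_of \<theta> s'"] by simp
  then show ?thesis using s down_down by (intro exI[of _ "r + k"]) (simp add: funpow_add return_map_flip)
next
  case (up_down i x x' l)
  define L where "L = 2 * (2 * of_int i + 1) * \<theta>"
  have L: "0 < L" using t up_down(3) by (simp add: L_def)
  define c where "c = (of_int i)\<^sup>2 - \<theta> * x"
  define c' where "c' = (of_int i)\<^sup>2 - \<theta> * x'"
  have c: "icpt \<theta> i < c" "c < icpt \<theta> (- i)" using abs_height_coord[OF t(1), of i c] height_coord_eqI[OF t(1) c_def] up_down by auto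
  have c': "icpt \<theta> i < c'" "c' < icpt \<theta> (- i)" using abs_height_coord[OF t(1), of i c'] height_coord_eqI[OF t(1) c'_def] up_down by auto
  have x': "x' = of_int (2 * i + 1) * (1 - 1 / \<theta>) + of_int (2 * (2 * i + 1) * l) - x" using up_down(6) by linarith
  have eq: "c' = icpt \<theta> i + icpt \<theta> (i + 1) - (c + of_int l * L)"
    using t unfolding c'_def c_def x' L_def icpt_def by (simp add: algebra_simps power2_eq_square)
  have it: "0 < of_int i * \<theta>" using t up_down(3) by simp
  have i0: "0 < (of_int i :: real)" using up_down(3) by simp
  have "- L < (icpt \<theta> i + icpt \<theta> (i + 1) - c') - c" using c c' unfolding L_def icpt_def
    by (simp add: algebra_simps power2_eq_square) (use it i0 t in linarith)
  then have "- L < of_int l * L" using eq by linarith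
  then have l: "0 \<le> l" using ge_if_gt_pred L by blast
  then have rl: "real (nat l) = of_int l" by simp
  have lt: "c + of_int l * L < icpt \<theta> (i + 1)" using eq c' by linarith
  moreover have "icpt \<theta> (i + 1) \<le> icpt \<theta> (- i - 1)" using it t by (simp add: icpt_def algebra_simps power2_eq_square)
  ultimately have T: "(return_map \<theta> ^^ nat l) c = c + of_int l * L"
    using return_map_bounces[OF t(1) _ c(1), of "nat l"] up_down(3) rl unfolding L_def by simp
  have "0 \<le> of_int l * L" using l L by simp
  then have "icpt \<theta> i < c + of_int l * L" using c(1) by linarith
  then have "flip \<theta> ((return_map \<theta> ^^ nat l) c) = c'" unfolding T eq using lt by (rule flip_eq)
  then show ?thesis using s up_down unfolding c_def c'_def
    by (intro exI[of _ "nat l + k"]) (simp add: funpow_add chord_of_def)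
next
  case (down_up i x x' l)
  define L where "L = 2 * (2 * of_int i + 1) * \<theta>"
  have L: "0 < L" using t down_up(3) by (simp add: L_def)
  define c where "c = (of_int (i + 1))\<^sup>2 - \<theta> * x"
  define c' where "c' = (of_int (i + 1))\<^sup>2 - \<theta> * x'"
  define d where "d = icpt \<theta> (- i) + icpt \<theta> (- i - 1) - c"
  have c: "icpt \<theta> (i + 1) < c" "c < icpt \<theta> (- (i + 1))" using abs_height_coord[OF t(1), of "i + 1" c] height_coord_eqI[OF t(1) c_def] down_up by auto
  have c': "icpt \<theta> (i + 1) < c'" "c' < icpt \<theta> (- (i + 1))" using abs_height_coord[OF t(1), of "i + 1" c'] height_coord_eqI[OF t(1) c'_def] down_up by auto
  have x': "x' = of_int (2 * i + 1) * (1 + 1 / \<theta>) + of_int (2 * (2 * i + 1) * l) - x" using down_up(6) by linarith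
  have eq: "c' = d + of_int (- l - 1) * L"
    using t unfolding c'_def c_def d_def x' L_def icpt_def by (simp add: algebra_simps power2_eq_square)
  have it: "0 \<le> of_int i * \<theta>" using t down_up(3) by simp
  have i0: "0 \<le> (of_int i :: real)" using down_up(3) by simp
  have "- L < c' - d" using c c' unfolding L_def d_def icpt_def
    by (simp add: algebra_simps power2_eq_square) (use it i0 t in linarith)
  then have "- L < of_int (- l - 1) * L" using eq by linarith
  then have l: "0 \<le> - l - 1" using ge_if_gt_pred L by blast
  then have rl: "real (nat (- l - 1)) = of_int (- l - 1)" by simp
  have "0 \<le> of_int (- l - 1) * L" using l L by (intro mult_nonneg_nonneg) auto
  then have "d \<le> c'" using eq by linarith
  then have c2: "icpt \<theta> (- i) < c" using c' unfolding d_def by simp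
  have "flip (- \<theta>) c = icpt (- \<theta>) i + icpt (- \<theta>) (i + 1) - c"
    using c2 c(2) by (intro flip_eq) (simp_all add: icpt_uminus)
  then have fd: "flip (- \<theta>) c = d" unfolding d_def by (simp add: icpt_uminus)
  have "icpt \<theta> i \<le> icpt \<theta> (- i)" using it by (simp add: icpt_def mult.commute)
  moreover have "icpt \<theta> (- i) < d" using c(2) by (simp add: d_def)
  ultimately have "icpt \<theta> i < d" by linarith
  from return_map_bounces[OF t(1) down_up(3) this, of "nat (- l - 1)"]
  have T: "(return_map \<theta> ^^ nat (- l - 1)) d = c'" using c'(2) eq rl unfolding L_def by simp
  have "d = return_map \<theta> ((return_map \<theta> ^^ k) b)" using fd s unfolding c_def down_up chord_of_def
    by (simp add: return_map_def)
  then show ?thesis using T down_up unfolding c'_def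
    by (intro exI[of _ "nat (- l - 1) + Suc k"]) (simp only: funpow_add, simp add: chord_of_def)
qed

lemma pass_crosses:
  assumes "0 < \<theta>" "pass \<eta> s s'"
  shows "crosses \<theta> (fst s') (chord_of \<theta> s')"
proof -
  have "1 \<le> fst s' \<and> \<bar>fst (snd s')\<bar> < of_int (fst s')" using assms(2) by cases auto
  then show ?thesis
    using abs_height_coord[OF assms(1), of "fst s'" "chord_of \<theta> s'"] height_coord_eqI[OF assms(1), of "chord_of \<theta> s'" "fst s'" "fst (snd s')"]
    by (simp add: crosses_def chord_of_def)
qed

text \<open>
Successive states lie on the successive chords of the leaf. A state on a chord outside the core is
higher than \<open>j\<close>, since a chord that meets the segment at height \<open>j\<^sup>2\<close> or a lower one belongs to
the core.
\<close>

lemma escaping_ascending: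
  assumes t: "0 < \<theta>" "\<theta> < 1" and b: "b \<in> escaping (return_map \<theta>) (core \<theta> j)" "b \<notin> lattice \<theta>"
  shows "height_coord \<theta> j b \<in> ascending (1 / \<theta>) (int j)"
proof -
  have out: "(return_map \<theta> ^^ k) b \<notin> core \<theta> j" if "k \<ge> 1" for k
    using b(1) that by (simp add: escaping_def)
  have out': "flip \<theta> ((return_map \<theta> ^^ k) b) \<notin> core \<theta> j" for k
  proof
    assume "flip \<theta> ((return_map \<theta> ^^ k) b) \<in> core \<theta> j"
    then have "(return_map \<theta> ^^ Suc k) b \<in> core \<theta> j" using flip_core[of \<theta>] t by (simp add: return_map_def)
    then show False using out[of "Suc k"] by simp
  qed
  define good where "good s \<longleftrightarrow> int j < fst s \<and>
    (\<exists>k. chord_of \<theta> s = (if snd (snd s) then (return_map \<theta> ^^ k) b else flip \<theta> ((return_map \<theta> ^^ k) b)))" for s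
  have above: "int j < fst s'" if "chord_of \<theta> s' \<notin> core \<theta> j" "pass (1 / \<theta>) s s'" for s s'
  proof (rule ccontr)
    assume n: "\<not> int j < fst s'"
    have c: "crosses \<theta> (fst s') (chord_of \<theta> s')" using pass_crosses[OF t(1) that(2)] .
    then have "icpt \<theta> (- fst s') \<le> icpt \<theta> (- int j)"
      using icpt_mono[of "- \<theta>" "fst s'" "int j"] n t by (simp add: icpt_uminus crosses_def)
    then show False using c that(1) icpt_ge[of \<theta> "fst s'"] by (simp add: core_def crosses_def)
  qed
  have follow: "good s'" if p: "pass (1 / \<theta>) s s'" and j: "int j \<le> fst s"
    and c: "chord_of \<theta> s = (if snd (snd s) then (return_map \<theta> ^^ k) b else flip \<theta> ((return_map \<theta> ^^ k) b))" for s s' k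
  proof -
    obtain k' where k': "chord_of \<theta> s' = (if snd (snd s') then (return_map \<theta> ^^ k') b else flip \<theta> ((return_map \<theta> ^^ k') b))"
       "\<not> snd (snd s) \<and> snd (snd s') \<longrightarrow> k < k'"
      using pass_chord[OF t p c] by blast
    have "int j < fst s'"
    proof (cases "snd (snd s) \<and> snd (snd s')")
      case up: True
      show ?thesis using p up j by cases auto
    next
      case False
      have "chord_of \<theta> s' \<notin> core \<theta> j"
      proof (cases "snd (snd s')")
        case True
        then show ?thesis using k' False out[of k'] by simp
      next
        case down: False
        then show ?thesis using k'(1) out'[of k'] by simp
      qed
      then show ?thesis using above p by blast
    qed
    then show ?thesis using k'(1) unfolding good_def by blast
  qed
  define s0 where "s0 = (int j, height_coord \<theta> j b, True)"
  have s0: "chord_of \<theta> s0 = b" using line_of_height_coord[OF t(1), of "int j" b] by (simp add: s0_def chord_of_def)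
  have "good s" if "(pass (1 / \<theta>))\<^sup>+\<^sup>+ s0 s" for s
    using that
  proof (induction rule: tranclp_induct)
    case (base s)
    then show ?case using follow[of s0 s 0] s0 by (simp add: s0_def)
  next
    case (step s s')
    from step.IH obtain k where "int j \<le> fst s"
      "chord_of \<theta> s = (if snd (snd s) then (return_map \<theta> ^^ k) b else flip \<theta> ((return_map \<theta> ^^ k) b))"
      unfolding good_def by auto
    then show ?case by (rule follow[OF step.hyps(2)])
  qed
  moreover have "\<bar>height_coord \<theta> j b\<bar> < int j"
    using escaping_core_shallow[OF t b] abs_height_coord[OF t(1), of "int j" b] by simp
  ultimately show ?thesis by (auto simp: ascending_def s0_def good_def)
qed


definition state_of :: "real \<Rightarrow> int \<Rightarrow> real \<Rightarrow> bool \<Rightarrow> int \<times> real \<times> bool" where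
  "state_of \<theta> i b up = (i, height_coord \<theta> i b, up)"

text \<open>
The segments met by a chord are consecutive, as the intercepts of the vertices form a convex
sequence.
\<close>

lemma crosses_between:
  assumes "0 < \<theta>" "crosses \<theta> i b" "crosses \<theta> n b" "i \<le> l" "l \<le> n"
  shows "crosses \<theta> l b"
proof -
  have "icpt \<theta> l < b"
  proof (cases "\<theta> \<le> 2 * of_int l + 1")
    case True
    then show ?thesis using icpt_mono[of \<theta> l n] assms by (simp add: crosses_def)
  next
    case False
    then show ?thesis using icpt_antimono[of l \<theta> i] assms by (simp add: crosses_def)
  qed
  moreover have "icpt \<theta> (- i) \<le> icpt \<theta> (- l)"
    using icpt_mono[of "- \<theta>" i l] assms by (simp add: icpt_uminus crosses_def)
  ultimately show ?thesis using assms by (auto simp: crosses_def)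
qed

context
  fixes \<theta> :: real
  assumes theta: "0 < \<theta>"
begin

lemma crosses_coord: "crosses \<theta> i b \<Longrightarrow> \<bar>height_coord \<theta> i b\<bar> < of_int i"
  using abs_height_coord[OF theta] by (simp add: crosses_def)

lemma pass_up:
  assumes "crosses \<theta> i b" "crosses \<theta> (i + 1) b"
  shows "pass (1 / \<theta>) (state_of \<theta> i b True) (state_of \<theta> (i + 1) b True)"
  unfolding state_of_def using crosses_coord[OF assms(1)] crosses_coord[OF assms(2)] assms(1) theta
  by (intro pass.up_up[where k = 0]) (simp_all add: crosses_def height_coord_def field_simps power2_eq_square)

lemma pass_down:
  assumes "crosses \<theta> i b" "crosses \<theta> (i + 1) b"
  shows "pass (1 / \<theta>) (state_of \<theta> (i + 1) b False) (state_of \<theta> i b False)"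
  unfolding state_of_def using crosses_coord[OF assms(1)] crosses_coord[OF assms(2)] assms(1) theta
  by (intro pass.down_down[where k = 0]) (simp_all add: crosses_def height_coord_def field_simps power2_eq_square)

lemma pass_bounce_top:
  assumes "crosses \<theta> i b" "crosses \<theta> i b'" "b + b' = icpt \<theta> i + icpt \<theta> (i + 1)"
  shows "pass (1 / \<theta>) (state_of \<theta> i b True) (state_of \<theta> i b' False)"
proof -
  have b': "b' = icpt \<theta> i + icpt \<theta> (i + 1) - b" using assms(3) by simp
  show ?thesis
    unfolding state_of_def using crosses_coord[OF assms(1)] crosses_coord[OF assms(2)] assms(1) theta
    by (intro pass.up_down[where k = 0])
       (simp_all add: crosses_def height_coord_def b' icpt_def field_simps power2_eq_square)
qed

text \<open>
The two alternatives are the crossing of the edge \<open>- i - 1\<close> and, when the slope exceeds \<open>2 i + 1\<close>,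
of the edge \<open>i\<close>, through which steep leaves leave \<open>Q\<^sup>+\<close> when they descend.
\<close>

lemma pass_bounce_bottom:
  assumes "0 \<le> i" "crosses \<theta> (i + 1) b" "crosses \<theta> (i + 1) b'"
    "b + b' = icpt \<theta> (- i) + icpt \<theta> (- i - 1) \<or> b + b' = icpt \<theta> i + icpt \<theta> (i + 1)"
  shows "pass (1 / \<theta>) (state_of \<theta> (i + 1) b False) (state_of \<theta> (i + 1) b' True)"
  using assms(4)
proof
  assume "b + b' = icpt \<theta> (- i) + icpt \<theta> (- i - 1)"
  then have b': "b' = icpt \<theta> (- i) + icpt \<theta> (- i - 1) - b" by simp
  show ?thesis
    unfolding state_of_def using crosses_coord[OF assms(2)] crosses_coord[OF assms(3)] assms(1) theta
    by (intro pass.down_up[where k = "- 1"])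
       (simp_all add: height_coord_def b' icpt_def field_simps power2_eq_square)
next
  assume "b + b' = icpt \<theta> i + icpt \<theta> (i + 1)"
  then have b': "b' = icpt \<theta> i + icpt \<theta> (i + 1) - b" by simp
  show ?thesis
    unfolding state_of_def using crosses_coord[OF assms(2)] crosses_coord[OF assms(3)] assms(1) theta
    by (intro pass.down_up[where k = 0])
       (simp_all add: height_coord_def b' icpt_def field_simps power2_eq_square)
qed

lemma climb:
  assumes "i \<le> n" "crosses \<theta> i b" "crosses \<theta> n b"
  shows "(pass (1 / \<theta>))\<^sup>*\<^sup>* (state_of \<theta> i b True) (state_of \<theta> n b True)"
  using assms
proof (induction n rule: int_ge_induct)
  case (step n)
  have "crosses \<theta> n b" by (rule crosses_between[OF theta step.prems]) (use step.hyps in auto)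
  then show ?case using step pass_up by (metis rtranclp.rtrancl_into_rtrancl)
qed simp

lemma descend:
  assumes "i \<le> n" "crosses \<theta> i b" "crosses \<theta> n b"
  shows "(pass (1 / \<theta>))\<^sup>*\<^sup>* (state_of \<theta> n b False) (state_of \<theta> i b False)"
  using assms
proof (induction n rule: int_ge_induct)
  case (step n)
  have "crosses \<theta> n b" by (rule crosses_between[OF theta step.prems]) (use step.hyps in auto)
  then show ?case using step pass_down by (metis converse_rtranclp_into_rtranclp)
qed simp

end

lemma flip_interval_exists:
  assumes "icpt \<theta> k < b" "b \<notin> lattice \<theta>"
  obtains n where "icpt \<theta> n < b" "b < icpt \<theta> (n + 1)"
proof (rule ccontr)
  assume no: "\<not> thesis"
  note result = that
  have all: "icpt \<theta> n < b" if "k \<le> n" for n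
    using that
  proof (induction n rule: int_ge_induct)
    case base
    then show ?case using assms(1) by simp
  next
    case (step n)
    then have "\<not> b < icpt \<theta> (n + 1)" using no result by blast
    moreover have "b \<noteq> icpt \<theta> (n + 1)" using assms(2) icpt_lattice by blast
    ultimately show ?case by simp
  qed
  \<comment> \<open>large enough for \<open>icpt \<theta> n = n (n - \<theta>)\<close> to exceed \<open>b\<close>\<close>
  define n where "n = max k (max 1 \<lceil>\<theta> + \<bar>b\<bar>\<rceil>)"
  have n: "k \<le> n" "1 \<le> (of_int n :: real)" "\<bar>b\<bar> \<le> of_int n - \<theta>" unfolding n_def by linarith+
  have "1 * \<bar>b\<bar> \<le> of_int n * (of_int n - \<theta>)" using n(2,3) by (intro mult_mono) auto
  then have "b \<le> icpt \<theta> n" by (simp add: icpt_def power2_eq_square algebra_simps)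
  then show False using all[OF n(1)] by simp
qed

text \<open>
For \<open>\<theta> > 1\<close> each chord meets some horizontal segment, because a leaf then turns around a cylinder
by less than half its circumference per passage. So a chord climbs to its highest segment, crosses
an edge, descends to the lowest segment of the next chord, crosses an edge again, and all this is
a sequence of steps of \<open>pass\<close>. That the new state is on the lowest segment met by the new chord
lets \<open>ascending_escaping\<close> control all segments of this chord.
\<close>

lemma pass_return_map:
  assumes t: "1 < \<theta>" and b: "crosses \<theta> i b" "b \<notin> lattice \<theta>"
  obtains m where "crosses \<theta> m (return_map \<theta> b)"
    "(pass (1 / \<theta>))\<^sup>+\<^sup>+ (state_of \<theta> i b True) (state_of \<theta> m (return_map \<theta> b) True)"
    "\<And>l. crosses \<theta> l (return_map \<theta> b) \<Longrightarrow> m \<le> l"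
proof -
  note result = that
  have t0: "0 < \<theta>" using t by simp
  obtain n where n: "icpt \<theta> n < b" "b < icpt \<theta> (n + 1)"
    using flip_interval_exists[of \<theta> i b] b by (auto simp: crosses_def)
  have nt: "\<theta> < 2 * of_int n + 1" using n icpt_less_iff[of \<theta> n] by linarith
  have above: "l \<le> n" if "icpt \<theta> l < c" "c < icpt \<theta> (n + 1)" for l c
  proof (rule ccontr)
    assume "\<not> l \<le> n"
    then have "icpt \<theta> (n + 1) \<le> icpt \<theta> l" using nt by (intro icpt_mono) auto
    then show False using that by simp
  qed
  have i: "1 \<le> i" "i \<le> n" using above[of i b] b n by (auto simp: crosses_def)
  have "icpt \<theta> (- i) \<le> icpt \<theta> (- n)" using icpt_mono[of "- \<theta>" i n] i t by (simp add: icpt_uminus)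
  then have bn: "crosses \<theta> n b" using n i b by (simp add: crosses_def)
  define c where "c = flip \<theta> b"
  have c: "c = icpt \<theta> n + icpt \<theta> (n + 1) - b" unfolding c_def by (rule flip_eq[OF n])
  have c_int: "icpt \<theta> n < c" "c < icpt \<theta> (n + 1)" using c n by auto
  have wide: "icpt \<theta> (l + 1) < icpt \<theta> (- l)" if "0 \<le> l" for l
  proof -
    have "0 < (2 * of_int l + 1) * (\<theta> - 1)" using that t by (intro mult_pos_pos) auto
    then show ?thesis by (simp add: icpt_def power2_eq_square algebra_simps)
  qed
  have cn: "crosses \<theta> n c" using c_int wide[of n] i by (simp add: crosses_def)
  have top: "(pass (1 / \<theta>))\<^sup>+\<^sup>+ (state_of \<theta> i b True) (state_of \<theta> n c False)"
    using climb[OF t0 i(2) b(1) bn] pass_bounce_top[OF t0 bn cn] c by (auto intro: rtranclp_into_tranclp1)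
  have c_lat: "c \<notin> lattice (- \<theta>)" unfolding c_def using b(2) flip_lattice by (simp add: lattice_uminus)
  obtain q where q: "icpt (- \<theta>) q < c" "c < icpt (- \<theta>) (q + 1)"
    using flip_interval_exists[of "- \<theta>" "- n" c] c_lat c_int by (auto simp: icpt_uminus)
  have qt: "- \<theta> < 2 * of_int q + 1" using q icpt_less_iff[of "- \<theta>" q] by linarith
  define d where "d = return_map \<theta> b"
  have d: "d = icpt (- \<theta>) q + icpt (- \<theta>) (q + 1) - c"
    unfolding d_def return_map_def comp_apply c_def[symmetric] by (rule flip_eq[OF q])
  have d_int: "icpt (- \<theta>) q < d" "d < icpt (- \<theta>) (q + 1)" using d q by auto
  have fin: ?thesis if p: "0 \<le> p" and "crosses \<theta> (p + 1) c" "crosses \<theta> (p + 1) d"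
    "c + d = icpt \<theta> (- p) + icpt \<theta> (- p - 1) \<or> c + d = icpt \<theta> p + icpt \<theta> (p + 1)"
    "\<And>l. crosses \<theta> l d \<Longrightarrow> p + 1 \<le> l" for p
  proof -
    have "p + 1 \<le> n" using above[of "p + 1" c] that(2) c_int by (simp add: crosses_def)
    from descend[OF t0 this that(2) cn] pass_bounce_bottom[OF t0 p that(2-4)]
    have "(pass (1 / \<theta>))\<^sup>+\<^sup>+ (state_of \<theta> i b True) (state_of \<theta> (p + 1) d True)"
      using top by (meson tranclp.trancl_into_trancl tranclp_rtranclp_tranclp)
    then show ?thesis using that(3,5) result unfolding d_def by blast
  qed
  \<comment> \<open>the next edge is on the left branch of the polygon, or has nonnegative index and slope less than \<open>\<theta>\<close>\<close>
  show ?thesis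
  proof (cases "0 \<le> q")
    case True
    have cr: "crosses \<theta> (q + 1) e" if "icpt (- \<theta>) q < e" "e < icpt (- \<theta>) (q + 1)" for e
      using that wide[OF True] True by (simp add: crosses_def icpt_uminus)
    have "q + 1 \<le> l" if "crosses \<theta> l d" for l
    proof (rule ccontr)
      assume "\<not> q + 1 \<le> l"
      then have "icpt (- \<theta>) l \<le> icpt (- \<theta>) q" using that t by (intro icpt_mono) (auto simp: crosses_def)
      then show False using that d_int by (simp add: crosses_def icpt_uminus)
    qed
    then show ?thesis using fin[OF True cr cr] q d_int d by (simp add: icpt_uminus)
  next
    case False
    define p where "p = - q - 1"
    have p: "0 \<le> p" "2 * of_int p + 1 < \<theta>" using False qt by (auto simp: p_def)
    have pq: "icpt (- \<theta>) q = icpt \<theta> (p + 1)" "icpt (- \<theta>) (q + 1) = icpt \<theta> p"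
      by (simp_all add: icpt_uminus p_def)
    have "icpt \<theta> p \<le> icpt \<theta> (- (p + 1))" using p t by (simp add: icpt_def power2_eq_square algebra_simps)
    then have cr: "crosses \<theta> (p + 1) e" if "icpt (- \<theta>) q < e" "e < icpt (- \<theta>) (q + 1)" for e
      using that p(1) unfolding pq crosses_def by simp
    have "p + 1 \<le> l" if "crosses \<theta> l d" for l
    proof (rule ccontr)
      assume "\<not> p + 1 \<le> l"
      then have "icpt \<theta> p \<le> icpt \<theta> l" using p by (intro icpt_antimono) auto
      then show False using that d_int unfolding pq by (simp add: crosses_def)
    qed
    then show ?thesis using fin[OF p(1) cr cr] q d_int d unfolding pq by simp
  qed
qed

text \<open>
For steep slopes the core may contain chords that pass above the height \<open>j\<^sup>2\<close>. This is the part of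
it consisting of the chords that meet one of the lowest \<open>j\<close> segments.
\<close>

definition wall :: "real \<Rightarrow> nat \<Rightarrow> real set" where
  "wall \<theta> j = {b. \<exists>i \<le> int j. crosses \<theta> i b}"

lemma wall_borel: "wall \<theta> j \<in> sets borel"
proof -
  have "wall \<theta> j = (\<Union>i\<in>{1..int j}. {icpt \<theta> i <..< icpt \<theta> (- i)})"
    by (auto simp: wall_def crosses_def)
  then show ?thesis by auto
qed

lemma wall_subset_core: "0 \<le> \<theta> \<Longrightarrow> wall \<theta> j \<subseteq> core \<theta> j"
proof
  fix b assume t: "0 \<le> \<theta>" and "b \<in> wall \<theta> j"
  then obtain i where i: "i \<le> int j" "crosses \<theta> i b" by (auto simp: wall_def)
  then have "icpt \<theta> (- i) \<le> icpt \<theta> (- int j)"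
    using icpt_mono[of "- \<theta>" i "int j"] t by (simp add: icpt_uminus crosses_def)
  then show "b \<in> core \<theta> j" using i icpt_ge[of \<theta> i] by (simp add: core_def crosses_def)
qed

text \<open>
The converse of \<open>escaping_ascending\<close>, for steep slopes and for the smaller set \<open>wall \<theta> j\<close>: a
return to it would be witnessed by a state of height at most \<open>j\<close>.
\<close>

lemma ascending_escaping:
  assumes t: "1 < \<theta>" and b: "height_coord \<theta> j b \<in> ascending (1 / \<theta>) (int j)" "b \<notin> lattice \<theta>" and j: "1 \<le> j"
  shows "b \<in> escaping (return_map \<theta>) (wall \<theta> j)"
proof -
  have bj: "crosses \<theta> (int j) b"
    using b(1) abs_height_coord[of \<theta> "int j" b] t j by (simp add: ascending_def crosses_def)
  have orbit: "\<exists>m. crosses \<theta> m ((return_map \<theta> ^^ k) b) \<and>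
      (pass (1 / \<theta>))\<^sup>*\<^sup>* (state_of \<theta> j b True) (state_of \<theta> m ((return_map \<theta> ^^ k) b) True)" for k
  proof (induction k)
    case 0
    then show ?case using bj by auto
  next
    case (Suc k)
    then obtain m where m: "crosses \<theta> m ((return_map \<theta> ^^ k) b)"
      "(pass (1 / \<theta>))\<^sup>*\<^sup>* (state_of \<theta> j b True) (state_of \<theta> m ((return_map \<theta> ^^ k) b) True)" by blast
    obtain m' where "crosses \<theta> m' (return_map \<theta> ((return_map \<theta> ^^ k) b))"
      "(pass (1 / \<theta>))\<^sup>+\<^sup>+ (state_of \<theta> m ((return_map \<theta> ^^ k) b) True)
         (state_of \<theta> m' (return_map \<theta> ((return_map \<theta> ^^ k) b)) True)"
      using pass_return_map[OF t m(1) return_map_funpow_lattice[OF b(2)]] by metis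
    then show ?case using m(2) by (auto intro!: exI[of _ m'] dest: tranclp_into_rtranclp)
  qed
  have "(return_map \<theta> ^^ k) b \<notin> wall \<theta> j" if "1 \<le> k" for k
  proof
    assume w: "(return_map \<theta> ^^ k) b \<in> wall \<theta> j"
    obtain k' where k: "k = Suc k'" using \<open>1 \<le> k\<close> by (cases k) auto
    obtain m where m: "crosses \<theta> m ((return_map \<theta> ^^ k') b)"
      "(pass (1 / \<theta>))\<^sup>*\<^sup>* (state_of \<theta> j b True) (state_of \<theta> m ((return_map \<theta> ^^ k') b) True)"
      using orbit by blast
    obtain m' where m': "(pass (1 / \<theta>))\<^sup>+\<^sup>+ (state_of \<theta> m ((return_map \<theta> ^^ k') b) True) (state_of \<theta> m' ((return_map \<theta> ^^ k) b) True)"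
      "\<And>l. crosses \<theta> l ((return_map \<theta> ^^ k) b) \<Longrightarrow> m' \<le> l"
      using pass_return_map[OF t m(1) return_map_funpow_lattice[OF b(2)]] unfolding k by auto
    have "(pass (1 / \<theta>))\<^sup>+\<^sup>+ (state_of \<theta> j b True) (state_of \<theta> m' ((return_map \<theta> ^^ k) b) True)"
      using m(2) m'(1) by (rule rtranclp_tranclp_tranclp)
    then have "int j < m'" using b(1) by (auto simp: ascending_def state_of_def)
    then show False using w m'(2) by (fastforce simp: wall_def)
  qed
  then show ?thesis using bj by (auto simp: escaping_def wall_def)
qed

text \<open>
The points escaping from the core for the slope \<open>\<theta>\<close> are mapped affinely to points escaping from
the wall, hence from part of the core, for \<open>\<theta>'\<close>, through their common description by \<open>ascending\<close>.
The factor comes from passing between intercepts and abscissas. The sign \<open>\<sigma>\<close> accounts for a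
reflection in the vertical axis when \<open>1 / \<theta> - 2 k\<close> is negative.
\<close>

lemma mass_twist_horizontal:
  assumes t: "0 < \<theta>" "\<theta> < 1" and t': "1 < \<theta>'" "\<bar>1 / \<theta> - 2 * of_int k\<bar> = 1 / \<theta>'"
  shows "mass \<theta> j * \<theta>' \<le> mass \<theta>' j * \<theta>"
proof (cases "j = 0")
  case True
  then have "mass \<theta> j = 0" using mass_shallow[OF t, of j] mass_nonneg[of \<theta> j] by simp
  then show ?thesis using mass_nonneg[of \<theta>' j] t by simp
next
  case False
  define \<sigma> where "\<sigma> = (if 0 \<le> 1 / \<theta> - 2 * of_int k then 1 else - 1 :: real)"
  have sg: "1 / \<theta>' = \<sigma> * (1 / \<theta> - 2 * of_int k)" "\<sigma> * \<sigma> = 1" "\<bar>\<sigma>\<bar> = 1" "\<sigma> \<noteq> 0"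
    using t'(2) by (auto simp: \<sigma>_def)
  have asc: "\<sigma> * x \<in> ascending (1 / \<theta>') j" if "x \<in> ascending (1 / \<theta>) j" for x
    using ascending_mirror[of x "1 / \<theta> - 2 * of_int k" j] ascending_twist[of "1 / \<theta>" k j] that sg(1)
    unfolding \<sigma>_def by (auto split: if_splits)
  \<comment> \<open>the intercept for the slope \<open>\<theta>'\<close> of the point at height \<open>j\<^sup>2\<close> with abscissa multiplied by \<open>\<sigma>\<close>\<close>
  define \<phi> where "\<phi> b = ((of_nat j)\<^sup>2 - \<theta>' * \<sigma> / \<theta> * (of_nat j)\<^sup>2) + (\<theta>' * \<sigma> / \<theta>) * b" for b
  have phi: "\<phi> b = (of_nat j)\<^sup>2 - \<theta>' * (\<sigma> * height_coord \<theta> j b)" for b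
    by (simp add: \<phi>_def height_coord_def algebra_simps diff_divide_distrib)
  have hc: "height_coord \<theta>' j (\<phi> b) = \<sigma> * height_coord \<theta> j b" for b
    using t' by (intro height_coord_eqI) (simp_all add: phi)
  have lat: "\<phi> b \<notin> lattice \<theta>'" if b: "b \<notin> lattice \<theta>" for b
  proof
    assume "\<phi> b \<in> lattice \<theta>'"
    then obtain m n where mn: "\<phi> b = of_int m + of_int n * \<theta>'" by (auto simp: lattice_def)
    have "\<theta>' * (\<sigma> * height_coord \<theta> j b) = (of_nat j)\<^sup>2 - (of_int m + of_int n * \<theta>')"
      using phi[of b] mn by simp
    then have "\<sigma> * height_coord \<theta> j b = ((of_nat j)\<^sup>2 - of_int m) * (1 / \<theta>') - of_int n"
      using t'(1) by (simp add: field_simps)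
    also have "\<dots> = ((of_nat j)\<^sup>2 - of_int m) * (\<sigma> * (1 / \<theta> - 2 * of_int k)) - of_int n"
      using sg(1) by simp
    finally have "\<sigma> * (\<sigma> * height_coord \<theta> j b) = \<sigma> * (((of_nat j)\<^sup>2 - of_int m) * (\<sigma> * (1 / \<theta> - 2 * of_int k)) - of_int n)"
      by simp
    also have "\<dots> = (\<sigma> * \<sigma>) * (((of_nat j)\<^sup>2 - of_int m) * (1 / \<theta> - 2 * of_int k)) - \<sigma> * of_int n"
      by (simp add: algebra_simps)
    finally have h: "height_coord \<theta> j b = ((of_nat j)\<^sup>2 - of_int m) * (1 / \<theta> - 2 * of_int k) - \<sigma> * of_int n"
      using sg(2) by (simp add: mult.assoc[symmetric])
    have "b = (of_nat j)\<^sup>2 - \<theta> * height_coord \<theta> j b" using line_of_height_coord[OF t(1), of "int j" b] by simp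
    also have "\<dots> = of_int m + \<theta> * (2 * of_int k * ((of_nat j)\<^sup>2 - of_int m) + \<sigma> * of_int n)"
      unfolding h using t(1) by (simp add: field_simps)
    also have "\<sigma> = of_int (if 0 \<le> 1 / \<theta> - 2 * of_int k then 1 else - 1)" by (simp add: \<sigma>_def)
    finally have "b \<in> lattice \<theta>"
      by (intro latticeI[of _ m "2 * k * ((int j)\<^sup>2 - m) + (if 0 \<le> 1 / \<theta> - 2 * of_int k then 1 else - 1) * n"]) (simp add: algebra_simps)
    then show False using b by simp
  qed
  let ?E = "escaping (return_map \<theta>) (core \<theta> j)" and ?W = "escaping (return_map \<theta>') (wall \<theta>' j)"
  have "?E \<subseteq> \<phi> -` ?W \<union> lattice \<theta>"
  proof
    fix b assume b: "b \<in> ?E"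
    show "b \<in> \<phi> -` ?W \<union> lattice \<theta>"
    proof (cases "b \<in> lattice \<theta>")
      case f: False
      have "height_coord \<theta>' j (\<phi> b) \<in> ascending (1 / \<theta>') (int j)"
        unfolding hc using asc escaping_ascending[OF t b f] by simp
      then have "\<phi> b \<in> ?W" using ascending_escaping[OF t'(1) _ lat[OF f], of j] False by simp
      then show ?thesis by simp
    qed simp
  qed
  have W: "?W \<in> sets borel" by (intro sets_escaping return_map_borel wall_borel)
  have vW: "\<phi> -` ?W \<in> sets borel"
    by (intro measurable_vimage_borel W) (simp add: \<phi>_def[abs_def])
  have "emeasure lborel ?E \<le> emeasure lborel (\<phi> -` ?W \<union> lattice \<theta>)"
    using \<open>?E \<subseteq> _\<close> vW by (intro emeasure_mono) (simp_all add: sets.Un sets.countable countable_lattice)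
  also have "\<dots> = emeasure lborel (\<phi> -` ?W)"
    using vW by (intro emeasure_Un_null_set countable_imp_null_set_lborel countable_lattice) simp
  finally have le: "emeasure lborel ?E \<le> emeasure lborel (\<phi> -` ?W)" .
  have scale: "\<bar>\<theta>' * \<sigma> / \<theta>\<bar> = \<theta>' / \<theta>" using t t' sg by (simp add: abs_mult)
  have "emeasure lborel ?W = ennreal (\<theta>' / \<theta>) * emeasure lborel (\<phi> -` ?W)"
    using emeasure_vimage_affine[OF _ W, of "\<theta>' * \<sigma> / \<theta>"] t t' sg unfolding \<phi>_def scale[symmetric] by simp
  moreover have "emeasure lborel ?W \<le> ennreal (mass \<theta>' j)"
    unfolding emeasure_escaping_core[symmetric] using t'
    by (intro emeasure_escaping_mono[OF return_map_automorphism wall_borel core_borel wall_subset_core emeasure_core]) simp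
  moreover have "ennreal (\<theta>' / \<theta> * mass \<theta> j) = ennreal (\<theta>' / \<theta>) * emeasure lborel ?E"
    unfolding emeasure_escaping_core using t t' by (intro ennreal_mult) (simp_all add: mass_nonneg)
  ultimately have "ennreal (\<theta>' / \<theta> * mass \<theta> j) \<le> ennreal (mass \<theta>' j)"
    using mult_left_mono[OF le, of "ennreal (\<theta>' / \<theta>)"] by simp
  then have "\<theta>' / \<theta> * mass \<theta> j \<le> mass \<theta>' j" by (simp add: mass_nonneg ennreal_le_iff)
  then show ?thesis using t by (simp add: field_simps)
qed

section \<open>The Euclidean algorithm with even quotients\<close>

lemma irrational_ratio_not_even_multiple:
  fixes a b :: real
  assumes "0 < b" "a / b \<notin> \<rat>"
  shows "a \<noteq> 2 * real m * b"
proof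
  assume "a = 2 * real m * b"
  then have "a / b = of_nat (2 * m)" using assms(1) by simp
  then show False using assms(2) by (metis Rats_of_nat)
qed

text \<open>
The reduction subtracts the nearest even multiple of \<open>b\<close>, which is \<open>2 b\<close> when \<open>a\<close> is between \<open>b\<close>
and \<open>2 b\<close>.
\<close>

lemma reduce_mod_double:
  fixes a b :: real
  assumes "0 < b" "b < a" "a / b \<notin> \<rat>"
  obtains m :: nat where "m \<ge> 1" "\<bar>a - 2 * real m * b\<bar> < b" "a / b < 2 \<Longrightarrow> m = 1"
proof -
  define q where "q = a / b"
  define k where "k = \<lfloor>(q + 1) / 2\<rfloor>"
  have ab: "1 < q" using assms by (simp add: q_def)
  have "of_int k \<le> (q + 1) / 2" "(q + 1) / 2 < of_int k + 1"
    unfolding k_def by (rule of_int_floor_le, rule real_of_int_floor_add_one_gt)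
  then have k: "2 * of_int k - 1 \<le> q" "q < 2 * of_int k + 1"
    by (simp_all add: field_simps)
  have k1: "1 \<le> k" unfolding k_def using ab by (simp add: le_floor_iff)
  have "q \<noteq> 2 * of_int k - 1"
    using assms(3) unfolding q_def by (metis Rats_1 Rats_diff Rats_mult Rats_number_of Rats_of_int)
  then have "\<bar>a / b - 2 * of_int k\<bar> < 1" using k unfolding q_def abs_less_iff by auto
  then have "\<bar>a / b - 2 * of_int k\<bar> * b < 1 * b" using assms(1) by (intro mult_strict_right_mono)
  moreover have "\<bar>a / b - 2 * of_int k\<bar> * b = \<bar>a - 2 * of_int k * b\<bar>"
    using assms(1) by (simp add: abs_mult_pos field_simps)
  ultimately have "\<bar>a - 2 * of_int k * b\<bar> < b" by simp
  moreover have "a / b < 2 \<Longrightarrow> k = 1" using k k1 unfolding q_def by linarith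
  ultimately show ?thesis using that[of "nat k"] k1 by (simp add: of_nat_nat)
qed

text \<open>
The bookkeeping of a run of the Euclidean algorithm from \<open>(a, b, j)\<close> to \<open>(a', b', j')\<close>, where \<open>j\<close>
accumulates the halves of the quotients. The difference \<open>a - b\<close> never increases. The potential
\<open>2 j (a - b) + a + b\<close> decreases by at least \<open>2 j\<close> times the decrease of \<open>a - b\<close>: a step with
quotient \<open>2\<close> that does not change \<open>a - b\<close> pays for its increase of \<open>j\<close> with the decrease of
\<open>a + b\<close>.
\<close>

definition descends :: "real \<times> real \<times> nat \<Rightarrow> real \<times> real \<times> nat \<Rightarrow> bool" where
  "descends = (\<lambda>(a, b, j) (a', b', j'). 0 < b' \<and> b' < a' \<and> a' / b' \<notin> \<rat> \<and> a' \<le> a \<and> a' - b' \<le> a - b \<and> j \<le> j' \<and>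
     2 * (j' * (a' - b')) + a' + b' \<le> 2 * (j * (a - b)) + a + b - 2 * (j * ((a - b) - (a' - b'))))"

lemma descends_refl:
  "0 < b \<Longrightarrow> b < a \<Longrightarrow> a / b \<notin> \<rat> \<Longrightarrow> descends (a, b, j) (a, b, j)"
  by (simp add: descends_def)

lemma descends_trans:
  assumes "descends s s'" "descends s' s''"
  shows "descends s s''"
proof -
  obtain a b j a' b' j' a'' b'' j'' where [simp]: "s = (a, b, j)" "s' = (a', b', j')" "s'' = (a'', b'', j'')"
    by (metis prod.exhaust)
  have "j * ((a' - b') - (a'' - b'')) \<le> j' * ((a' - b') - (a'' - b''))"
    using assms by (intro mult_right_mono) (auto simp: descends_def)
  then show ?thesis using assms by (auto simp: descends_def algebra_simps)
qed

lemma descends_step: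
  fixes a b :: real and j m :: nat
  assumes "0 < b" "b < a" "a / b \<notin> \<rat>" "1 \<le> m" and lt: "\<bar>a - 2 * real m * b\<bar> < b"
  shows "descends (a, b, j) (b, \<bar>a - 2 * real m * b\<bar>, j + m)"
proof -
  define r where "r = \<bar>a - 2 * real m * b\<bar>"
  have "a \<noteq> 2 * real m * b" using irrational_ratio_not_even_multiple assms(1) assms(3) by blast
  then have r: "0 < r" "r < b" using lt by (auto simp: r_def)
  have irr: "b / r \<notin> \<rat>"
  proof
    assume "b / r \<in> \<rat>"
    then have "r / b \<in> \<rat>" using Rats_inverse by fastforce
    then have "(a - 2 * real m * b) / b \<in> \<rat>" unfolding r_def
      by (cases "a - 2 * real m * b \<ge> 0") (auto dest: Rats_minus_iff[THEN iffD2] simp: minus_divide_left)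
    then have "(a - 2 * real m * b) / b + 2 * of_nat m \<in> \<rat>" by (intro Rats_add Rats_mult) auto
    moreover have "(a - 2 * real m * b) / b + 2 * of_nat m = a / b" using assms(1) by (simp add: field_simps)
    ultimately show False using assms(3) by simp
  qed
  have mb: "1 * b \<le> m * b" using assms(1,4) by (intro mult_right_mono) auto
  have mr: "1 * r \<le> m * r" using r assms(4) by (intro mult_right_mono) auto
  have "a \<ge> 2 * m * b - r" unfolding r_def by linarith
  then have ge: "a - r \<ge> 2 * (m * (b - r))" using mr by (simp add: algebra_simps)
  have "b - r \<le> a - b" using mb lt unfolding r_def by (auto simp: abs_if algebra_simps split: if_splits)
  then show ?thesis using r irr assms(1,2) ge
    unfolding descends_def prod.case r_def[symmetric] by (simp add: algebra_simps)
qed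

text \<open>
The function \<open>h\<close> stands for the escaping mass in terms of the two remainders. It may be estimated
from above after a reduction, at the cost of increasing \<open>j\<close>. The conclusion will be that it
vanishes.
\<close>

locale descent =
  fixes h :: "real \<Rightarrow> real \<Rightarrow> nat \<Rightarrow> real"
  assumes reduce: "0 < b \<Longrightarrow> b < a \<Longrightarrow> a / b \<notin> \<rat> \<Longrightarrow> \<bar>a - 2 * real m * b\<bar> < b \<Longrightarrow>
        h a b j \<le> h b \<bar>a - 2 * real m * b\<bar> (j + m)"
    and bound: "0 < b \<Longrightarrow> b < a \<Longrightarrow> a / b \<notin> \<rat> \<Longrightarrow> h a b j \<le> 2 * real j * a + 2 * a"
begin

lemma step:
  assumes "0 < b" "b < a" "a / b \<notin> \<rat>"
  obtains a' b' j' where "descends (a, b, j) (a', b', j')" "h a b j \<le> h a' b' j'" "a' = b"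
     "a / b < 2 \<Longrightarrow> b' = 2 * b - a"
proof -
  obtain m :: nat where m: "m \<ge> 1" "\<bar>a - 2 * real m * b\<bar> < b" "a / b < 2 \<Longrightarrow> m = 1"
    using reduce_mod_double[OF assms] by blast
  have "a / b < 2 \<Longrightarrow> \<bar>a - 2 * real m * b\<bar> = 2 * b - a"
    using m(3) assms(1) by (simp add: field_simps)
  then show ?thesis
    using that[OF descends_step[OF assms m(1,2)] reduce[OF assms m(2)]] by blast
qed

text \<open>
As long as \<open>a < 2 b\<close> the quotient is \<open>2\<close> and \<open>a\<close> decreases by the constant \<open>a - b\<close>, so this ends
after at most \<open>N\<close> steps.
\<close>

lemma reach_large_ratio:
  assumes "0 < b" "b < a" "a / b \<notin> \<rat>" "a \<le> real N * (a - b)"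
  shows "\<exists>a' b' j'. descends (a, b, j) (a', b', j') \<and> h a b j \<le> h a' b' j' \<and> 2 * b' < a'"
  using assms
proof (induction N arbitrary: a b j)
  case 0
  then show ?case by simp
next
  case (Suc N)
  show ?case
  proof (cases "2 * b < a")
    case True
    then show ?thesis using descends_refl[OF Suc.prems(1-3)] by blast
  next
    case False
    have "a / b \<noteq> 2" using Suc.prems(3) by (metis Rats_number_of)
    then have "a / b < 2" using False Suc.prems(1) by (simp add: field_simps)
    then obtain j' where D: "descends (a, b, j) (b, 2 * b - a, j')" "h a b j \<le> h b (2 * b - a) j'"
      using step[OF Suc.prems(1-3)] by metis
    have "b \<le> real N * (b - (2 * b - a))" using Suc.prems(4) by (simp add: algebra_simps)
    then obtain a' b' j'' where "descends (b, 2 * b - a, j') (a', b', j'')" "h b (2 * b - a) j' \<le> h a' b' j''" "2 * b' < a'"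
      using Suc.IH[of "2 * b - a" b j'] D(1) unfolding descends_def by auto
    then show ?thesis using D descends_trans by (meson order_trans)
  qed
qed

lemma next_large_ratio:
  assumes "0 < b" "b < a" "a / b \<notin> \<rat>"
  obtains a' b' j' where "descends (a, b, j) (a', b', j')" "h a b j \<le> h a' b' j'" "2 * b' < a'" "a' \<le> b"
proof -
  obtain b1 j1 where s: "descends (a, b, j) (b, b1, j1)" "h a b j \<le> h b b1 j1"
    using step[OF assms] by metis
  have pos: "0 < b1" "b1 < b" "b / b1 \<notin> \<rat>" using s(1) by (auto simp: descends_def)
  have "b / (b - b1) \<le> real (nat \<lceil>b / (b - b1)\<rceil>)" by linarith
  then have "b \<le> real (nat \<lceil>b / (b - b1)\<rceil>) * (b - b1)" using pos by (subst pos_divide_le_eq[symmetric]) simp_all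
  from reach_large_ratio[OF pos this, of j1] obtain a' b' j' where
    t: "descends (b, b1, j1) (a', b', j')" "h b b1 j1 \<le> h a' b' j'" "2 * b' < a'" by blast
  have "a' \<le> b" using t(1) by (simp add: descends_def)
  then show ?thesis using that[OF descends_trans[OF s(1) t(1)] _ t(3)] s(2) t(2) by linarith
qed

text \<open>
When \<open>2 b < a\<close> the bound on \<open>h\<close> is at most \<open>4 j (a - b) + 2 a\<close>. Passing to the second next such
stage at least halves \<open>a - b\<close> and divides \<open>a\<close> by at least four, so the potential
\<open>2 j (a - b) + 2 a + b\<close> decreases by a quarter of that bound. It cannot do so infinitely often if
\<open>h\<close> stays above \<open>c > 0\<close>.
\<close>

lemma no_positive_level:
  assumes "0 < c" "0 < b" "2 * b < a" "a / b \<notin> \<rat>" "c \<le> h a b j"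
    "2 * (j * (a - b)) + a + b + a < real N * (c / 4)"
  shows False
  using assms(2-)
proof (induction N arbitrary: a b j)
  case 0
  moreover have "0 \<le> j * (a - b)" using 0 by (intro mult_nonneg_nonneg) auto
  ultimately show ?case by simp
next
  case (Suc N)
  have "b < a" using Suc.prems by simp
  obtain a1 b1 j1 where s: "descends (a, b, j) (a1, b1, j1)" "h a b j \<le> h a1 b1 j1" "2 * b1 < a1" "a1 \<le> b"
    using next_large_ratio[OF Suc.prems(1) \<open>b < a\<close> Suc.prems(3)] by blast
  have p1: "0 < b1" "b1 < a1" "a1 / b1 \<notin> \<rat>" using s(1) by (auto simp: descends_def)
  obtain a2 b2 j2 where t: "descends (a1, b1, j1) (a2, b2, j2)" "h a1 b1 j1 \<le> h a2 b2 j2" "2 * b2 < a2" "a2 \<le> b1"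
    using next_large_ratio[OF p1] by blast
  have D: "descends (a, b, j) (a2, b2, j2)" using descends_trans[OF s(1) t(1)] .
  have "a - b \<le> 2 * ((a - b) - (a2 - b2))" using D s t Suc.prems by (auto simp: descends_def)
  then have "j * (a - b) \<le> j * (2 * ((a - b) - (a2 - b2)))" by (intro mult_left_mono) auto
  then have "2 * (j2 * (a2 - b2)) + a2 + b2 \<le> 2 * (j * (a - b)) + a + b - j * (a - b)"
    using D by (auto simp: descends_def algebra_simps)
  moreover have "c \<le> 4 * (j * (a - b)) + 2 * a"
  proof -
    have "real j * a \<le> j * (2 * (a - b))" using Suc.prems by (intro mult_left_mono) auto
    then show ?thesis using bound[OF Suc.prems(1) \<open>b < a\<close> Suc.prems(3), of j] Suc.prems(4)
      by (simp add: algebra_simps)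
  qed
  moreover have "a2 \<le> a / 4" using s t Suc.prems by simp
  ultimately have "2 * (j2 * (a2 - b2)) + a2 + b2 + a2 < real N * (c / 4)"
    using Suc.prems by (simp add: algebra_simps)
  moreover have "c \<le> h a2 b2 j2" using s t Suc.prems by linarith
  moreover have "0 < b2" "a2 / b2 \<notin> \<rat>" using D by (auto simp: descends_def)
  ultimately show ?case using Suc.IH t(3) by blast
qed

theorem nonpos:
  assumes "0 < b" "b < a" "a / b \<notin> \<rat>"
  shows "h a b j \<le> 0"
proof (rule ccontr)
  assume c: "\<not> h a b j \<le> 0"
  obtain a' b' j' where s: "descends (a, b, j) (a', b', j')" "h a b j \<le> h a' b' j'" "2 * b' < a'"
    using next_large_ratio[OF assms] by blast
  have "0 < h a b j / 4" using c by simp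
  then obtain N where "2 * (j' * (a' - b')) + a' + b' + a' < real N * (h a b j / 4)"
    using reals_Archimedean3 by blast
  then show False using no_positive_level[of "h a b j" b' a' j' N] s c by (auto simp: descends_def)
qed

end

section \<open>Conservativity of the return map\<close>

text \<open>
The escaping mass in terms of a direction \<open>(x, y)\<close>; it is homogeneous, so that no factor appears
in the two reductions.
\<close>

definition scaled_mass :: "real \<Rightarrow> real \<Rightarrow> nat \<Rightarrow> real" where
  "scaled_mass x y j = x * mass (y / x) j"

lemma scaled_mass_shallow:
  assumes "0 < y" "y < x"
  shows "scaled_mass x y j \<le> 2 * real j * y"
  using mult_left_mono[OF mass_shallow[of "y / x" j], of x] assms by (simp add: scaled_mass_def)

lemma scaled_mass_horizontal:
  assumes "0 < b" "b < a" "\<bar>a - 2 * real m * b\<bar> < b" "a / b \<notin> \<rat>"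
  shows "scaled_mass a b j \<le> scaled_mass \<bar>a - 2 * real m * b\<bar> b (j + m)"
proof -
  define r where "r = \<bar>a - 2 * real m * b\<bar>"
  have "a \<noteq> 2 * real m * b" using irrational_ratio_not_even_multiple assms(1) assms(4) by blast
  then have r: "0 < r" "r < b" using assms(3) by (auto simp: r_def)
  have "a / b - 2 * of_int (int m) = (a - 2 * real m * b) / b" using assms(1) by (simp add: field_simps)
  then have "\<bar>1 / (b / a) - 2 * of_int (int m)\<bar> = 1 / (b / r)" using assms(1) by (simp add: r_def)
  then have "mass (b / a) j * (b / r) \<le> mass (b / r) j * (b / a)"
    using assms r by (intro mass_twist_horizontal[where k = "int m"]) auto
  also have "\<dots> \<le> mass (b / r) (j + m) * (b / a)"
    using assms r by (intro mult_right_mono mass_mono) auto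
  finally show ?thesis using assms r unfolding scaled_mass_def r_def[symmetric] by (simp add: field_simps)
qed

lemma scaled_mass_vertical:
  assumes "0 < b"
  shows "scaled_mass b a j \<le> scaled_mass b \<bar>a - 2 * real m * b\<bar> (j + m)"
proof -
  have "a / b - 2 * real m = (a - 2 * real m * b) / b" using assms by (simp add: field_simps)
  then have "\<bar>a / b - 2 * real m\<bar> = \<bar>a - 2 * real m * b\<bar> / b" using assms by simp
  then show ?thesis using mass_twist_vertical[of "a / b" j m] assms by (simp add: scaled_mass_def)
qed

text \<open>
The maximum makes the estimate symmetric: the larger coordinate is reduced modulo twice the
smaller one by a vertical or a horizontal twist, according to which of the two it is. A horizontal
twist does not change \<open>j\<close>, but it may be charged the same cost. For a steep direction the bound
follows from a single vertical twist to a shallow one.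
\<close>

lemma descent_scaled_mass:
  "descent (\<lambda>a b j. max (scaled_mass a b j) (scaled_mass b a j))"
proof
  fix a b :: real and j m :: nat
  assume ab: "0 < b" "b < a" "a / b \<notin> \<rat>" "\<bar>a - 2 * real m * b\<bar> < b"
  show "max (scaled_mass a b j) (scaled_mass b a j)
    \<le> max (scaled_mass b \<bar>a - 2 * real m * b\<bar> (j + m)) (scaled_mass \<bar>a - 2 * real m * b\<bar> b (j + m))"
    using scaled_mass_horizontal[OF ab(1,2,4,3), of j] scaled_mass_vertical[OF ab(1), of a j m] by linarith
next
  fix a b :: real and j :: nat
  assume ab: "0 < b" "b < a" "a / b \<notin> \<rat>"
  obtain m :: nat where m: "m \<ge> 1" "\<bar>a - 2 * real m * b\<bar> < b" using reduce_mod_double[OF ab] by blast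
  define r where "r = \<bar>a - 2 * real m * b\<bar>"
  have "a \<noteq> 2 * real m * b" using irrational_ratio_not_even_multiple ab(1) ab(3) by blast
  then have r: "0 < r" "r < b" using m(2) by (auto simp: r_def)
  have "scaled_mass b a j \<le> 2 * real (j + m) * r"
    using scaled_mass_vertical[OF ab(1), of a j m] scaled_mass_shallow[OF r, of "j + m"] unfolding r_def by linarith
  moreover have "real j * r \<le> real j * a" using r ab by (intro mult_left_mono) auto
  moreover have "real m * r \<le> real m * b" using r ab by (intro mult_left_mono) auto
  moreover have "2 * (real m * b) \<le> a + r" unfolding r_def by linarith
  ultimately have 1: "scaled_mass b a j \<le> 2 * real j * a + 2 * a" using r ab by (simp add: algebra_simps)
  have "real j * b \<le> real j * a" using ab by (intro mult_left_mono) auto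
  then have "scaled_mass a b j \<le> 2 * real j * a + 2 * a" using scaled_mass_shallow[OF ab(1,2), of j] ab by linarith
  then show "max (scaled_mass a b j) (scaled_mass b a j) \<le> 2 * real j * a + 2 * a" using 1 by simp
qed

proposition mass_eq_0:
  assumes "0 < \<theta>" "\<theta> \<notin> \<rat>"
  shows "mass \<theta> j = 0"
proof -
  have "\<theta> \<noteq> 1" using assms(2) by auto
  then consider "\<theta> < 1" | "1 < \<theta>" by linarith
  then have "mass \<theta> j \<le> 0"
  proof cases
    case 1
    have "1 / \<theta> \<notin> \<rat>" using assms(2) Rats_inverse[of "1 / \<theta>"] by auto
    then have "max (scaled_mass 1 \<theta> j) (scaled_mass \<theta> 1 j) \<le> 0"
      using descent.nonpos[OF descent_scaled_mass assms(1) 1] by blast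
    then show ?thesis by (simp add: scaled_mass_def)
  next
    case 2
    then have "max (scaled_mass \<theta> 1 j) (scaled_mass 1 \<theta> j) \<le> 0"
      using descent.nonpos[OF descent_scaled_mass, of 1 \<theta> j] assms by simp
    then show ?thesis by (simp add: scaled_mass_def)
  qed
  then show ?thesis using mass_nonneg[of \<theta> j] by simp
qed

text \<open>
A bounded set lies in some core up to fixed points of the return map, so \<open>mass_eq_0\<close> and
monotonicity apply. For negative slopes the core of \<open>- \<theta>\<close> is used.
\<close>

theorem return_map_conservative:
  assumes "\<theta> \<notin> \<rat>" "A \<in> sets borel" "bdd_above A"
  shows "escaping (return_map \<theta>) A \<in> null_sets lborel"
proof -
  define low where "low = - (\<theta>\<^sup>2) / 4"
  obtain M where M: "\<And>b. b \<in> A \<Longrightarrow> b \<le> M" using assms(3) by (auto simp: bdd_above_def)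
  obtain j :: nat where j: "max 1 M < real j" using reals_Archimedean2 by blast
  have "\<theta> \<noteq> 0" using assms(1) by auto
  define B where "B = A \<inter> {low<..}"
  have B: "B \<in> sets borel" using assms(2) by (simp add: B_def)
  have sub: "B \<subseteq> core \<bar>\<theta>\<bar> j"
  proof
    fix b assume b: "b \<in> B"
    have "1 * real j \<le> real j * real j" using j by (intro mult_right_mono) auto
    moreover have "0 \<le> \<bar>\<theta>\<bar> * real j" by simp
    moreover have "b \<le> M" using b M by (simp add: B_def)
    ultimately have "b < real j * real j + \<bar>\<theta>\<bar> * real j" using j by linarith
    then show "b \<in> core \<bar>\<theta>\<bar> j" using b by (simp add: core_def B_def low_def icpt_def power2_eq_square)
  qed
  have fixed: "return_map \<theta> b = b" if "b \<le> low" for b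
  proof -
    have "flip \<kappa> b = b" if "\<kappa>\<^sup>2 = \<theta>\<^sup>2" for \<kappa>
    proof (rule flip_id)
      fix n show "\<not> (icpt \<kappa> n < b \<and> b < icpt \<kappa> (n + 1))"
        using icpt_ge[of \<kappa> n] \<open>b \<le> low\<close> that by (simp add: low_def)
    qed
    then show ?thesis by (simp add: return_map_def)
  qed
  have "escaping (return_map \<theta>) A \<subseteq> escaping (return_map \<theta>) B"
  proof
    fix b assume b: "b \<in> escaping (return_map \<theta>) A"
    then have "b \<in> A" "return_map \<theta> b \<notin> A" by (auto simp: escaping_def dest: spec[of _ 1])
    then have "low < b" using fixed[of b] by fastforce
    then show "b \<in> escaping (return_map \<theta>) B" using b by (auto simp: escaping_def B_def)
  qed
  moreover have "escaping (return_map \<theta>) B \<in> null_sets lborel"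
  proof -
    have "emeasure lborel (escaping (return_map \<theta>) (core \<bar>\<theta>\<bar> j)) = ennreal (mass \<bar>\<theta>\<bar> j)"
      using emeasure_escaping_core[of \<theta> j] emeasure_escaping_core_reflect[of \<theta> j] by (cases "0 \<le> \<theta>") simp_all
    also have "mass \<bar>\<theta>\<bar> j = 0" using assms(1) \<open>\<theta> \<noteq> 0\<close> Rats_minus_iff[of \<theta>] by (intro mass_eq_0) (simp_all add: abs_if)
    finally have "emeasure lborel (escaping (return_map \<theta>) B) = 0"
      using emeasure_escaping_mono[OF return_map_automorphism[of \<theta>] B core_borel sub emeasure_core] by simp
    then show ?thesis using sets_escaping[OF return_map_borel B] by auto
  qed
  ultimately show ?thesis using sets_escaping[OF return_map_borel assms(2)] null_sets_subset[of "escaping (return_map \<theta>) B" lborel "escaping (return_map \<theta>) A"] by simp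
qed

section \<open>Chords and the flow in the charts\<close>

text \<open>
The point of the surface with position \<open>p\<close> in \<open>Q\<^sup>+\<close>, or with position \<open>- p\<close> in \<open>Q\<^sup>-\<close>. With this
convention positions always lie in \<open>Q\<^sup>+\<close>, and \<open>heading up v\<close> is the direction in which they move.
\<close>

definition point :: "bool \<Rightarrow> real \<times> real \<Rightarrow> S1_point" where
  "point up p = glued `` {if up then Inl p else Inr (- p)}"

definition heading :: "bool \<Rightarrow> real \<times> real \<Rightarrow> real \<times> real" where
  "heading up v = (if up then v else - v)"

text \<open>
The place of \<open>point up p\<close> in the chart at the edge \<open>n\<close>.
\<close>

definition in_chart :: "int \<Rightarrow> bool \<Rightarrow> real \<times> real \<Rightarrow> real \<times> real" where
  "in_chart n up p = (if up then p else - p - shift n)"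

lemma uminus_interior_Q_plus: "p \<in> interior Q_plus \<Longrightarrow> - p \<in> interior Q_minus"
  unfolding Q_minus_def by (simp add: interior_negations)

lemma in_chart_add: "in_chart n up p + s *\<^sub>R v = in_chart n up (p + s *\<^sub>R heading up v)"
  by (simp add: in_chart_def heading_def)

lemma in_chart_interior:
  assumes "p \<in> interior Q_plus"
  shows "in_chart n up p \<in> chart_domain n" "chart n (in_chart n up p) = point up p"
proof -
  have "p \<in> Q_plus" using assms interior_subset by blast
  moreover have m: "- p \<in> interior Q_minus" by (rule uminus_interior_Q_plus[OF assms])
  moreover have "- p - shift n \<notin> Q_plus" by (rule interior_Q_minus_below[OF m])
  ultimately show "in_chart n up p \<in> chart_domain n" "chart n (in_chart n up p) = point up p"
    using assms by (auto simp: in_chart_def chart_domain_def chart_def point_def)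
qed

lemma reflect_edge:
  assumes "e \<in> edge n"
  shows "- e - shift n \<in> edge n"
proof -
  have "e + shift n \<in> uminus ` edge n" using assms shift_edge[of n] by blast
  then obtain e' where "e' \<in> edge n" "e + shift n = - e'" by blast
  then have "- e - shift n = e'" by (metis add.inverse_inverse minus_diff_eq add.commute diff_minus_eq_add minus_diff_commute)
  then show ?thesis using \<open>e' \<in> edge n\<close> by simp
qed

lemma reflect_vertex:
  assumes "e \<in> edge n" "e \<notin> range vertex"
  shows "- e - shift n \<notin> range vertex"
proof
  assume "- e - shift n \<in> range vertex"
  then have "- e - shift n \<in> {vertex n, vertex (n + 1)}"
    using reflect_edge[OF assms(1)] open_edge_eq[of n] unfolding open_segment_def edge_def by blast
  then have "e = vertex (n + 1) \<or> e = vertex n" unfolding shift_def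
    by (auto simp: algebra_simps)
  then show False using assms(2) by auto
qed

lemma point_edge:
  assumes "e \<in> edge n"
  shows "point up e = point (\<not> up) (- e - shift n)"
proof -
  have *: "point True e = point False (- e - shift n)" if "e \<in> edge n" for e
  proof -
    have "(Inl e, Inr (e + shift n)) \<in> glued" using that unfolding glued_def gluing_def by blast
    then have "glued `` {Inl e} = glued `` {Inr (e + shift n)}"
      by (rule equiv_class_eq[OF equiv_glued])
    then show ?thesis by (simp add: point_def add.commute)
  qed
  show ?thesis
  proof (cases up)
    case True then show ?thesis using *[OF assms] by simp
  next
    case False then show ?thesis using *[OF reflect_edge[OF assms]] by simp
  qed
qed

lemma in_chart_edge:
  assumes "e \<in> edge n" "e \<notin> range vertex"
  shows "in_chart n up e \<in> chart_domain n" "chart n (in_chart n up e) = point up e"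
proof -
  have *: "e \<in> chart_domain n" "chart n e = point True e" if "e \<in> edge n" "e \<notin> range vertex" for e
    using that edge_subset_Q_plus[of n] open_edge_eq[of n] by (auto simp: chart_domain_def chart_def point_def)
  show "in_chart n up e \<in> chart_domain n" "chart n (in_chart n up e) = point up e"
    using *[OF assms] *[OF reflect_edge reflect_vertex, OF assms(1) assms] point_edge[OF assms(1), of up]
    by (cases up; simp add: in_chart_def)+
qed

lemma geodesic_S1_atlas:
  "geodesic S1_atlas v J \<gamma> \<longleftrightarrow> (\<forall>t\<in>J. \<exists>n q e. 0 < e \<and>
     (\<forall>s\<in>J \<inter> ball t e. q + (s - t) *\<^sub>R v \<in> chart_domain n \<and> \<gamma> s = chart n (q + (s - t) *\<^sub>R v)))"
  by (simp add: geodesic_def S1_atlas_def)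

lemma flow_in_chart:
  assumes "0 \<le> t" "\<And>s. 0 \<le> s \<Longrightarrow> s \<le> t \<Longrightarrow> q + s *\<^sub>R v \<in> chart_domain n"
  shows "flows_to S1_atlas v t (chart n q) (chart n (q + t *\<^sub>R v))"
proof -
  have "geodesic S1_atlas v {0..t} (\<lambda>s. chart n (q + s *\<^sub>R v))"
    unfolding geodesic_S1_atlas
  proof
    fix t0 assume "t0 \<in> {0..t}"
    have "\<forall>s\<in>{0..t} \<inter> ball t0 1. (q + t0 *\<^sub>R v) + (s - t0) *\<^sub>R v \<in> chart_domain n \<and>
        chart n (q + s *\<^sub>R v) = chart n ((q + t0 *\<^sub>R v) + (s - t0) *\<^sub>R v)"
      using assms(2) by (auto simp: algebra_simps)
    then show "\<exists>m p e. 0 < e \<and> (\<forall>s\<in>{0..t} \<inter> ball t0 e. p + (s - t0) *\<^sub>R v \<in> chart_domain m \<and>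
        chart n (q + s *\<^sub>R v) = chart m (p + (s - t0) *\<^sub>R v))"
      by (intro exI[of _ n] exI[of _ "q + t0 *\<^sub>R v"] exI[of _ "1::real"]) simp
  qed
  then show ?thesis unfolding flows_to_def by (intro exI[of _ "\<lambda>s. chart n (q + s *\<^sub>R v)"]) simp
qed

text \<open>
Interior points of the polygons are glued to nothing else, so each chart shows them only once.
This makes it possible to join geodesics there.
\<close>

lemma in_chart_unique:
  assumes "q \<in> chart_domain n" "chart n q = point up p" "p \<in> interior Q_plus"
  shows "q = in_chart n up p"
proof -
  have p: "p \<in> Q_plus" "p \<notin> edge m" "p \<notin> range vertex" for m
    using assms(3) interior_subset edge_notin_interior by (blast, blast, metis edge_def edge_notin_interior ends_in_segment(1) imageE)
  have refl: "(a, a) \<in> glued" for a using equiv_glued by (auto simp: glued_def)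
  let ?c = "if q \<in> Q_plus then Inl q else Inr (q + shift n)"
  have "?c \<in> chart n q" unfolding chart_def using refl by auto
  then have c: "?c \<in> point up p" using assms(2) by simp
  show ?thesis
  proof (cases up)
    case True
    then have "(Inl p, ?c) \<in> glued" using c by (simp add: point_def)
    then have "?c = Inl p" using glued_Inl p by blast
    then show ?thesis using True by (auto simp: in_chart_def split: if_splits)
  next
    case False
    then have "(Inr (- p), ?c) \<in> glued" using c by (simp add: point_def)
    then have "?c = Inr (- p)" using glued_Inr uminus_interior_Q_plus[OF assms(3)] by blast
    then have "q + shift n = - p" by (auto split: if_splits)
    then show ?thesis using False by (simp add: in_chart_def eq_diff_eq)
  qed
qed

text \<open>
Two geodesics that meet at an interior point of a polygon may be given there in different charts,
but both charts restrict to the same parametrisation of that polygon.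
\<close>

lemma flows_to_concat:
  assumes "flows_to S1_atlas v s x (point up p)" "flows_to S1_atlas v t (point up p) z"
    and p: "p \<in> interior Q_plus" and st: "0 \<le> s" "0 \<le> t"
  shows "flows_to S1_atlas v (s + t) x z"
proof -
  obtain \<gamma>1 where g1: "geodesic S1_atlas v {0..s} \<gamma>1" "\<gamma>1 0 = x" "\<gamma>1 s = point up p"
    using assms(1) by (auto simp: flows_to_def)
  obtain \<gamma>2 where g2: "geodesic S1_atlas v {0..t} \<gamma>2" "\<gamma>2 0 = point up p" "\<gamma>2 t = z"
    using assms(2) by (auto simp: flows_to_def)
  have loc: "\<exists>n q e. 0 < e \<and> (\<forall>r\<in>J \<inter> ball t0 e. q + (r - t0) *\<^sub>R v \<in> chart_domain n \<and> \<gamma> r = chart n (q + (r - t0) *\<^sub>R v))"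
    if "geodesic S1_atlas v J \<gamma>" "t0 \<in> J" for J \<gamma> t0
    using that unfolding geodesic_S1_atlas by blast
  define \<gamma> where "\<gamma> r = (if r \<le> s then \<gamma>1 r else \<gamma>2 (r - s))" for r
  have "geodesic S1_atlas v {0..s + t} \<gamma>"
    unfolding geodesic_S1_atlas
  proof
    fix t0 assume t0: "t0 \<in> {0..s + t}"
    show "\<exists>n q e. 0 < e \<and> (\<forall>r\<in>{0..s + t} \<inter> ball t0 e. q + (r - t0) *\<^sub>R v \<in> chart_domain n \<and> \<gamma> r = chart n (q + (r - t0) *\<^sub>R v))"
    proof (cases t0 s rule: linorder_cases)
      case less
      then have "t0 \<in> {0..s}" using t0 by simp
      from loc[OF g1(1) this] obtain n q e where e: "0 < e"
        "\<And>r. r \<in> {0..s} \<inter> ball t0 e \<Longrightarrow> q + (r - t0) *\<^sub>R v \<in> chart_domain n \<and> \<gamma>1 r = chart n (q + (r - t0) *\<^sub>R v)"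
        by blast
      show ?thesis
      proof (intro exI conjI ballI)
        show "0 < min e (s - t0)" using e less by simp
        fix r assume r: "r \<in> {0..s + t} \<inter> ball t0 (min e (s - t0))"
        then have "r \<in> {0..s} \<inter> ball t0 e" "r \<le> s" by (auto simp: dist_real_def)
        then show "q + (r - t0) *\<^sub>R v \<in> chart_domain n" "\<gamma> r = chart n (q + (r - t0) *\<^sub>R v)"
          using e(2)[of r] by (simp_all add: \<gamma>_def)
      qed
    next
      case greater
      then have "t0 - s \<in> {0..t}" using t0 by simp
      from loc[OF g2(1) this] obtain n q e where e: "0 < e"
        "\<And>r. r \<in> {0..t} \<inter> ball (t0 - s) e \<Longrightarrow> q + (r - (t0 - s)) *\<^sub>R v \<in> chart_domain n \<and> \<gamma>2 r = chart n (q + (r - (t0 - s)) *\<^sub>R v)"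
        by blast
      show ?thesis
      proof (intro exI conjI ballI)
        show "0 < min e (t0 - s)" using e greater by simp
        fix r assume r: "r \<in> {0..s + t} \<inter> ball t0 (min e (t0 - s))"
        then have "r - s \<in> {0..t} \<inter> ball (t0 - s) e" "s < r" by (auto simp: dist_real_def)
        then show "q + (r - t0) *\<^sub>R v \<in> chart_domain n" "\<gamma> r = chart n (q + (r - t0) *\<^sub>R v)"
          using e(2)[of "r - s"] by (simp_all add: \<gamma>_def)
      qed
    next
      case equal
      have "s \<in> {0..s}" using st by simp
      from loc[OF g1(1) this] obtain n q e where e: "0 < e"
        "\<And>r. r \<in> {0..s} \<inter> ball s e \<Longrightarrow> q + (r - s) *\<^sub>R v \<in> chart_domain n \<and> \<gamma>1 r = chart n (q + (r - s) *\<^sub>R v)"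
        by blast
      have q: "q = in_chart n up p" using e(2)[of s] e(1) st g1(3) by (intro in_chart_unique[OF _ _ p]) auto
      have "(0::real) \<in> {0..t}" using st by simp
      from loc[OF g2(1) this] obtain n' q' e' where e': "0 < e'"
        "\<And>r. r \<in> {0..t} \<inter> ball 0 e' \<Longrightarrow> q' + (r - 0) *\<^sub>R v \<in> chart_domain n' \<and> \<gamma>2 r = chart n' (q' + (r - 0) *\<^sub>R v)"
        by blast
      have q': "q' = in_chart n' up p" using e'(2)[of 0] e'(1) st g2(2) by (intro in_chart_unique[OF _ _ p]) auto
      have "open ((\<lambda>r. p + r *\<^sub>R heading up v) -` interior Q_plus)"
        by (intro open_vimage open_interior continuous_intros)
      moreover have "0 \<in> (\<lambda>r. p + r *\<^sub>R heading up v) -` interior Q_plus" using p by simp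
      ultimately obtain d where d: "0 < d" "ball 0 d \<subseteq> (\<lambda>r. p + r *\<^sub>R heading up v) -` interior Q_plus"
        using open_contains_ball by meson
      show ?thesis
      proof (intro exI conjI ballI)
        show "0 < min e (min e' d)" using e e' d by simp
        fix r assume r: "r \<in> {0..s + t} \<inter> ball t0 (min e (min e' d))"
        have "q + (r - s) *\<^sub>R v \<in> chart_domain n \<and> \<gamma> r = chart n (q + (r - s) *\<^sub>R v)"
        proof (cases "r \<le> s")
          case True
          then have "r \<in> {0..s} \<inter> ball s e" using r equal by auto
          then show ?thesis using e(2)[of r] True by (simp add: \<gamma>_def)
        next
          case False
          then have rs: "r - s \<in> {0..t} \<inter> ball 0 e'" "r - s \<in> ball 0 d" using r equal by (auto simp: dist_real_def)
          have "\<gamma>2 (r - s) = chart n' (q' + (r - s) *\<^sub>R v)" "p + (r - s) *\<^sub>R heading up v \<in> interior Q_plus"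
            using e'(2)[OF rs(1)] subsetD[OF d(2) rs(2)] by simp_all
          then show ?thesis using False in_chart_interior unfolding q q' \<gamma>_def in_chart_add by simp
        qed
        then show "q + (r - t0) *\<^sub>R v \<in> chart_domain n" "\<gamma> r = chart n (q + (r - t0) *\<^sub>R v)" using equal by simp_all
      qed
    qed
  qed
  moreover have "\<gamma> 0 = x" using g1(2) st by (simp add: \<gamma>_def)
  moreover have "\<gamma> (s + t) = z" using g1(3) g2(2,3) st by (cases "t = 0") (auto simp: \<gamma>_def)
  ultimately show ?thesis unfolding flows_to_def by blast
qed


definition intercept :: "real \<Rightarrow> real \<times> real \<Rightarrow> real" where
  "intercept \<theta> p = snd p - \<theta> * fst p"

definition meets_edge :: "real \<Rightarrow> int \<Rightarrow> real \<Rightarrow> bool" where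
  "meets_edge \<theta> n b \<longleftrightarrow> (icpt \<theta> n < b \<and> b < icpt \<theta> (n + 1)) \<or> (icpt \<theta> (n + 1) < b \<and> b < icpt \<theta> n)"

text \<open>
The intersection of the line of intercept \<open>b\<close> with the line that carries the edge \<open>n\<close>.
\<close>

definition edge_point :: "real \<Rightarrow> int \<Rightarrow> real \<Rightarrow> real \<times> real" where
  "edge_point \<theta> n b = (let x = (b + of_int n * (of_int n + 1)) / (2 * of_int n + 1 - \<theta>) in (x, \<theta> * x + b))"

lemma edge_point_on_edge:
  assumes "meets_edge \<theta> n b"
  shows "edge_point \<theta> n b \<in> edge n" "edge_point \<theta> n b \<notin> range vertex" "intercept \<theta> (edge_point \<theta> n b) = b"
proof -
  define \<kappa> where "\<kappa> = 2 * of_int n + 1 - \<theta>"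
  define x where "x = (b + of_int n * (of_int n + 1)) / \<kappa>"
  have k0: "\<kappa> \<noteq> 0" using assms icpt_less_iff[of \<theta> n] icpt_diff[of \<theta> "n + 1" n] by (auto simp: meets_edge_def \<kappa>_def)
  have kx: "\<kappa> * x = b + of_int n * (of_int n + 1)" using k0 by (simp add: x_def)
  have e: "edge_point \<theta> n b = (x, \<theta> * x + b)" by (simp add: edge_point_def x_def \<kappa>_def Let_def)
  have b: "b - icpt \<theta> n = \<kappa> * (x - of_int n)" "icpt \<theta> (n + 1) - b = \<kappa> * (of_int n + 1 - x)"
    using kx by (simp_all add: icpt_def \<kappa>_def algebra_simps power2_eq_square)
  have x: "of_int n < x" "x < of_int n + 1"
  proof -
    have "(0 < \<kappa> * (x - of_int n) \<and> 0 < \<kappa> * (of_int n + 1 - x)) \<or> (\<kappa> * (x - of_int n) < 0 \<and> \<kappa> * (of_int n + 1 - x) < 0)"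
      using assms unfolding meets_edge_def b[symmetric] by auto
    then show "of_int n < x" "x < of_int n + 1"
      by (auto simp: zero_less_mult_iff mult_less_0_iff)
  qed
  have "\<theta> * x + b = chord n x" using kx by (simp add: chord_def \<kappa>_def algebra_simps)
  then show "edge_point \<theta> n b \<in> edge n" using x unfolding e edge_iff by simp
  have "x \<noteq> of_int k" for k
  proof
    assume "x = of_int k"
    then have "n < k" "k < n + 1" using x by linarith+
    then show False by simp
  qed
  then show "edge_point \<theta> n b \<notin> range vertex" unfolding e by (auto simp: vertex_def)
  show "intercept \<theta> (edge_point \<theta> n b) = b" unfolding e by (simp add: intercept_def)
qed

lemma edge_point_unique:
  assumes "p \<in> edge n" "\<theta> \<noteq> 2 * of_int n + 1"
  shows "p = edge_point \<theta> n (intercept \<theta> p)"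
proof -
  obtain x y where p: "p = (x, y)" by force
  have "y = chord n x" using assms(1) unfolding p edge_iff by simp
  then have "y - \<theta> * x + of_int n * (of_int n + 1) = x * (2 * of_int n + 1 - \<theta>)"
    by (simp add: chord_def algebra_simps)
  then have "(y - \<theta> * x + of_int n * (of_int n + 1)) / (2 * of_int n + 1 - \<theta>) = x"
    using assms(2) by (simp add: field_simps)
  then show ?thesis by (simp add: p edge_point_def intercept_def Let_def)
qed

lemma edge_point_reflect:
  assumes "meets_edge \<theta> n b"
  shows "edge_point \<theta> n (icpt \<theta> n + icpt \<theta> (n + 1) - b) = - edge_point \<theta> n b - shift n"
proof -
  have k: "\<theta> \<noteq> 2 * of_int n + 1" using assms icpt_diff[of \<theta> "n + 1" n] by (auto simp: meets_edge_def)
  have "intercept \<theta> (- edge_point \<theta> n b - shift n) = icpt \<theta> n + icpt \<theta> (n + 1) - b"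
    using edge_point_on_edge(3)[OF assms]
    by (simp add: intercept_def shift_def vertex_def icpt_def algebra_simps)
  then show ?thesis using edge_point_unique[OF reflect_edge[OF edge_point_on_edge(1)[OF assms]] k] by simp
qed

lemma meets_edge_if:
  assumes "p \<in> edge n" "intercept \<theta> p \<notin> lattice \<theta>" "\<theta> \<noteq> 2 * of_int n + 1"
  shows "meets_edge \<theta> n (intercept \<theta> p)"
proof -
  obtain x y where p: "p = (x, y)" by force
  have x: "of_int n \<le> x" "x \<le> of_int n + 1" "y = chord n x" using assms(1) unfolding p edge_iff by auto
  define \<kappa> where "\<kappa> = 2 * of_int n + 1 - \<theta>"
  have b: "intercept \<theta> p - icpt \<theta> n = \<kappa> * (x - of_int n)" "icpt \<theta> (n + 1) - intercept \<theta> p = \<kappa> * (of_int n + 1 - x)"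
    unfolding p intercept_def x(3) by (simp_all add: icpt_def \<kappa>_def chord_def algebra_simps power2_eq_square)
  have "intercept \<theta> p \<noteq> icpt \<theta> n" "intercept \<theta> p \<noteq> icpt \<theta> (n + 1)" using assms(2) icpt_lattice by metis+
  then have "x \<noteq> of_int n" "x \<noteq> of_int n + 1" using b by auto
  then have s: "0 < x - of_int n" "0 < of_int n + 1 - x" using x by auto
  show ?thesis
  proof (cases "0 < \<kappa>")
    case True
    then have "0 < \<kappa> * (x - of_int n)" "0 < \<kappa> * (of_int n + 1 - x)" using s by simp_all
    then show ?thesis unfolding meets_edge_def using b by linarith
  next
    case False
    then have "\<kappa> < 0" using assms(3) by (simp add: \<kappa>_def)
    then have "\<kappa> * (x - of_int n) < 0" "\<kappa> * (of_int n + 1 - x) < 0" using s by (simp_all add: mult_neg_pos)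
    then show ?thesis unfolding meets_edge_def using b by linarith
  qed
qed

text \<open>
Whether leaves moving in the direction \<open>u\<close> leave \<open>Q\<^sup>+\<close> through the edge \<open>n\<close>: these are the edges
of slope greater than \<open>\<theta>\<close> for motion to the right, and those of smaller slope for motion to the
left.
\<close>

definition exits :: "real \<Rightarrow> real \<times> real \<Rightarrow> int \<Rightarrow> bool" where
  "exits \<theta> u n \<longleftrightarrow> 0 < (2 * of_int n + 1 - \<theta>) * fst u"

lemma exits_slope: "exits \<theta> u n \<Longrightarrow> \<theta> \<noteq> 2 * of_int n + 1"
  unfolding exits_def by (intro notI) simp

text \<open>
The chords of the polygon give affine inequalities along the line which are strict at \<open>p\<close> and weak
at the edge, hence strict in between.
\<close>

lemma reach_edge:
  assumes u: "snd u = \<theta> * fst u" "exits \<theta> u n" and b: "meets_edge \<theta> n (intercept \<theta> p)"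
    and p: "p \<in> interior Q_plus \<or> p \<in> edge n"
  obtains r where "0 \<le> r" "p + r *\<^sub>R u = edge_point \<theta> n (intercept \<theta> p)"
    "\<And>s. 0 \<le> s \<Longrightarrow> s < r \<Longrightarrow> p + s *\<^sub>R u \<in> interior Q_plus" "p \<in> interior Q_plus \<Longrightarrow> 0 < r"
proof (cases "p \<in> interior Q_plus")
  case False
  have "\<theta> \<noteq> 2 * of_int n + 1" by (rule exits_slope[OF u(2)])
  then have "p = edge_point \<theta> n (intercept \<theta> p)" using edge_point_unique p False by blast
  then show ?thesis using that[of 0] False by simp
next
  case True
  obtain x y where xy: "p = (x, y)" by force
  define \<kappa> where "\<kappa> = 2 * of_int n + 1 - \<theta>"
  define X where "X = (intercept \<theta> p + of_int n * (of_int n + 1)) / \<kappa>"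
  have ku: "0 < \<kappa> * fst u" using u(2) by (simp add: exits_def \<kappa>_def)
  then have k0: "\<kappa> \<noteq> 0" "fst u \<noteq> 0" by auto
  have e: "edge_point \<theta> n (intercept \<theta> p) = (X, \<theta> * X + intercept \<theta> p)"
    by (simp add: edge_point_def X_def \<kappa>_def Let_def)
  define r where "r = (X - x) / fst u"
  have ru: "r * fst u = X - x" using k0 by (simp add: r_def)
  have pr: "p + r *\<^sub>R u = edge_point \<theta> n (intercept \<theta> p)"
  proof -
    have "r * snd u = \<theta> * (X - x)" unfolding u(1) using ru by (simp add: mult.left_commute)
    then have "p + r *\<^sub>R u = (x + (X - x), y + \<theta> * (X - x))"
      using ru by (cases u) (simp add: xy)
    then show ?thesis unfolding e by (simp add: xy intercept_def algebra_simps)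
  qed
  have inside: "chord l x < y" for l using True unfolding xy interior_Q_plus_iff by blast
  have "\<kappa> * X = y - \<theta> * x + of_int n * (of_int n + 1)" using k0 by (simp add: X_def xy intercept_def)
  then have "\<kappa> * (X - x) = y - chord n x" by (simp add: \<kappa>_def chord_def algebra_simps)
  then have "0 < (\<kappa> * fst u) * r" using inside[of n] ru by (simp add: mult.assoc mult.commute[of "fst u"])
  then have r: "0 < r" using ku by (simp add: zero_less_mult_iff)
  have e_in: "chord l X \<le> \<theta> * X + intercept \<theta> p" for l
    using edge_point_on_edge(1)[OF b] edge_subset_Q_plus[of n] unfolding e using Q_plus_iff by blast
  have "p + s *\<^sub>R u \<in> interior Q_plus" if s: "0 \<le> s" "s < r" for s
  proof -
    define \<mu> where "\<mu> = s / r"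
    have mu: "0 \<le> \<mu>" "\<mu> < 1" "s = \<mu> * r" using s r by (auto simp: \<mu>_def)
    define x' where "x' = x + s * fst u"
    have x': "x' = (1 - \<mu>) * x + \<mu> * X" unfolding x'_def mu(3) mult.assoc ru by (simp add: algebra_simps)
    have ps: "p + s *\<^sub>R u = (x', y + \<theta> * (x' - x))"
      using u(1) by (cases u) (simp add: xy x'_def algebra_simps)
    have "chord l x' < y + \<theta> * (x' - x)" for l
    proof -
      have "0 < (1 - \<mu>) * (y - chord l x)" using mu inside[of l] by simp
      moreover have "0 \<le> \<mu> * (\<theta> * X + intercept \<theta> p - chord l X)" using mu e_in[of l] by simp
      moreover have "y + \<theta> * (x' - x) - chord l x' = (1 - \<mu>) * (y - chord l x) + \<mu> * (\<theta> * X + intercept \<theta> p - chord l X)"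
        unfolding x' chord_def intercept_def xy by (simp add: algebra_simps)
      ultimately show ?thesis by linarith
    qed
    then show ?thesis unfolding ps interior_Q_plus_iff by blast
  qed
  then show ?thesis using that[of r] r pr by simp
qed

context
  fixes v :: "real \<times> real" and \<theta> :: real
  assumes slope: "snd v = \<theta> * fst v"
begin

lemma slope_heading: "snd (heading up v) = \<theta> * fst (heading up v)"
  using slope by (simp add: heading_def)

lemma flow_to_edge:
  assumes p: "p \<in> interior Q_plus" and n: "exits \<theta> (heading up v) n" and e: "e \<in> edge n" "intercept \<theta> e = intercept \<theta> p"
    and b: "meets_edge \<theta> n (intercept \<theta> p)"
  shows "\<exists>t>0. flows_to S1_atlas v t (point up p) (point up e)"
proof -
  have "\<theta> \<noteq> 2 * of_int n + 1" by (rule exits_slope[OF n])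
  then have ep: "e = edge_point \<theta> n (intercept \<theta> p)" using edge_point_unique e by metis
  obtain r where r: "0 < r" "p + r *\<^sub>R heading up v = e"
    "\<And>s. 0 \<le> s \<Longrightarrow> s < r \<Longrightarrow> p + s *\<^sub>R heading up v \<in> interior Q_plus"
    using reach_edge[OF slope_heading n b] p ep by metis
  have en: "e \<notin> range vertex" unfolding ep by (rule edge_point_on_edge(2)[OF b])
  have "flows_to S1_atlas v r (chart n (in_chart n up p)) (chart n (in_chart n up p + r *\<^sub>R v))"
  proof (rule flow_in_chart)
    fix s assume "0 \<le> s" "s \<le> r"
    then show "in_chart n up p + s *\<^sub>R v \<in> chart_domain n"
      unfolding in_chart_add using r in_chart_interior(1) in_chart_edge(1)[OF e(1) en]
      by (cases "s = r") auto
  qed (use r in simp)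
  then show ?thesis
    unfolding in_chart_add r(2) using r(1) in_chart_interior(2)[OF p] in_chart_edge(2)[OF e(1) en] by auto
qed

text \<open>
The path stays in the chart at the edge \<open>n\<close>. Seen from the other polygon its second half is a path
from the edge to \<open>p'\<close>, which read backwards is again an instance of \<open>reach_edge\<close> with the same
direction.
\<close>

lemma flow_across_edge:
  assumes p: "p \<in> interior Q_plus \<or> p \<in> edge n" and n: "exits \<theta> (heading up v) n"
    and b: "meets_edge \<theta> n (intercept \<theta> p)"
    and p': "p' \<in> interior Q_plus" "intercept \<theta> p' = icpt \<theta> n + icpt \<theta> (n + 1) - intercept \<theta> p"
  shows "\<exists>t>0. flows_to S1_atlas v t (point up p) (point (\<not> up) p')"
proof -
  let ?u = "heading up v"
  define e where "e = edge_point \<theta> n (intercept \<theta> p)"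
  obtain r where r: "0 \<le> r" "p + r *\<^sub>R ?u = e"
    "\<And>s. 0 \<le> s \<Longrightarrow> s < r \<Longrightarrow> p + s *\<^sub>R ?u \<in> interior Q_plus"
    using reach_edge[OF slope_heading n b p] unfolding e_def by metis
  have b': "meets_edge \<theta> n (intercept \<theta> p')" using b unfolding p'(2) meets_edge_def by auto
  have e': "edge_point \<theta> n (intercept \<theta> p') = - e - shift n"
    unfolding p'(2) e_def by (rule edge_point_reflect[OF b])
  obtain r' where r': "0 < r'" "p' + r' *\<^sub>R ?u = - e - shift n"
    "\<And>s. 0 \<le> s \<Longrightarrow> s < r' \<Longrightarrow> p' + s *\<^sub>R ?u \<in> interior Q_plus"
    using reach_edge[OF slope_heading n b', unfolded e'] p'(1) by metis
  have e: "e \<in> edge n" "e \<notin> range vertex" unfolding e_def by (rule edge_point_on_edge[OF b])+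
  define q where "q = in_chart n up p"
  have qs: "q + s *\<^sub>R v = in_chart n up (p + s *\<^sub>R ?u)" for s unfolding q_def by (rule in_chart_add)
  \<comment> \<open>the same place in the chart, measured from the other polygon, where time runs backwards from \<open>p'\<close>\<close>
  have other: "in_chart n up (p + s *\<^sub>R ?u) = in_chart n (\<not> up) (p' + (r + r' - s) *\<^sub>R ?u)" for s
  proof -
    have "p + s *\<^sub>R ?u = e + (s - r) *\<^sub>R ?u" using r(2) by (simp add: algebra_simps)
    moreover have "p' + (r + r' - s) *\<^sub>R ?u = - e - shift n - (s - r) *\<^sub>R ?u" using r'(2) by (simp add: algebra_simps)
    ultimately show ?thesis by (simp add: in_chart_def)
  qed
  have start: "chart n q = point up p"
  proof (cases "p \<in> interior Q_plus")
    case True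
    then show ?thesis unfolding q_def by (rule in_chart_interior(2))
  next
    case False
    then have "p = e" using p edge_point_unique[of p n \<theta>] n unfolding e_def exits_def by fastforce
    then show ?thesis unfolding q_def using in_chart_edge(2)[OF e] by simp
  qed
  have "flows_to S1_atlas v (r + r') (chart n q) (chart n (q + (r + r') *\<^sub>R v))"
  proof (rule flow_in_chart)
    fix s assume s: "0 \<le> s" "s \<le> r + r'"
    consider "s < r" | "s = r" | "r < s" by linarith
    then show "q + s *\<^sub>R v \<in> chart_domain n"
    proof cases
      case 1
      then show ?thesis unfolding qs using r(3)[OF s(1)] by (intro in_chart_interior(1))
    next
      case 2
      then show ?thesis unfolding qs 2 r(2) by (intro in_chart_edge(1)[OF e])
    next
      case 3
      then show ?thesis unfolding qs other using r'(3)[of "r + r' - s"] s by (intro in_chart_interior(1)) simp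
    qed
  qed (use r r' in simp)
  moreover have "chart n (q + (r + r') *\<^sub>R v) = point (\<not> up) p'"
    unfolding qs other using in_chart_interior(2)[OF p'(1)] by simp
  ultimately show ?thesis using start r(1) r'(1) by (intro exI[of _ "r + r'"]) simp
qed

end

text \<open>
A point vertically above a vertex.
\<close>

lemma vertical_point:
  assumes "icpt \<theta> k < b"
  obtains p where "p \<in> interior Q_plus" "intercept \<theta> p = b"
proof -
  have "chord l (of_int k) < \<theta> * of_int k + b" for l
    using chord_vertex[of l k] assms by (simp add: icpt_def)
  then have "(of_int k, \<theta> * of_int k + b) \<in> interior Q_plus" by (simp add: interior_Q_plus_iff)
  then show ?thesis using that by (simp add: intercept_def)
qed

lemma intercept_above:
  assumes "p \<in> Q_plus" "intercept \<theta> p \<notin> lattice \<theta>"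
  shows "\<exists>k. icpt \<theta> k < intercept \<theta> p"
proof (rule ccontr)
  assume no: "\<not> (\<exists>k. icpt \<theta> k < intercept \<theta> p)"
  obtain x y where p: "p = (x, y)" by force
  define n where "n = \<lfloor>x\<rfloor>"
  define \<mu> where "\<mu> = x - of_int n"
  have mu: "0 \<le> \<mu>" "\<mu> < 1" unfolding \<mu>_def n_def by linarith+
  have lt: "intercept \<theta> p < icpt \<theta> k" for k
    using no assms(2) icpt_lattice[of \<theta> k] by (metis linorder_neqE_linordered_idom)
  have "0 < (1 - \<mu>) * (icpt \<theta> n - intercept \<theta> p)" using mu lt[of n] by simp
  moreover have "0 \<le> \<mu> * (icpt \<theta> (n + 1) - intercept \<theta> p)" using mu lt[of "n + 1"] by (intro mult_nonneg_nonneg) auto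
  moreover have "(1 - \<mu>) * (icpt \<theta> n - intercept \<theta> p) + \<mu> * (icpt \<theta> (n + 1) - intercept \<theta> p) = chord n x - y"
    unfolding \<mu>_def p intercept_def chord_def icpt_def by (simp add: algebra_simps power2_eq_square)
  moreover have "chord n x \<le> y" using assms(1) unfolding p Q_plus_iff by blast
  ultimately show False by linarith
qed

text \<open>
The sign of \<open>fst u\<close> selects the edges on the right or on the left, hence the flip that describes
the crossing.
\<close>

lemma exit_exists:
  assumes "icpt \<theta> k < b" "b \<notin> lattice \<theta>" "fst u \<noteq> 0"
  obtains n where "meets_edge \<theta> n b" "exits \<theta> u n" "flip (sgn (fst u) * \<theta>) b = icpt \<theta> n + icpt \<theta> (n + 1) - b"
proof (cases "0 < fst u")
  case True
  obtain n where n: "icpt \<theta> n < b" "b < icpt \<theta> (n + 1)" using flip_interval_exists[OF assms(1,2)] by blast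
  then have "\<theta> < 2 * of_int n + 1" using icpt_less_iff[of \<theta> n] by linarith
  then show ?thesis using that[of n] n flip_eq[OF n] True by (simp add: meets_edge_def exits_def)
next
  case False
  have "icpt (- \<theta>) (- k) < b" "b \<notin> lattice (- \<theta>)" using assms by (simp_all add: icpt_uminus lattice_uminus)
  then obtain m where m: "icpt (- \<theta>) m < b" "b < icpt (- \<theta>) (m + 1)" using flip_interval_exists by blast
  define n where "n = - m - 1"
  have nm: "icpt (- \<theta>) m = icpt \<theta> (n + 1)" "icpt (- \<theta>) (m + 1) = icpt \<theta> n" by (simp_all add: icpt_uminus n_def)
  have "2 * of_int n + 1 < \<theta>" using m icpt_less_iff[of "- \<theta>" m] by (simp add: n_def)
  then have "exits \<theta> u n" using False assms(3) by (simp add: exits_def mult_neg_neg)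
  then show ?thesis using that[of n] m flip_eq[OF m] False assms(3) unfolding nm by (simp add: meets_edge_def)
qed

lemma flip_above: "icpt \<theta> k < b \<Longrightarrow> \<exists>k. icpt \<theta> k < flip (s * \<theta>) b" if "s = 1 \<or> s = - 1" for s :: real
proof (cases rule: flip_cases[where \<theta> = "s * \<theta>" and b = b])
  case (flip n)
  have "icpt (s * \<theta>) n = icpt \<theta> n \<or> icpt (s * \<theta>) n = icpt \<theta> (- n)" using that by (auto simp: icpt_uminus)
  then show ?thesis using flip(4) by metis
qed auto

section \<open>Recurrence of the flow\<close>

context
  fixes v :: "real \<times> real" and \<theta> :: real
  assumes slope: "snd v = \<theta> * fst v" and v1: "fst v \<noteq> 0"
begin

text \<open>
The slope seen by a leaf in its direction of motion, so that \<open>flip (drift up)\<close> is the next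
crossing and \<open>return_map (drift up)\<close> the next return to the same polygon.
\<close>

definition drift :: "bool \<Rightarrow> real" where
  "drift up = sgn (fst (heading up v)) * \<theta>"

lemma drift_not: "drift (\<not> up) = - drift up"
  by (cases up) (simp_all add: drift_def heading_def sgn_minus)

lemma fst_heading: "fst (heading up v) \<noteq> 0"
  using v1 by (simp add: heading_def)

lemma drift_cases: "drift up = \<theta> \<or> drift up = - \<theta>"
  unfolding drift_def using fst_heading[of up] by (cases "0 < fst (heading up v)") simp_all

lemma lattice_drift: "lattice (drift up) = lattice \<theta>"
  using drift_cases[of up] by (auto simp: lattice_uminus)

lemma flip_drift_above: "icpt \<theta> k < b \<Longrightarrow> \<exists>k. icpt \<theta> k < flip (drift up) b"
  using flip_above[of "sgn (fst (heading up v))" \<theta> k b] fst_heading[of up]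
  unfolding drift_def by (auto simp: sgn_if)

lemma return_map_drift_above: "icpt \<theta> k < b \<Longrightarrow> \<exists>k. icpt \<theta> k < return_map (drift up) b"
proof -
  assume "icpt \<theta> k < b"
  then obtain l where "icpt \<theta> l < flip (drift up) b" using flip_drift_above by blast
  then show ?thesis using flip_drift_above[of l "flip (drift up) b" "\<not> up"]
    by (simp add: return_map_def drift_not)
qed

text \<open>
The starting point may lie on the edge through which the leaf leaves the polygon. The points of a
transversal that lie on an edge are treated in this way, as the final points of their chords.
\<close>

lemma flow_one_step:
  assumes p: "p \<in> interior Q_plus \<or> (\<exists>n. p \<in> edge n \<and> exits \<theta> (heading up v) n)"
    and g: "intercept \<theta> p \<notin> lattice \<theta>"
    and p': "p' \<in> interior Q_plus" "intercept \<theta> p' = flip (drift up) (intercept \<theta> p)"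
  shows "\<exists>t>0. flows_to S1_atlas v t (point up p) (point (\<not> up) p')"
  using p
proof
  assume i: "p \<in> interior Q_plus"
  then obtain k where "icpt \<theta> k < intercept \<theta> p" using intercept_above g interior_subset by blast
  then obtain n where n: "meets_edge \<theta> n (intercept \<theta> p)" "exits \<theta> (heading up v) n"
    "flip (drift up) (intercept \<theta> p) = icpt \<theta> n + icpt \<theta> (n + 1) - intercept \<theta> p"
    using exit_exists[OF _ g fst_heading] unfolding drift_def by metis
  show ?thesis using flow_across_edge[OF slope _ n(2,1) p'(1)] i p'(2) n(3) by simp
next
  assume "\<exists>n. p \<in> edge n \<and> exits \<theta> (heading up v) n"
  then obtain n where n: "p \<in> edge n" "exits \<theta> (heading up v) n" by blast
  have b: "meets_edge \<theta> n (intercept \<theta> p)" by (rule meets_edge_if[OF n(1) g exits_slope[OF n(2)]])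
  have "flip (drift up) (intercept \<theta> p) = icpt \<theta> n + icpt \<theta> (n + 1) - intercept \<theta> p"
  proof (cases "0 < fst (heading up v)")
    case True
    then have "\<theta> < 2 * of_int n + 1" using n(2) by (simp add: exits_def zero_less_mult_iff)
    then have "icpt \<theta> n < icpt \<theta> (n + 1)" using icpt_less_iff by blast
    then show ?thesis using True b flip_eq[of \<theta> n] by (auto simp: drift_def meets_edge_def)
  next
    case False
    then have neg: "fst (heading up v) < 0" using fst_heading[of up] by simp
    then have "2 * of_int n + 1 < \<theta>" using n(2) by (auto simp: exits_def zero_less_mult_iff)
    then have "\<not> icpt \<theta> n < icpt \<theta> (n + 1)" using icpt_less_iff[of \<theta> n] by simp
    then show ?thesis using neg b flip_eq[of "- \<theta>" "- n - 1" "intercept \<theta> p"]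
      by (auto simp: drift_def meets_edge_def icpt_uminus add_ac)
  qed
  then show ?thesis using flow_across_edge[OF slope _ n(2) b p'(1)] n(1) p'(2) by simp
qed

lemma flow_return:
  assumes p: "p \<in> interior Q_plus \<or> (\<exists>n. p \<in> edge n \<and> exits \<theta> (heading up v) n)"
    and g: "intercept \<theta> p \<notin> lattice \<theta>"
    and p': "p' \<in> interior Q_plus" "intercept \<theta> p' = return_map (drift up) (intercept \<theta> p)"
  shows "\<exists>t>0. flows_to S1_atlas v t (point up p) (point up p')"
proof -
  define c where "c = flip (drift up) (intercept \<theta> p)"
  have cg: "c \<notin> lattice \<theta>" unfolding c_def using flip_lattice[of _ "drift up"] g lattice_drift by metis
  have "p \<in> Q_plus" using p interior_subset edge_subset_Q_plus by blast
  then obtain k where "icpt \<theta> k < intercept \<theta> p" using intercept_above g by blast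
  then obtain l where "icpt \<theta> l < c" unfolding c_def using flip_drift_above by blast
  then obtain p1 where p1: "p1 \<in> interior Q_plus" "intercept \<theta> p1 = c" by (rule vertical_point)
  obtain t1 where t1: "0 < t1" "flows_to S1_atlas v t1 (point up p) (point (\<not> up) p1)"
    using flow_one_step[OF p g p1(1)] p1(2) c_def by auto
  have "intercept \<theta> p' = flip (drift (\<not> up)) (intercept \<theta> p1)"
    using p'(2) p1(2) by (simp add: return_map_def drift_not c_def)
  then obtain t2 where t2: "0 < t2" "flows_to S1_atlas v t2 (point (\<not> up) p1) (point up p')"
    using flow_one_step[of p1 "\<not> up" p'] p1 cg p'(1) by auto
  have "flows_to S1_atlas v (t1 + t2) (point up p) (point up p')"
    using flows_to_concat[OF t1(2) t2(2) p1(1)] t1(1) t2(1) by simp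
  then show ?thesis using t1(1) t2(1) by (intro exI[of _ "t1 + t2"]) simp
qed

lemma flow_iterated_return:
  assumes p: "p \<in> interior Q_plus \<or> (\<exists>n. p \<in> edge n \<and> exits \<theta> (heading up v) n)"
    and g: "intercept \<theta> p \<notin> lattice \<theta>"
    and p': "p' \<in> interior Q_plus" "intercept \<theta> p' = (return_map (drift up) ^^ Suc k) (intercept \<theta> p)"
  shows "\<exists>t>0. flows_to S1_atlas v t (point up p) (point up p')"
  using p'
proof (induction k arbitrary: p')
  case 0
  then show ?case using flow_return[OF p g] by simp
next
  case (Suc k)
  define c where "c = (return_map (drift up) ^^ Suc k) (intercept \<theta> p)"
  have cg: "c \<notin> lattice \<theta>" unfolding c_def using return_map_funpow_lattice g lattice_drift by metis
  have "p \<in> Q_plus" using p interior_subset edge_subset_Q_plus by blast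
  then obtain l where "icpt \<theta> l < intercept \<theta> p" using intercept_above g by blast
  then have "\<exists>l. icpt \<theta> l < (return_map (drift up) ^^ i) (intercept \<theta> p)" for i
  proof (induction i)
    case (Suc i)
    then obtain l where "icpt \<theta> l < (return_map (drift up) ^^ i) (intercept \<theta> p)" by blast
    then show ?case using return_map_drift_above by simp
  qed auto
  then obtain l where "icpt \<theta> l < c" unfolding c_def by blast
  then obtain p1 where p1: "p1 \<in> interior Q_plus" "intercept \<theta> p1 = c" by (rule vertical_point)
  obtain t1 where t1: "0 < t1" "flows_to S1_atlas v t1 (point up p) (point up p1)"
    using Suc.IH[OF p1(1)] p1(2) c_def by auto
  have "intercept \<theta> p' = return_map (drift up) (intercept \<theta> p1)"
    using Suc.prems(2) p1(2) by (simp add: c_def)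
  then obtain t2 where t2: "0 < t2" "flows_to S1_atlas v t2 (point up p1) (point up p')"
    using flow_return[of p1 up p'] p1 cg Suc.prems(1) by auto
  have "flows_to S1_atlas v (t1 + t2) (point up p) (point up p')"
    using flows_to_concat[OF t1(2) t2(2) p1(1)] t1(1) t2(1) by simp
  then show ?case using t1(1) t2(1) by (intro exI[of _ "t1 + t2"]) simp
qed

text \<open>
If the target is on an edge, it is reached from an interior point of its chord, to which the leaf
comes first.
\<close>

lemma flow_to_returning_point:
  assumes p: "p \<in> interior Q_plus \<or> (\<exists>n. p \<in> edge n \<and> exits \<theta> (heading up v) n)"
    and g: "intercept \<theta> p \<notin> lattice \<theta>"
    and p': "p' \<in> interior Q_plus \<or> (\<exists>n. p' \<in> edge n \<and> exits \<theta> (heading up v) n)"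
      "intercept \<theta> p' = (return_map (drift up) ^^ k) (intercept \<theta> p)" "1 \<le> k"
  shows "\<exists>t>0. flows_to S1_atlas v t (point up p) (point up p')"
proof -
  obtain i where k: "k = Suc i" using p'(3) by (cases k) auto
  have g': "intercept \<theta> p' \<notin> lattice \<theta>" unfolding p'(2) using return_map_funpow_lattice g lattice_drift by metis
  show ?thesis
    using p'(1)
  proof
    assume "p' \<in> interior Q_plus"
    then show ?thesis using flow_iterated_return[OF p g] p'(2) k by blast
  next
    assume "\<exists>n. p' \<in> edge n \<and> exits \<theta> (heading up v) n"
    then obtain n where n: "p' \<in> edge n" "exits \<theta> (heading up v) n" by blast
    have b: "meets_edge \<theta> n (intercept \<theta> p')" by (rule meets_edge_if[OF n(1) g' exits_slope[OF n(2)]])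
    obtain l where "icpt \<theta> l < intercept \<theta> p'" using intercept_above g' edge_subset_Q_plus n(1) by blast
    then obtain p1 where p1: "p1 \<in> interior Q_plus" "intercept \<theta> p1 = intercept \<theta> p'" by (rule vertical_point)
    obtain t1 where t1: "0 < t1" "flows_to S1_atlas v t1 (point up p) (point up p1)"
      using flow_iterated_return[OF p g p1(1)] p1(2) p'(2) k by metis
    obtain t2 where t2: "0 < t2" "flows_to S1_atlas v t2 (point up p1) (point up p')"
      using flow_to_edge[OF slope p1(1) n(2,1)] p1(2) b by auto
    have "flows_to S1_atlas v (t1 + t2) (point up p) (point up p')"
      using flows_to_concat[OF t1(2) t2(2) p1(1)] t1(1) t2(1) by simp
    then show ?thesis using t1(1) t2(1) by (intro exI[of _ "t1 + t2"]) simp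
  qed
qed

text \<open>
Along such a piece of a transversal the intercept is an affine function of the transverse
coordinate. So the points that do not come back correspond to intercepts that escape from a
bounded Borel set, and these are negligible. The intercepts in \<open>lattice \<theta>\<close> are discarded because
their leaves may meet a vertex.
\<close>

lemma piece_recurrent:
  fixes K :: "real set" and p :: "real \<Rightarrow> real \<times> real"
  assumes irr: "\<theta> \<notin> \<rat>" and K: "K \<in> sets borel" "bounded K" and c: "c \<noteq> 0"
    and p: "\<And>s. s \<in> K \<Longrightarrow> p s \<in> interior Q_plus \<or> (\<exists>n. p s \<in> edge n \<and> exits \<theta> (heading up v) n)"
    and b: "\<And>s. s \<in> K \<Longrightarrow> intercept \<theta> (p s) = a + c * s"
  shows "\<exists>N\<in>null_sets lborel. \<forall>s\<in>K - N. \<exists>t>0. \<exists>s'\<in>K. flows_to S1_atlas v t (point up (p s)) (point up (p s'))"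
proof -
  define B where "B = (\<lambda>s. a + c * s) ` K"
  have "B = (\<lambda>b. - a / c + (1 / c) * b) -` K"
  proof (intro set_eqI iffI)
    fix b assume "b \<in> (\<lambda>b. - a / c + (1 / c) * b) -` K"
    moreover have "b = a + c * (- a / c + (1 / c) * b)" using c by (simp add: field_simps)
    ultimately show "b \<in> B" unfolding B_def by blast
  qed (use c in \<open>auto simp: B_def field_simps\<close>)
  moreover have "(\<lambda>b. - a / c + (1 / c) * b) \<in> borel_measurable borel" by measurable
  ultimately have Bb: "B \<in> sets borel" using measurable_vimage_borel K(1) by metis
  obtain M where M: "\<And>s. s \<in> K \<Longrightarrow> \<bar>s\<bar> \<le> M" using K(2) by (auto simp: bounded_iff)
  have bdd: "bdd_above B"
  proof (rule bdd_aboveI)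
    fix x assume "x \<in> B"
    then obtain s where s: "s \<in> K" "x = a + c * s" by (auto simp: B_def)
    have "c * s \<le> \<bar>c\<bar> * \<bar>s\<bar>" by (metis abs_ge_self abs_mult)
    also have "\<dots> \<le> \<bar>c\<bar> * M" using M[OF s(1)] by (intro mult_left_mono) auto
    finally show "x \<le> a + \<bar>c\<bar> * M" using s by simp
  qed
  define E where "E = escaping (return_map (drift up)) B \<union> lattice \<theta>"
  have "drift up \<notin> \<rat>" using drift_cases[of up] irr by (auto simp: Rats_minus_iff)
  then have E: "E \<in> null_sets lborel" unfolding E_def
    using return_map_conservative Bb bdd countable_imp_null_set_lborel[OF countable_lattice] by blast
  show ?thesis
  proof (intro bexI ballI)
    show "(\<lambda>s. a + c * s) -` E \<in> null_sets lborel" by (rule null_vimage_affine[OF c E])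
    fix s assume s: "s \<in> K - (\<lambda>s. a + c * s) -` E"
    then have bs: "intercept \<theta> (p s) = a + c * s" "intercept \<theta> (p s) \<notin> E" using b by auto
    have "intercept \<theta> (p s) \<in> B" using s bs(1) by (auto simp: B_def)
    then obtain k where k: "1 \<le> k" "(return_map (drift up) ^^ k) (intercept \<theta> (p s)) \<in> B"
      using bs(2) by (auto simp: E_def escaping_def)
    then obtain s' where s': "s' \<in> K" "(return_map (drift up) ^^ k) (intercept \<theta> (p s)) = a + c * s'"
      by (auto simp: B_def)
    have "\<exists>t>0. flows_to S1_atlas v t (point up (p s)) (point up (p s'))"
    proof (rule flow_to_returning_point[OF p _ p _ k(1)])
      show "s \<in> K" "s' \<in> K" using s s' by auto
      show "intercept \<theta> (p s) \<notin> lattice \<theta>" using bs(2) by (simp add: E_def)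
      show "intercept \<theta> (p s') = (return_map (drift up) ^^ k) (intercept \<theta> (p s))" using b[OF s'(1)] s'(2) by simp
    qed
    then show "\<exists>t>0. \<exists>s'\<in>K. flows_to S1_atlas v t (point up (p s)) (point up (p s'))" using s'(1) by blast
  qed
qed

text \<open>
The piece is divided according to the polygon that its points are about to leave. A point on the
edge \<open>n\<close> is counted for the polygon out of which the flow crosses that edge.
\<close>

lemma chart_piece_recurrent:
  fixes K :: "real set" and c :: "real \<Rightarrow> real \<times> real"
  assumes irr: "\<theta> \<notin> \<rat>" and K: "K \<in> sets borel" "bounded K" "continuous_on K c"
    and c: "\<And>s. s \<in> K \<Longrightarrow> c s \<in> chart_domain n \<and> \<sigma> s = chart n (c s)"
    and d: "\<And>s. s \<in> K \<Longrightarrow> transverse_coord v (c s) = s + d"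
  shows "\<exists>N\<in>null_sets lborel. \<forall>s\<in>K - N. \<exists>t>0. \<exists>s'\<in>K. flows_to S1_atlas v t (\<sigma> s) (\<sigma> s')"
proof -
  have k0: "2 * of_int n + 1 - \<theta> \<noteq> 0"
  proof
    assume "2 * of_int n + 1 - \<theta> = 0"
    then have "\<theta> = of_int (2 * n + 1)" by simp
    then show False using irr by (metis Rats_of_int)
  qed
  have ex: "exits \<theta> (heading True v) n \<or> exits \<theta> (heading False v) n"
    using k0 v1 unfolding exits_def heading_def by (simp add: zero_less_mult_iff mult_less_0_iff) linarith
  define S where "S up = {q. (\<exists>p. q = in_chart n up p \<and> p \<in> interior Q_plus)} \<union>
      (if exits \<theta> (heading up v) n then edge n else {})" for up
  have "closed (edge n)" by (simp add: edge_def)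
  moreover have "{q. \<exists>p. q = in_chart n True p \<and> p \<in> interior Q_plus} = interior Q_plus"
    by (auto simp: in_chart_def)
  moreover have "{q. \<exists>p. q = in_chart n False p \<and> p \<in> interior Q_plus} = (\<lambda>q. q - shift n) ` interior Q_minus"
    unfolding Q_minus_def interior_negations image_image in_chart_def if_False by blast
  moreover have "open ((\<lambda>q. q - shift n) ` interior Q_minus)" by (rule open_translation_subtract[OF open_interior])
  ultimately have Sb: "S up \<in> sets borel" for up
    unfolding S_def by (cases up) (simp_all add: sets.Un borel_open borel_closed)
  define P where "P up = {s \<in> K. c s \<in> S up}" for up
  have Pb: "P up \<in> sets borel" for up unfolding P_def by (rule borel_preimage_on[OF K(3,1) Sb])
  have bP: "bounded (P up)" for up unfolding P_def using K(2) by (rule bounded_subset) auto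
  define p where "p up s = (if up then c s else - c s - shift n)" for up s
  have chart_p: "in_chart n up (p up s) = c s" for up s by (simp add: p_def in_chart_def)
  have inj: "q = p up s" if "c s = in_chart n up q" for q up s using that by (auto simp: p_def in_chart_def)
  have edge_p: "p up s \<in> edge n" if "c s \<in> edge n" for up s
    using that reflect_edge by (simp add: p_def)
  have vertex_p: "p up s \<notin> range vertex" if "c s \<in> edge n" "c s \<in> chart_domain n" for up s
  proof -
    have "c s \<notin> range vertex"
    proof
      assume vx: "c s \<in> range vertex"
      then have "c s \<notin> open_segment (vertex n) (vertex (n + 1))" by (simp add: open_edge_eq)
      moreover have "vertex k \<notin> interior Q_plus" for k
        using edge_notin_interior[of "vertex k" k] by (simp add: edge_def)
      moreover have "c s \<notin> (\<lambda>q. q - shift n) ` interior Q_minus"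
      proof
        assume "c s \<in> (\<lambda>q. q - shift n) ` interior Q_minus"
        then obtain q where "q \<in> interior Q_minus" "c s = q - shift n" by blast
        then have "c s \<notin> Q_plus" using interior_Q_minus_below by simp
        then show False using that(1) edge_subset_Q_plus by blast
      qed
      ultimately show False using that(2) vx unfolding chart_domain_def by auto
    qed
    then show ?thesis using reflect_vertex that(1) by (simp add: p_def)
  qed
  have pP: "p up s \<in> interior Q_plus \<or> (\<exists>m. p up s \<in> edge m \<and> exits \<theta> (heading up v) m)"
    and pt: "\<sigma> s = point up (p up s)" if "s \<in> P up" for s up
  proof -
    have s: "s \<in> K" "c s \<in> S up" using that by (auto simp: P_def)
    have cs: "p up s \<in> interior Q_plus \<or> c s \<in> edge n \<and> exits \<theta> (heading up v) n"
      using s(2) inj unfolding S_def by (auto split: if_splits)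
    then show "p up s \<in> interior Q_plus \<or> (\<exists>m. p up s \<in> edge m \<and> exits \<theta> (heading up v) m)"
      using edge_p by blast
    have ch: "\<sigma> s = chart n (in_chart n up (p up s))" using c[OF s(1)] chart_p by simp
    show "\<sigma> s = point up (p up s)"
    proof (cases "p up s \<in> interior Q_plus")
      case True
      then show ?thesis unfolding ch by (rule in_chart_interior(2))
    next
      case False
      then have "c s \<in> edge n" using cs by blast
      then show ?thesis unfolding ch using edge_p vertex_p c[OF s(1)] by (intro in_chart_edge(2)) auto
    qed
  qed
  have cover: "s \<in> P True \<or> s \<in> P False" if s: "s \<in> K" for s
  proof -
    consider "c s \<in> interior Q_plus" | "c s \<in> edge n" | "c s \<in> (\<lambda>q. q - shift n) ` interior Q_minus"
      using c[OF s] open_edge_eq[of n] unfolding chart_domain_def by blast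
    then have "c s \<in> S True \<or> c s \<in> S False"
    proof cases
      case 1
      then show ?thesis by (simp add: S_def in_chart_def)
    next
      case 2
      then show ?thesis using ex by (auto simp: S_def)
    next
      case 3
      then obtain q where q: "q \<in> interior Q_minus" "c s = q - shift n" by blast
      then have "- q \<in> interior Q_plus" "c s = in_chart n False (- q)"
        by (auto simp: Q_minus_def interior_negations in_chart_def)
      then show ?thesis unfolding S_def by blast
    qed
    then show ?thesis using s by (simp add: P_def)
  qed
  have tc: "intercept \<theta> (c s) = d / fst v + (1 / fst v) * s" if "s \<in> K" for s
  proof -
    have "fst v * intercept \<theta> (c s) = s + d"
      using d[OF that] slope by (simp add: transverse_coord_def intercept_def algebra_simps)
    then show ?thesis using v1 by (simp add: field_simps)
  qed
  have piece: "\<exists>N\<in>null_sets lborel. \<forall>s\<in>P up - N. \<exists>t>0. \<exists>s'\<in>P up. flows_to S1_atlas v t (\<sigma> s) (\<sigma> s')" for up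
  proof -
    define a where "a = (if up then d / fst v else - d / fst v - intercept \<theta> (shift n))"
    define k where "k = (if up then 1 / fst v else - 1 / fst v)"
    have k: "k \<noteq> 0" using v1 by (simp add: k_def)
    have ic: "intercept \<theta> (p up s) = a + k * s" if "s \<in> P up" for s
    proof -
      have "intercept \<theta> (- c s - shift n) = - intercept \<theta> (c s) - intercept \<theta> (shift n)"
        by (simp add: intercept_def algebra_simps)
      then show ?thesis using tc[of s] that by (simp add: p_def a_def k_def P_def)
    qed
    have "\<exists>N\<in>null_sets lborel. \<forall>s\<in>P up - N. \<exists>t>0. \<exists>s'\<in>P up.
        flows_to S1_atlas v t (point up (p up s)) (point up (p up s'))"
      by (rule piece_recurrent[where p = "p up" and a = a and c = k, OF irr Pb bP k pP ic])
    then obtain N where N: "N \<in> null_sets lborel"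
      "\<forall>s\<in>P up - N. \<exists>t>0. \<exists>s'\<in>P up. flows_to S1_atlas v t (point up (p up s)) (point up (p up s'))" ..
    have "\<exists>t>0. \<exists>s'\<in>P up. flows_to S1_atlas v t (\<sigma> s) (\<sigma> s')" if "s \<in> P up - N" for s
    proof -
      from bspec[OF N(2) that] obtain t s' where ts: "0 < t" "s' \<in> P up"
        "flows_to S1_atlas v t (point up (p up s)) (point up (p up s'))" by (elim exE conjE bexE)
      then have "flows_to S1_atlas v t (\<sigma> s) (\<sigma> s')" using pt[of s up] pt[of s' up] that by simp
      then show ?thesis using ts(1,2) by (intro exI[of _ t] conjI bexI[of _ s'])
    qed
    then show ?thesis using N(1) by (intro bexI[of _ N] ballI)
  qed
  from piece[of True] obtain N1 where N1: "N1 \<in> null_sets lborel"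
    "\<forall>s\<in>P True - N1. \<exists>t>0. \<exists>s'\<in>P True. flows_to S1_atlas v t (\<sigma> s) (\<sigma> s')" ..
  from piece[of False] obtain N2 where N2: "N2 \<in> null_sets lborel"
    "\<forall>s\<in>P False - N2. \<exists>t>0. \<exists>s'\<in>P False. flows_to S1_atlas v t (\<sigma> s) (\<sigma> s')" ..
  have PK: "P up \<subseteq> K" for up by (auto simp: P_def)
  show ?thesis
  proof (intro bexI[of _ "N1 \<union> N2"] ballI)
    show "N1 \<union> N2 \<in> null_sets lborel" using N1(1) N2(1) by blast
    fix s assume s: "s \<in> K - (N1 \<union> N2)"
    show "\<exists>t>0. \<exists>s'\<in>K. flows_to S1_atlas v t (\<sigma> s) (\<sigma> s')"
    proof (cases "s \<in> P True")
      case True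
      then have "s \<in> P True - N1" using s by simp
      from bspec[OF N1(2) this] show ?thesis using PK by (elim exE conjE bexE) (intro exI conjI bexI, auto)
    next
      case False
      then have "s \<in> P False - N2" using s cover by auto
      from bspec[OF N2(2) this] show ?thesis using PK by (elim exE conjE bexE) (intro exI conjI bexI, auto)
    qed
  qed
qed

text \<open>
A transversal is covered by countably many pieces, each within one chart, cut out by intervals
with rational endpoints. It suffices that almost every point of a piece returns to the same piece.
\<close>

lemma transversal_recurrent:
  assumes irr: "\<theta> \<notin> \<rat>" and tr: "transversal S1_atlas v J \<sigma>" and bJ: "bounded J"
  shows "AE s in lebesgue_on J. \<exists>t>0. \<exists>y\<in>\<sigma> ` J. flows_to S1_atlas v t (\<sigma> s) y"
proof -
  have iv: "is_interval J" using tr by (simp add: transversal_def)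
  then have Jb: "J \<in> sets borel" by (rule real_interval_borel_measurable)
  define R where "R K N \<longleftrightarrow> N \<in> null_sets lborel \<and> (\<forall>s\<in>K - N. \<exists>t>0. \<exists>s'\<in>K. flows_to S1_atlas v t (\<sigma> s) (\<sigma> s'))" for K N
  define I where "I = (\<lambda>(a, b). J \<inter> {real_of_rat a <..< real_of_rat b})"
  define G where "G = {ab. \<exists>N. R (I ab) N}"
  have near: "\<exists>ab\<in>G. s \<in> I ab" if s: "s \<in> J" for s
  proof -
    obtain n c e where e: "0 < e" "continuous_on (J \<inter> ball s e) c"
      "\<And>r. r \<in> J \<inter> ball s e \<Longrightarrow> c r \<in> chart_domain n \<and> \<sigma> r = chart n (c r) \<and>
         transverse_coord v (c r) - transverse_coord v (c s) = r - s"
      using tr s unfolding transversal_def S1_atlas_def by fastforce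
    obtain a where a: "s - e < real_of_rat a" "real_of_rat a < s" using of_rat_dense[of "s - e" s] e(1) by auto
    obtain b where b: "s < real_of_rat b" "real_of_rat b < s + e" using of_rat_dense[of s "s + e"] e(1) by auto
    have sub: "I (a, b) \<subseteq> J \<inter> ball s e" using a b by (auto simp: I_def dist_real_def)
    have "I (a, b) \<in> sets borel" using Jb by (simp add: I_def)
    moreover have "bounded (I (a, b))" using bJ by (rule bounded_subset) (auto simp: I_def)
    moreover have "continuous_on (I (a, b)) c" using e(2) sub by (rule continuous_on_subset)
    moreover have "c r \<in> chart_domain n \<and> \<sigma> r = chart n (c r)" if "r \<in> I (a, b)" for r using e(3) sub that by blast
    moreover have "transverse_coord v (c r) = r + (transverse_coord v (c s) - s)" if "r \<in> I (a, b)" for r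
      using e(3)[OF subsetD[OF sub that]] by simp
    ultimately have "\<exists>N\<in>null_sets lborel. \<forall>r\<in>I (a, b) - N. \<exists>t>0. \<exists>s'\<in>I (a, b). flows_to S1_atlas v t (\<sigma> r) (\<sigma> s')"
      by (rule chart_piece_recurrent[OF irr])
    then have "(a, b) \<in> G" by (auto simp: G_def R_def)
    moreover have "s \<in> I (a, b)" using s a b by (simp add: I_def)
    ultimately show ?thesis by blast
  qed
  define N where "N ab = (SOME N. R (I ab) N)" for ab
  have N: "R (I ab) (N ab)" if "ab \<in> G" for ab
    using that someI_ex[of "R (I ab)"] unfolding G_def N_def by blast
  define M where "M = (\<Union>ab\<in>G. N ab)"
  have "M \<in> null_sets lborel" unfolding M_def using N by (intro null_sets_UN') (auto simp: R_def)
  have "\<exists>t>0. \<exists>y\<in>\<sigma> ` J. flows_to S1_atlas v t (\<sigma> s) y" if s: "s \<in> J" "s \<notin> M" for s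
  proof -
    obtain ab where ab: "ab \<in> G" "s \<in> I ab" using near s(1) by blast
    then have "s \<in> I ab - N ab" using s(2) by (auto simp: M_def)
    then obtain t s' where "0 < t" "s' \<in> I ab" "flows_to S1_atlas v t (\<sigma> s) (\<sigma> s')"
      using N[OF ab(1)] unfolding R_def by blast
    then show ?thesis by (auto simp: I_def split: prod.splits)
  qed
  then have "AE s in lborel. s \<in> J \<longrightarrow> (\<exists>t>0. \<exists>y\<in>\<sigma> ` J. flows_to S1_atlas v t (\<sigma> s) y)"
    using \<open>M \<in> null_sets lborel\<close> by (intro AE_I'[of M]) auto
  then have "AE s in lebesgue. s \<in> J \<longrightarrow> (\<exists>t>0. \<exists>y\<in>\<sigma> ` J. flows_to S1_atlas v t (\<sigma> s) y)"
    by (rule AE_completion)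
  moreover have "J \<inter> space lebesgue \<in> sets lebesgue" using Jb by simp
  ultimately show ?thesis by (simp add: AE_restrict_space_iff)
qed

end

theorem theorem13:
  fixes \<theta> :: real and v :: "real \<times> real"
  assumes "\<theta> \<notin> \<rat>"
    and "norm v = 1" and "snd v = \<theta> * fst v"
  shows "recurrent S1_atlas v"
proof -
  have "fst v \<noteq> 0"
  proof
    assume "fst v = 0"
    then have "v = 0" using assms(3) by (simp add: prod_eq_iff)
    then show False using assms(2) by simp
  qed
  then show ?thesis
    unfolding recurrent_def using transversal_recurrent[OF assms(3) _ assms(1)] by blast
qed

end
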